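(* Let $X$ be a globular cardinal. The $\omega$-functor $L\colon\mathfrak{F}X\to\mathfrak{F}\,\Gamma X$, from the free $\omega$-category on $X$ to the free $\omega$-category on the ordinal graph $\Gamma X$ corresponding to $X$, is an isomorphism of $\omega$-categories.
   Context: $\omega$-categories. A $0$-category is a set (discrete category), an $n$-category ($n\ge1$) is a category enriched in the cartesian category of $(n-1)$-categories, and $\omega\mathrm{Cat}$ is the colimit of the inclusions $0\text{-Cat}\to1\text{-Cat}\to2\text{-Cat}\to\cdots$. Globular cardinals. A globular set $X$ is a sequence of sets $X_n$ ($n\ge0$) with maps $s_n,t_n\colon X_{n+1}\to X_n$ such that $s_ns_{n+1}=s_nt_{n+1}$ and $t_ns_{n+1}=t_nt_{n+1}$; morphisms commute with sources and targets. $X$ has dimension $n$ if $X_m=\emptyset$ for all $m>n$; the empty globular set has dimension $-1$. The relation $\blacktriangleleft$ on the set of all elements of $X$ is the reflexive-transitive closure of: $x\prec y$ when $x=s(y)$ or $y=t(x)$. A globular cardinal is a globular set with finitely many elements in total for which $\blacktriangleleft$ is a linear order; $\mathrm{GlobCard}$ is the full subcategory of globular sets on these. For a finite linearly ordered set $A$ write $A\backslash\mathrm{f}$ for $A$ without its first element and $\mathrm{p}x$ for the predecessor of $x\in A\backslash\mathrm{f}$. For consecutive $y,z\in X_0$, $X(y,z)$ is the globular cardinal with $X(y,z)_k=\{x\in X_{k+1} : y\blacktriangleleft x\blacktriangleleft z\}$ and source and target maps those of $X$; a morphism $\gamma\colon Y\to X$ of globular cardinals maps consecutive elements of $Y_0$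 to consecutive elements of $X_0$ and restricts to $\gamma(y,z)\colon Y(y,z)\to X(\gamma y,\gamma z)$. Free $\omega$-category on a globular cardinal $X$. The $n$-cells of $\mathfrak{F}X$ are the isomorphism classes of objects $\gamma\colon Y\to X$ of the slice $\mathrm{GlobCard}/X$ with $Y$ a nonempty globular cardinal of dimension $n$ (i.e. $Y_m=\emptyset$ for $m>n$); an $n$-cell regarded as an $(n+1)$-cell is its identity. For a globular cardinal $Y$ and elements $x,y$ consecutive in $Y_n$, $Y[x,y]$ is the largest globular subset of $Y$ with $Y[x,y]_n=\{x,y\}$. The $0$-source $\mathrm{s}_0Y$ (resp. $0$-target $\mathrm{t}_0Y$) is the smallest globular subset containing the least (resp. greatest) element of $Y$; for $m\ge1$, $\mathrm{s}_mY$ (resp. $\mathrm{t}_mY$) is the smallest globular subset containing $Y_\ell$ for all $\ell<m$ and the least (resp. greatest) element of $Y[\mathrm{p}y,y]_m$ (whenever this set is nonempty) for all $y\in Y_{m-1}\backslash\mathrm{f}$. The $m$-domain (resp. $m$-codomain) of $\gamma$ is its restriction along $\mathrm{s}_mY\to Y$ (resp. $\mathrm{t}_mY\to Y$). If $\alpha\colon Y\to X$ and $\beta\colon Z\to X$ are $n$-cells with $\mathrm{dom}_m\beta=\mathrm{cod}_m\alpha$, there is a unique isomorphism $\delta\colon\mathrm{s}_mZ\to\mathrm{t}_mY$ over $X$, and $\beta\circ_m\alpha$ is the induced morphism to $X$ from the pushout of $Z\leftarrow\mathrm{s}_mZ\to Y$ (inclusion on the left, $\delta$ followed by inclusion on the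 right). Ordinal graphs. For a category $\mathcal{V}$, a $\mathcal{V}$-graph $\mathcal{G}$ is a set $\mathrm{Ob}\,\mathcal{G}$ with an edge-object $\mathcal{G}(x,y)\in\mathcal{V}$ for all $x,y\in\mathrm{Ob}\,\mathcal{G}$; morphisms consist of a map $f$ on objects and morphisms $\mathcal{G}(x,y)\to\mathcal{H}(fx,fy)$. Ordinal graphs are defined inductively: the empty graph is the ordinal graph of dimension $-1$; an ordinal graph $\mathcal{G}$ of dimension $0$ is a linearly ordered set with at most one element, its only edge-object (if any) being empty; an ordinal graph of dimension $n+1$ is a finite linearly ordered set $\mathrm{Ob}\,\mathcal{G}$ with edge-objects $\mathcal{G}(x,y)$ that are ordinal graphs of dimension $n$, nonempty if and only if $y$ is the successor of $x$. Morphisms are morphisms of (iterated) enriched graphs. $\Gamma$ sends the empty globular cardinal to the empty ordinal graph and otherwise $\Gamma X=\mathcal{G}$ with $\mathrm{Ob}\,\mathcal{G}=X_0$ and $\mathcal{G}(\mathrm{p}x,x)=\Gamma(X(\mathrm{p}x,x))$ for $x\in X_0\backslash\mathrm{f}$, other edge-objects being empty. Free $\omega$-category on an ordinal graph $\mathcal{G}$. $\mathfrak{F}$ of the empty graph is the empty $\omega$-category. Otherwise, if $\mathrm{Ob}\,\mathcal{G}=\{x_0<\dots<x_p\}$, $\mathfrak{F}\mathcal{G}$ has objects $\mathrm{Ob}\,\mathcal{G}$ and hom-$\omega$-categories: $(\mathfrak{F}\mathcal{G})(x_h,x_k)=\mathfrak{F}(\mathcal{G}(x_{k-1},x_k))\times\cdots\times\mathfrak{F}(\mathcal{G}(x_h,x_{h+1}))$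 if $h<k$, the terminal $\omega$-category if $h=k$, and the empty one if $h>k$; composition is concatenation of sequences. Thus an $n$-cell ($n\ge1$) from $x_h$ to $x_k$ is a sequence $(y_i)_{i=h+1}^k$ of $(n-1)$-cells $y_i$ of $\mathfrak{F}(\mathcal{G}(x_{i-1},x_i))$, with $m$-domains, $m$-codomains ($1\le m<n$) and $m$-compositions ($1\le m<n$) computed componentwise from the $(m-1)$-domains, $(m-1)$-codomains and $(m-1)$-compositions. The $\omega$-functor $L$, defined by induction on the dimension of $X$ and on the dimension of cells. For $X$ empty both sides are empty. A $0$-cell $\gamma\colon Y\to X$ (with $Y=\{y\}$) goes to $\gamma_0(y)\in X_0$. An $(m+1)$-cell $\gamma\colon Y\to X$, with $y_0$ and $y_p$ the first and last elements of $Y_0$, goes to the $(m+1)$-cell from $\gamma y_0$ to $\gamma y_p$ given by the sequence $\big(L(\gamma(\mathrm{p}y,y))\big)_{y\in Y_0\backslash\mathrm{f}}$ in $\prod_{y\in Y_0\backslash\mathrm{f}}\mathfrak{F}\big((\Gamma X)(\gamma\mathrm{p}y,\gamma y)\big)$ (the empty sequence, i.e. the unique cell of the terminal hom at $\gamma y_0$, if $Y_0=\{y_0\}$). *)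

theory Defs
  imports Main
begin

section \<open>Strict \<open>\<omega>\<close>-categories\<close>

text \<open>
  The data of an \<open>\<omega>\<close>-category: \<open>mdom C m n a\<close> and \<open>mcod C m n a\<close> are the \<open>m\<close>-domain and
  \<open>m\<close>-codomain (\<open>m < n\<close>) of an \<open>n\<close>-cell \<open>a\<close>, \<open>ident C n a\<close> is \<open>a\<close> regarded as an
  \<open>(n+1)\<close>-cell, and \<open>mcomp C m n b a\<close> is the composite of \<open>n\<close>-cells "\<open>b\<close> after \<open>a\<close>" along
  their common \<open>m\<close>-cell (\<open>m < n\<close>).  Outside these ranges the values carry no meaning.
\<close>

record 'c ocat =
  ncells :: "nat \<Rightarrow> 'c set"
  mdom :: "nat \<Rightarrow> nat \<Rightarrow> 'c \<Rightarrow> 'c"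
  mcod :: "nat \<Rightarrow> nat \<Rightarrow> 'c \<Rightarrow> 'c"
  ident :: "nat \<Rightarrow> 'c \<Rightarrow> 'c"
  mcomp :: "nat \<Rightarrow> nat \<Rightarrow> 'c \<Rightarrow> 'c \<Rightarrow> 'c"

definition hom_ocat :: "'c ocat \<Rightarrow> 'c \<Rightarrow> 'c \<Rightarrow> 'c ocat" where
  "hom_ocat C x y =
     \<lparr> ncells = (\<lambda>n. {a \<in> ncells C (Suc n). mdom C 0 (Suc n) a = x \<and> mcod C 0 (Suc n) a = y}),
       mdom = (\<lambda>m n. mdom C (Suc m) (Suc n)),
       mcod = (\<lambda>m n. mcod C (Suc m) (Suc n)),
       ident = (\<lambda>n. ident C (Suc n)),
       mcomp = (\<lambda>m n. mcomp C (Suc m) (Suc n)) \<rparr>"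

definition prod_ocat :: "'c ocat \<Rightarrow> 'd ocat \<Rightarrow> ('c \<times> 'd) ocat" where
  "prod_ocat C D =
     \<lparr> ncells = (\<lambda>n. ncells C n \<times> ncells D n),
       mdom = (\<lambda>m n. map_prod (mdom C m n) (mdom D m n)),
       mcod = (\<lambda>m n. map_prod (mcod C m n) (mcod D m n)),
       ident = (\<lambda>n. map_prod (ident C n) (ident D n)),
       mcomp = (\<lambda>m n b a. (mcomp C m n (fst b) (fst a), mcomp D m n (snd b) (snd a))) \<rparr>"

text \<open>
  A functor enriched at every level, written out on cells: the functors on hom-categories
  at all levels together are one family of maps on \<open>n\<close>-cells.
\<close>

definition ofunctor :: "'c ocat \<Rightarrow> 'd ocat \<Rightarrow> (nat \<Rightarrow> 'c \<Rightarrow> 'd) \<Rightarrow> bool" where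
  "ofunctor C D F \<longleftrightarrow>
     (\<forall>n. \<forall>a \<in> ncells C n. F n a \<in> ncells D n) \<and>
     (\<forall>m n. \<forall>a \<in> ncells C n. m < n \<longrightarrow>
        F m (mdom C m n a) = mdom D m n (F n a) \<and>
        F m (mcod C m n a) = mcod D m n (F n a)) \<and>
     (\<forall>n. \<forall>a \<in> ncells C n. F (Suc n) (ident C n a) = ident D n (F n a)) \<and>
     (\<forall>m n. \<forall>a \<in> ncells C n. \<forall>b \<in> ncells C n.
        m < n \<and> mdom C m n b = mcod C m n a \<longrightarrow>
        F n (mcomp C m n b a) = mcomp D m n (F n b) (F n a))"

text \<open>The iterated identity \<open>n\<close>-cell of a \<open>0\<close>-cell.\<close>

primrec idents :: "'c ocat \<Rightarrow> nat \<Rightarrow> 'c \<Rightarrow> 'c" where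
  "idents C 0 x = x"
| "idents C (Suc n) x = ident C n (idents C n x)"

text \<open>
  \<open>is_ncat\<close> is the recursive definition by enrichment.  An \<open>n\<close>-category is here always
  regarded, along the inclusions of \<open>n\<close>-categories into \<open>(n+1)\<close>-categories, as having cells
  in all dimensions, those above \<open>n\<close> being identities; so a \<open>0\<close>-category is a set \<open>ncells C 0\<close>
  all of whose higher cells are iterated identities.  In an \<open>(n+1)\<close>-category the
  composition \<open>C(y,z) \<times> C(x,y) \<rightarrow> C(x,z)\<close> is \<open>mcomp C 0\<close>, and the identity functor from the
  terminal category to \<open>C(x,x)\<close> is given by the cells \<open>idents C (Suc n) x\<close>.
\<close>

definition discrete_ocat :: "'c ocat \<Rightarrow> bool" where
  "discrete_ocat C \<longleftrightarrow>
     (\<forall>n. bij_betw (idents C n) (ncells C 0) (ncells C n)) \<and>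
     (\<forall>x \<in> ncells C 0. \<forall>m n. m < n \<longrightarrow>
        mdom C m n (idents C n x) = idents C m x \<and>
        mcod C m n (idents C n x) = idents C m x \<and>
        mcomp C m n (idents C n x) (idents C n x) = idents C n x)"

primrec is_ncat :: "nat \<Rightarrow> 'c ocat \<Rightarrow> bool" where
  "is_ncat 0 C \<longleftrightarrow> discrete_ocat C"
| "is_ncat (Suc n) C \<longleftrightarrow>
     (\<forall>k. \<forall>a \<in> ncells C (Suc k).
        mdom C 0 (Suc k) a \<in> ncells C 0 \<and> mcod C 0 (Suc k) a \<in> ncells C 0) \<and>
     (\<forall>x \<in> ncells C 0. \<forall>y \<in> ncells C 0. is_ncat n (hom_ocat C x y)) \<and>
     (\<forall>x \<in> ncells C 0. ident C 0 x \<in> ncells (hom_ocat C x x) 0) \<and>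
     (\<forall>x \<in> ncells C 0. \<forall>y \<in> ncells C 0. \<forall>z \<in> ncells C 0.
        ofunctor (prod_ocat (hom_ocat C y z) (hom_ocat C x y)) (hom_ocat C x z)
          (\<lambda>k (b, a). mcomp C 0 (Suc k) b a)) \<and>
     (\<forall>w \<in> ncells C 0. \<forall>x \<in> ncells C 0. \<forall>y \<in> ncells C 0. \<forall>z \<in> ncells C 0. \<forall>k.
        \<forall>a \<in> ncells (hom_ocat C w x) k. \<forall>b \<in> ncells (hom_ocat C x y) k.
        \<forall>c \<in> ncells (hom_ocat C y z) k.
          mcomp C 0 (Suc k) c (mcomp C 0 (Suc k) b a) =
          mcomp C 0 (Suc k) (mcomp C 0 (Suc k) c b) a) \<and>
     (\<forall>x \<in> ncells C 0. \<forall>y \<in> ncells C 0. \<forall>k. \<forall>a \<in> ncells (hom_ocat C x y) k.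
        mcomp C 0 (Suc k) a (idents C (Suc k) x) = a \<and>
        mcomp C 0 (Suc k) (idents C (Suc k) y) a = a)"

definition omega_cat :: "'c ocat \<Rightarrow> bool" where
  "omega_cat C \<longleftrightarrow> (\<exists>n. is_ncat n C)"

definition omega_iso :: "'c ocat \<Rightarrow> 'd ocat \<Rightarrow> (nat \<Rightarrow> 'c \<Rightarrow> 'd) \<Rightarrow> bool" where
  "omega_iso C D F \<longleftrightarrow>
     omega_cat C \<and> omega_cat D \<and> ofunctor C D F \<and>
     (\<exists>G. ofunctor D C G \<and>
        (\<forall>n. \<forall>a \<in> ncells C n. G n (F n a) = a) \<and>
        (\<forall>n. \<forall>b \<in> ncells D n. F n (G n b) = b))"


section \<open>Globular sets and globular cardinals\<close>

record 'a gset =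
  el :: "nat \<Rightarrow> 'a set"
  src :: "nat \<Rightarrow> 'a \<Rightarrow> 'a"
  tgt :: "nat \<Rightarrow> 'a \<Rightarrow> 'a"

definition globular_set :: "'a gset \<Rightarrow> bool" where
  "globular_set X \<longleftrightarrow>
     (\<forall>n. \<forall>x \<in> el X (Suc n). src X n x \<in> el X n \<and> tgt X n x \<in> el X n) \<and>
     (\<forall>n. \<forall>x \<in> el X (Suc (Suc n)).
        src X n (src X (Suc n) x) = src X n (tgt X (Suc n) x) \<and>
        tgt X n (src X (Suc n) x) = tgt X n (tgt X (Suc n) x))"

definition gmor :: "'a gset \<Rightarrow> 'b gset \<Rightarrow> (nat \<Rightarrow> 'a \<Rightarrow> 'b) \<Rightarrow> bool" where
  "gmor X Y f \<longleftrightarrow>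
     (\<forall>n. \<forall>x \<in> el X n. f n x \<in> el Y n) \<and>
     (\<forall>n. \<forall>x \<in> el X (Suc n).
        f n (src X n x) = src Y n (f (Suc n) x) \<and>
        f n (tgt X n x) = tgt Y n (f (Suc n) x))"

definition giso :: "'a gset \<Rightarrow> 'b gset \<Rightarrow> (nat \<Rightarrow> 'a \<Rightarrow> 'b) \<Rightarrow> bool" where
  "giso X Y f \<longleftrightarrow> gmor X Y f \<and>
     (\<exists>g. gmor Y X g \<and>
        (\<forall>n. \<forall>x \<in> el X n. g n (f n x) = x) \<and>
        (\<forall>n. \<forall>y \<in> el Y n. f n (g n y) = y))"

text \<open>
  The sets \<open>el X n\<close> need not be disjoint, so an element of \<open>X\<close> is a pair of its dimension
  and its value.
\<close>

definition elts :: "'a gset \<Rightarrow> (nat \<times> 'a) set" where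
  "elts X = (SIGMA n:UNIV. el X n)"

definition prec :: "'a gset \<Rightarrow> (nat \<times> 'a) rel" where
  "prec X = {((n, src X n y), (Suc n, y)) | n y. y \<in> el X (Suc n)} \<union>
            {((Suc n, x), (n, tgt X n x)) | n x. x \<in> el X (Suc n)}"

definition tri :: "'a gset \<Rightarrow> (nat \<times> 'a) rel" where
  "tri X = (prec X)\<^sup>* \<inter> elts X \<times> elts X"

definition glob_card :: "'a gset \<Rightarrow> bool" where
  "glob_card X \<longleftrightarrow> globular_set X \<and> finite (elts X) \<and> linear_order_on (elts X) (tri X)"

definition consec :: "'a gset \<Rightarrow> nat \<Rightarrow> 'a \<Rightarrow> 'a \<Rightarrow> bool" where
  "consec X n x y \<longleftrightarrow>
     x \<in> el X n \<and> y \<in> el X n \<and> x \<noteq> y \<and> ((n, x), (n, y)) \<in> tri X \<and>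
     (\<forall>z \<in> el X n. ((n, x), (n, z)) \<in> tri X \<and> ((n, z), (n, y)) \<in> tri X \<longrightarrow> z = x \<or> z = y)"

text \<open>The elements of \<open>X\<^sub>0\<close> in increasing order.\<close>

definition obj_list :: "'a gset \<Rightarrow> 'a list" where
  "obj_list X = (THE xs. distinct xs \<and> set xs = el X 0 \<and>
                         sorted_wrt (\<lambda>x y. ((0, x), (0, y)) \<in> tri X) xs)"

text \<open>The globular cardinal \<open>X(y,z)\<close>, and the restriction \<open>\<gamma>(y,z)\<close> of a morphism to it.\<close>

definition ghom :: "'a gset \<Rightarrow> 'a \<Rightarrow> 'a \<Rightarrow> 'a gset" where
  "ghom X y z =
     \<lparr> el = (\<lambda>k. {x \<in> el X (Suc k). ((0, y), (Suc k, x)) \<in> tri X \<and> ((Suc k, x), (0, z)) \<in> tri X}),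
       src = (\<lambda>k. src X (Suc k)),
       tgt = (\<lambda>k. tgt X (Suc k)) \<rparr>"

definition mor_shift :: "(nat \<Rightarrow> 'a \<Rightarrow> 'b) \<Rightarrow> nat \<Rightarrow> 'a \<Rightarrow> 'b" where
  "mor_shift g k = g (Suc k)"


subsection \<open>Sources and targets of globular cardinals\<close>

definition globular_subset :: "'a gset \<Rightarrow> (nat \<Rightarrow> 'a set) \<Rightarrow> bool" where
  "globular_subset Y S \<longleftrightarrow>
     (\<forall>n. S n \<subseteq> el Y n) \<and>
     (\<forall>n. \<forall>x \<in> S (Suc n). src Y n x \<in> S n \<and> tgt Y n x \<in> S n)"

text \<open>The smallest globular subset containing a given set of elements.\<close>

definition gen_subset :: "'a gset \<Rightarrow> (nat \<times> 'a) set \<Rightarrow> 'a gset" where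
  "gen_subset Y A =
     Y \<lparr> el := (\<lambda>n. \<Inter> {S n | S. globular_subset Y S \<and> (\<forall>(k, x) \<in> A. x \<in> S k)}) \<rparr>"

text \<open>
  The globular subset \<open>Y[x,y]\<close>, for \<open>x, y\<close> consecutive in \<open>Y\<^sub>n\<close>: the largest one whose
  set of elements of dimension \<open>n\<close> is \<open>{x, y}\<close>.
\<close>

definition between :: "'a gset \<Rightarrow> nat \<Rightarrow> 'a \<Rightarrow> 'a \<Rightarrow> nat \<Rightarrow> 'a set" where
  "between Y n x y k = \<Union> {S k | S. globular_subset Y S \<and> S n = {x, y}}"

text \<open>The least element of \<open>A\<close>, as a singleton; empty if there is none.\<close>

definition least_of :: "'b rel \<Rightarrow> 'b set \<Rightarrow> 'b set" where
  "least_of r A = {a \<in> A. \<forall>b \<in> A. (a, b) \<in> r}"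

text \<open>
  With \<open>r = tri Y\<close> this is \<open>s\<^sub>mY\<close>; with the converse order, least elements become greatest
  ones and it is \<open>t\<^sub>mY\<close>.
\<close>

definition boundary :: "(nat \<times> 'a) rel \<Rightarrow> 'a gset \<Rightarrow> nat \<Rightarrow> 'a gset" where
  "boundary r Y m = gen_subset Y
     (case m of
        0 \<Rightarrow> least_of r (elts Y)
      | Suc l \<Rightarrow> (SIGMA k:{..l}. el Y k) \<union>
                \<Union> {least_of r ({m} \<times> between Y l x y m) | x y. consec Y l x y})"

definition gsource :: "nat \<Rightarrow> 'a gset \<Rightarrow> 'a gset" where
  "gsource m Y = boundary (tri Y) Y m"

definition gtarget :: "nat \<Rightarrow> 'a gset \<Rightarrow> 'a gset" where
  "gtarget m Y = boundary ((tri Y)\<inverse>) Y m"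


subsection \<open>Pushouts of globular sets\<close>

text \<open>
  The pushout of \<open>Z \<leftarrow> W \<rightarrow> Y\<close>, where \<open>W\<close> is a globular subset of \<open>Z\<close> and \<open>d\<close> is the morphism
  to \<open>Y\<close>: dimensionwise the quotient of the disjoint union of \<open>Y\<close> and \<open>Z\<close> by the equivalence
  relation generated by \<open>d w \<sim> w\<close>.
\<close>

definition glue :: "'a gset \<Rightarrow> (nat \<Rightarrow> 'a \<Rightarrow> 'b) \<Rightarrow> nat \<Rightarrow> ('b + 'a) rel" where
  "glue W d n = (let R = {(Inl (d n w), Inr w) | w. w \<in> el W n} in (R \<union> R\<inverse>)\<^sup>*)"

definition pushout :: "'b gset \<Rightarrow> 'a gset \<Rightarrow> 'a gset \<Rightarrow> (nat \<Rightarrow> 'a \<Rightarrow> 'b) \<Rightarrow> ('b + 'a) set gset" where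
  "pushout Y Z W d =
     \<lparr> el = (\<lambda>n. (el Y n <+> el Z n) // glue W d n),
       src = (\<lambda>n Q. glue W d n `` (map_sum (src Y n) (src Z n) ` Q)),
       tgt = (\<lambda>n Q. glue W d n `` (map_sum (tgt Y n) (tgt Z n) ` Q)) \<rparr>"

definition pushout_mor ::
  "(nat \<Rightarrow> 'b \<Rightarrow> 'x) \<Rightarrow> (nat \<Rightarrow> 'a \<Rightarrow> 'x) \<Rightarrow> nat \<Rightarrow> ('b + 'a) set \<Rightarrow> 'x" where
  "pushout_mor f g n Q = the_elem (case_sum (f n) (g n) ` Q)"


section \<open>The free \<open>\<omega>\<close>-category on a globular cardinal\<close>

text \<open>
  Globular cardinals being finite, isomorphism classes of objects of the slice are taken
  among those \<open>\<gamma> : Y \<rightarrow> X\<close> whose domain has natural numbers as elements.  The class of an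
  object with domain over an arbitrary type consists of the objects of this kind isomorphic
  to it over \<open>X\<close>.
\<close>

type_synonym 'a slice_obj = "nat gset \<times> (nat \<Rightarrow> nat \<Rightarrow> 'a)"

definition slice_iso ::
  "'b gset \<Rightarrow> (nat \<Rightarrow> 'b \<Rightarrow> 'x) \<Rightarrow> 'c gset \<Rightarrow> (nat \<Rightarrow> 'c \<Rightarrow> 'x) \<Rightarrow> (nat \<Rightarrow> 'b \<Rightarrow> 'c) \<Rightarrow> bool" where
  "slice_iso Y f Z g h \<longleftrightarrow> giso Y Z h \<and> (\<forall>n. \<forall>y \<in> el Y n. g n (h n y) = f n y)"

definition slice_objs :: "'a gset \<Rightarrow> 'a slice_obj set" where
  "slice_objs X = {(Y, g). glob_card Y \<and> gmor Y X g}"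

definition iso_class :: "'a gset \<Rightarrow> 'b gset \<Rightarrow> (nat \<Rightarrow> 'b \<Rightarrow> 'a) \<Rightarrow> 'a slice_obj set" where
  "iso_class X Y f = {(Z, g) \<in> slice_objs X. \<exists>h. slice_iso Y f Z g h}"

definition free_glob :: "'a gset \<Rightarrow> 'a slice_obj set ocat" where
  "free_glob X =
     \<lparr> ncells = (\<lambda>n. {iso_class X Y f | Y f.
         (Y, f) \<in> slice_objs X \<and> elts Y \<noteq> {} \<and> (\<forall>m > n. el Y m = {})}),
       mdom = (\<lambda>m n A. \<Union>(Y, f) \<in> A. iso_class X (gsource m Y) f),
       mcod = (\<lambda>m n A. \<Union>(Y, f) \<in> A. iso_class X (gtarget m Y) f),
       ident = (\<lambda>n A. A),
       mcomp = (\<lambda>m n B A. \<Union> {iso_class X (pushout Y Z (gsource m Z) d) (pushout_mor f g) |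
         Y f Z g d. (Y, f) \<in> A \<and> (Z, g) \<in> B \<and> slice_iso (gsource m Z) g (gtarget m Y) f d}) \<rparr>"


section \<open>Ordinal graphs\<close>

text \<open>
  Iterated enriched graphs with a finite linearly ordered set of objects, given by the list of
  the objects in increasing order.  The edge-objects \<open>edge G x y\<close> are relevant only for
  objects \<open>x, y\<close> of \<open>G\<close>.
\<close>

datatype 'a graph = Empty | Graph "'a list" "'a \<Rightarrow> 'a \<Rightarrow> 'a graph"

primrec obs :: "'a graph \<Rightarrow> 'a list" where
  "obs Empty = []"
| "obs (Graph xs E) = xs"

primrec edge :: "'a graph \<Rightarrow> 'a \<Rightarrow> 'a \<Rightarrow> 'a graph" where
  "edge Empty = (\<lambda>_ _. Empty)"
| "edge (Graph xs E) = E"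

primrec ordinal_graph_dim :: "nat \<Rightarrow> 'a graph \<Rightarrow> bool" where
  "ordinal_graph_dim 0 G \<longleftrightarrow>
     length (obs G) \<le> 1 \<and> (\<forall>x \<in> set (obs G). \<forall>y \<in> set (obs G). obs (edge G x y) = [])"
| "ordinal_graph_dim (Suc n) G \<longleftrightarrow>
     distinct (obs G) \<and>
     (\<forall>x \<in> set (obs G). \<forall>y \<in> set (obs G).
        ordinal_graph_dim n (edge G x y) \<and>
        (obs (edge G x y) \<noteq> [] \<longleftrightarrow> (x, y) \<in> set (zip (obs G) (tl (obs G)))))"

definition ordinal_graph :: "'a graph \<Rightarrow> bool" where
  "ordinal_graph G \<longleftrightarrow> (\<exists>n. ordinal_graph_dim n G)"

text \<open>
  The ordinal graph \<open>\<Gamma> X\<close>; the finiteness test only ensures termination.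
\<close>

function Gam :: "'a gset \<Rightarrow> 'a graph" where
  "Gam X = (if finite (elts X) \<and> el X 0 \<noteq> {}
            then Graph (obj_list X) (\<lambda>x y. if consec X 0 x y then Gam (ghom X x y) else Empty)
            else Empty)"
  by auto
termination
proof (relation "measure (\<lambda>X. card (elts X))", simp)
  fix X :: "'a gset" and x y
  assume *: "finite (elts X) \<and> el X 0 \<noteq> {}" "consec X 0 x y"
  let ?f = "\<lambda>(k :: nat, a :: 'a). (Suc k, a)"
  have "?f ` elts (ghom X x y) \<subset> elts X"
    using * by (auto simp: elts_def ghom_def image_iff)
  then have "card (?f ` elts (ghom X x y)) < card (elts X)"
    using * psubset_card_mono by blast
  moreover have "inj_on ?f (elts (ghom X x y))"
    by (auto simp: inj_on_def)
  ultimately show "(ghom X x y, X) \<in> measure (\<lambda>X. card (elts X))"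
    by (simp add: card_image)
qed

declare Gam.simps [simp del]


section \<open>The free \<open>\<omega>\<close>-category on an ordinal graph\<close>

text \<open>
  \<open>Obj x\<close> is a \<open>0\<close>-cell; \<open>Arr x y cs\<close> is the cell of positive dimension from \<open>x\<close> to \<open>y\<close>
  given by the sequence \<open>cs\<close>.
\<close>

datatype 'a gcell = Obj 'a | Arr 'a 'a "'a gcell list"

text \<open>
  If \<open>obs G = [x\<^sub>0, \<dots>, x\<^sub>p]\<close>, the cells from \<open>x\<^sub>h\<close> to \<open>x\<^sub>k\<close> are sequences of
  length \<open>k - h\<close> whose entry number \<open>i\<close> is a cell over the edge-object from
  \<open>x\<close> with index \<open>h + i\<close> to \<open>x\<close> with index \<open>h + i + 1\<close>.
\<close>

primrec gcells :: "nat \<Rightarrow> 'a graph \<Rightarrow> 'a gcell set" where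
  "gcells 0 G = Obj ` set (obs G)"
| "gcells (Suc n) G =
     {Arr (obs G ! h) (obs G ! k) cs | h k cs.
        h \<le> k \<and> k < length (obs G) \<and> length cs = k - h \<and>
        (\<forall>i < k - h. cs ! i \<in> gcells n (edge G (obs G ! (h + i)) (obs G ! Suc (h + i))))}"

fun gdom :: "nat \<Rightarrow> 'a gcell \<Rightarrow> 'a gcell" where
  "gdom 0 (Arr x y cs) = Obj x"
| "gdom (Suc m) (Arr x y cs) = Arr x y (map (gdom m) cs)"
| "gdom m (Obj x) = Obj x"

fun gcod :: "nat \<Rightarrow> 'a gcell \<Rightarrow> 'a gcell" where
  "gcod 0 (Arr x y cs) = Obj y"
| "gcod (Suc m) (Arr x y cs) = Arr x y (map (gcod m) cs)"
| "gcod m (Obj x) = Obj x"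

primrec gident :: "'a gcell \<Rightarrow> 'a gcell" where
  "gident (Obj x) = Arr x x []"
| "gident (Arr x y cs) = Arr x y (map gident cs)"

fun gcomp :: "nat \<Rightarrow> 'a gcell \<Rightarrow> 'a gcell \<Rightarrow> 'a gcell" where
  "gcomp 0 (Arr y' z ds) (Arr x y cs) = Arr x z (cs @ ds)"
| "gcomp (Suc m) (Arr x' y' ds) (Arr x y cs) = Arr x y (map2 (gcomp m) ds cs)"
| "gcomp m d c = undefined"

definition free_graph :: "'a graph \<Rightarrow> 'a gcell ocat" where
  "free_graph G =
     \<lparr> ncells = (\<lambda>n. gcells n G),
       mdom = (\<lambda>m n. gdom m),
       mcod = (\<lambda>m n. gcod m),
       ident = (\<lambda>n. gident),
       mcomp = (\<lambda>m n. gcomp m) \<rparr>"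


section \<open>The \<open>\<omega>\<close>-functor \<open>L\<close>\<close>

primrec L_rep :: "nat \<Rightarrow> 'b gset \<Rightarrow> (nat \<Rightarrow> 'b \<Rightarrow> 'a) \<Rightarrow> 'a gcell" where
  "L_rep 0 Y g = Obj (g 0 (the_elem (el Y 0)))"
| "L_rep (Suc m) Y g =
     (let ys = obj_list Y in
      Arr (g 0 (hd ys)) (g 0 (last ys))
        (map (\<lambda>(y, z). L_rep m (ghom Y y z) (mor_shift g)) (zip ys (tl ys))))"

text \<open>
  \<open>L_rep\<close> takes the same value on all representatives of an isomorphism class.
\<close>

definition L_fun :: "nat \<Rightarrow> 'a slice_obj set \<Rightarrow> 'a gcell" where
  "L_fun n A = the_elem ((\<lambda>(Y, g). L_rep n Y g) ` A)"


section \<open>Adequacy: \<open>\<Gamma> X\<close> is an ordinal graph\<close>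

text \<open>The iterated \<open>0\<close>-source (\<open>s = src X\<close>) or \<open>0\<close>-target (\<open>s = tgt X\<close>) of an element.\<close>

primrec end_el :: "(nat \<Rightarrow> 'a \<Rightarrow> 'a) \<Rightarrow> nat \<Rightarrow> 'a \<Rightarrow> 'a" where
  "end_el s 0 x = x"
| "end_el s (Suc n) x = end_el s n (s n x)"

lemma end_el_mem:
  assumes "globular_set X" "x \<in> el X n"
  shows "end_el (src X) n x \<in> el X 0 \<and> ((0, end_el (src X) n x), (n, x)) \<in> (prec X)\<^sup>*
       \<and> end_el (tgt X) n x \<in> el X 0 \<and> ((n, x), (0, end_el (tgt X) n x)) \<in> (prec X)\<^sup>*"
  using assms(2)
proof (induction n arbitrary: x)
  case (Suc n)
  have m: "src X n x \<in> el X n" "tgt X n x \<in> el X n"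
    using assms(1) Suc.prems by (auto simp: globular_set_def)
  have "((n, src X n x), (Suc n, x)) \<in> prec X" "((Suc n, x), (n, tgt X n x)) \<in> prec X"
    using Suc.prems by (auto simp: prec_def)
  then show ?case using Suc.IH[OF m(1)] Suc.IH[OF m(2)]
    by (auto intro: rtrancl_into_rtrancl converse_rtrancl_into_rtrancl)
qed simp

lemma end_el_step:
  assumes "globular_set X" "((Suc n, x), (Suc k, y)) \<in> prec X"
  shows "end_el (src X) (Suc n) x = end_el (src X) (Suc k) y
       \<and> end_el (tgt X) (Suc n) x = end_el (tgt X) (Suc k) y"
  using assms by (auto simp: prec_def globular_set_def)

lemma prec_elts: "globular_set X \<Longrightarrow> (a, b) \<in> prec X \<Longrightarrow> a \<in> elts X \<and> b \<in> elts X"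
  by (auto simp: prec_def elts_def globular_set_def)

definition same_ends :: "'a gset \<Rightarrow> nat \<times> 'a \<Rightarrow> nat \<times> 'a \<Rightarrow> bool" where
  "same_ends X a b \<longleftrightarrow> end_el (src X) (fst a) (snd a) = end_el (src X) (fst b) (snd b)
                    \<and> end_el (tgt X) (fst a) (snd a) = end_el (tgt X) (fst b) (snd b)"

lemma path_from:
  assumes g: "globular_set X" and p: "(a, b) \<in> (prec X)\<^sup>*" and "fst a \<noteq> 0"
  shows "((a, b) \<in> (prec X \<inter> {(a, b). fst a \<noteq> 0 \<and> fst b \<noteq> 0})\<^sup>* \<and> fst b \<noteq> 0 \<and> same_ends X a b) \<or>
         ((0, end_el (tgt X) (fst a) (snd a)), b) \<in> (prec X)\<^sup>*"
  using p
proof (induction rule: rtrancl_induct)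
  case base
  then show ?case using assms by (simp add: same_ends_def)
next
  case (step b c)
  show ?case
  proof (cases "((0, end_el (tgt X) (fst a) (snd a)), b) \<in> (prec X)\<^sup>*")
    case True
    then show ?thesis using step(2) by (meson rtrancl_into_rtrancl)
  next
    case False
    then have b: "(a, b) \<in> (prec X \<inter> {(a, b). fst a \<noteq> 0 \<and> fst b \<noteq> 0})\<^sup>*" "fst b \<noteq> 0" "same_ends X a b"
      using step by auto
    obtain n x where bb: "b = (Suc n, x)" using b(2) by (metis not0_implies_Suc prod.collapse)
    show ?thesis
    proof (cases "fst c")
      case 0
      then have "n = 0 \<and> c = (0, tgt X 0 x)" using step(2) bb by (cases c) (auto simp: prec_def)
      then show ?thesis using b(3) bb by (auto simp: same_ends_def)
    next
      case (Suc k)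
      then obtain y where c: "c = (Suc k, y)" by (metis prod.collapse)
      have "same_ends X b c" using end_el_step[OF g step(2)[unfolded bb c]]
        unfolding same_ends_def bb c fst_conv snd_conv .
      moreover have "(b, c) \<in> prec X \<inter> {(a, b). fst a \<noteq> 0 \<and> fst b \<noteq> 0}"
        using step(2) b(2) c by auto
      ultimately show ?thesis using rtrancl_into_rtrancl[OF b(1)] b(3) Suc
        by (simp add: same_ends_def)
    qed
  qed
qed

lemma path_to:
  assumes g: "globular_set X" and p: "(a, b) \<in> (prec X)\<^sup>*" and "fst b \<noteq> 0"
  shows "(fst a \<noteq> 0 \<and> same_ends X a b) \<or> (a, (0, end_el (src X) (fst b) (snd b))) \<in> (prec X)\<^sup>*"
  using p
proof (induction rule: converse_rtrancl_induct)
  case base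
  then show ?case using assms by (simp add: same_ends_def)
next
  case (step a c)
  show ?case
  proof (cases "(c, (0, end_el (src X) (fst b) (snd b))) \<in> (prec X)\<^sup>*")
    case True
    then show ?thesis using step(1) by (meson converse_rtrancl_into_rtrancl)
  next
    case False
    then have b: "fst c \<noteq> 0" "same_ends X c b" using step by auto
    obtain n x where bb: "c = (Suc n, x)" using b(1) by (metis not0_implies_Suc prod.collapse)
    show ?thesis
    proof (cases "fst a")
      case 0
      then have "n = 0 \<and> a = (0, src X 0 x)" using step(1) bb by (cases a) (auto simp: prec_def)
      then show ?thesis using b(2) bb by (auto simp: same_ends_def)
    next
      case (Suc k)
      then obtain y where c: "a = (Suc k, y)" by (metis prod.collapse)
      have "same_ends X a c" using end_el_step[OF g step(1)[unfolded bb c]]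
        unfolding same_ends_def bb c fst_conv snd_conv .
      then show ?thesis using b(2) Suc
        by (simp add: same_ends_def)
    qed
  qed
qed

lemma tri_antisym:
  assumes "glob_card X" "a \<in> elts X" "b \<in> elts X" "(a, b) \<in> (prec X)\<^sup>*" "(b, a) \<in> (prec X)\<^sup>*"
  shows "a = b"
proof -
  have "antisym (tri X)" "(a, b) \<in> tri X" "(b, a) \<in> tri X"
    using assms by (auto simp: glob_card_def linear_order_on_def partial_order_on_def tri_def)
  then show ?thesis by (rule antisymD)
qed

lemma ghom_iff:
  assumes X: "glob_card X" and c: "consec X 0 y z"
  shows "x \<in> el (ghom X y z) k \<longleftrightarrow>
    x \<in> el X (Suc k) \<and> end_el (src X) (Suc k) x = y \<and> end_el (tgt X) (Suc k) x = z"
proof -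
  have g: "globular_set X" using X by (simp add: glob_card_def)
  have yz: "y \<in> el X 0" "z \<in> el X 0" using c by (auto simp: consec_def)
  show ?thesis
  proof
    assume "x \<in> el (ghom X y z) k"
    then have x: "x \<in> el X (Suc k)" "((0, y), (Suc k, x)) \<in> (prec X)\<^sup>*" "((Suc k, x), (0, z)) \<in> (prec X)\<^sup>*"
      by (auto simp: ghom_def tri_def)
    define p where "p = end_el (src X) (Suc k) x"
    define q where "q = end_el (tgt X) (Suc k) x"
    note m = end_el_mem[OF g x(1), folded p_def q_def]
    have 1: "((0, y), (0, p)) \<in> (prec X)\<^sup>*"
      using path_to[OF g x(2)] p_def by simp
    have 2: "((0, q), (0, z)) \<in> (prec X)\<^sup>*"
      using path_from[OF g x(3)] q_def by simp
    have "((0, p), (0, z)) \<in> (prec X)\<^sup>*" "((0, y), (0, q)) \<in> (prec X)\<^sup>*"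
      using x m by auto
    then have "p = y \<or> p = z" "q = y \<or> q = z"
      using c m 1 2 yz by (auto simp: consec_def tri_def elts_def)
    moreover have "p \<noteq> z"
    proof
      assume "p = z"
      then have "(0, p) = (Suc k, x)"
        using m x yz by (intro tri_antisym[OF X]) (auto simp: elts_def)
      then show False by simp
    qed
    moreover have "q \<noteq> y"
    proof
      assume "q = y"
      then have "(0, q) = (Suc k, x)"
        using m x yz by (intro tri_antisym[OF X]) (auto simp: elts_def)
      then show False by simp
    qed
    ultimately show "x \<in> el X (Suc k) \<and> end_el (src X) (Suc k) x = y \<and> end_el (tgt X) (Suc k) x = z"
      using x p_def q_def by auto
  next
    assume "x \<in> el X (Suc k) \<and> end_el (src X) (Suc k) x = y \<and> end_el (tgt X) (Suc k) x = z"
    then show "x \<in> el (ghom X y z) k"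
      using end_el_mem[OF g, of x "Suc k"] yz by (auto simp: ghom_def tri_def elts_def)
  qed
qed

lemma glob_card_ghom:
  assumes X: "glob_card X" and c: "consec X 0 y z"
  shows "glob_card (ghom X y z)"
proof -
  let ?H = "ghom X y z"
  let ?f = "\<lambda>(k :: nat, a :: 'a). (Suc k, a)"
  have g: "globular_set X" using X by (simp add: glob_card_def)
  have mem: "(k, x) \<in> elts ?H \<longleftrightarrow> (Suc k, x) \<in> elts X \<and>
      end_el (src X) (Suc k) x = y \<and> end_el (tgt X) (Suc k) x = z" for k x
    using ghom_iff[OF X c] by (auto simp: elts_def)
  have st: "src ?H n = src X (Suc n)" "tgt ?H n = tgt X (Suc n)" for n
    by (simp_all add: ghom_def)
  have gs: "globular_set ?H"
  proof -
    have G: "src X n x \<in> el X n" "tgt X n x \<in> el X n" if "x \<in> el X (Suc n)" for n x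
      using g that by (auto simp: globular_set_def)
    have G2: "src X n (tgt X (Suc n) x) = src X n (src X (Suc n) x)"
             "tgt X n (src X (Suc n) x) = tgt X n (tgt X (Suc n) x)" if "x \<in> el X (Suc (Suc n))" for n x
      using g that by (auto simp: globular_set_def)
    show ?thesis
      unfolding globular_set_def st using ghom_iff[OF X c] by (auto simp: G G2)
  qed
  have inj: "inj_on ?f A" for A by (auto simp: inj_on_def)
  have "?f ` elts ?H \<subseteq> elts X" using mem by auto
  then have fin: "finite (elts ?H)"
    using X inj by (meson finite_imageD finite_subset glob_card_def)
  have up: "(?f a, ?f b) \<in> (prec X)\<^sup>*" if "(a, b) \<in> (prec ?H)\<^sup>*" for a b
    using that
  proof (induction rule: rtrancl_induct)
    case (step b c)
    have "(?f b, ?f c) \<in> prec X"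
      using step(2) ghom_iff[OF X c] by (auto simp: prec_def st)
    then show ?case using step by (meson rtrancl_into_rtrancl)
  qed simp
  have down1: "b \<in> ?f ` elts ?H \<and> (inv_into UNIV ?f a, inv_into UNIV ?f b) \<in> (prec ?H)\<^sup>*"
    if "(a, b) \<in> (prec X \<inter> {(a, b). fst a \<noteq> 0 \<and> fst b \<noteq> 0})\<^sup>*" "a \<in> ?f ` elts ?H" for a b
    using that
  proof (induction rule: rtrancl_induct)
    case (step b c)
    then obtain n x where b: "b = (Suc n, x)" "(n, x) \<in> elts ?H" by auto
    obtain k w where cc: "c = (Suc k, w)" using step(2)
      by (metis (mono_tags, lifting) IntD2 case_prodD mem_Collect_eq not0_implies_Suc prod.collapse)
    have bc: "((Suc n, x), (Suc k, w)) \<in> prec X" using step(2) b cc by auto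
    have kw: "(k, w) \<in> elts ?H"
      using end_el_step[OF g bc] prec_elts[OF g bc] b(2) unfolding mem by metis
    have i: "inv_into UNIV ?f (Suc j, v) = (j, v)" for j v
      using inv_f_f[OF inj, of "(j, v)"] by simp
    have "((n, x), (k, w)) \<in> prec ?H"
      using bc b(2) kw by (auto simp: prec_def st elts_def)
    then show ?case using step b cc kw i
      by (auto intro: rtrancl_into_rtrancl)
  qed simp
  have down: "(a, b) \<in> (prec ?H)\<^sup>*"
    if "(?f a, ?f b) \<in> (prec X)\<^sup>*" "a \<in> elts ?H" "b \<in> elts ?H" for a b
  proof -
    obtain n x k w where ab: "a = (n, x)" "b = (k, w)" by fastforce
    have A: "(Suc n, x) \<in> elts X" "end_el (tgt X) (Suc n) x = z"
      and B: "(Suc k, w) \<in> elts X" "end_el (tgt X) (Suc k) w = z"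
      using that ab mem by auto
    have "((0, z), (Suc k, w)) \<notin> (prec X)\<^sup>*"
    proof
      assume "((0, z), (Suc k, w)) \<in> (prec X)\<^sup>*"
      moreover have "((Suc k, w), (0, z)) \<in> (prec X)\<^sup>*" "(0, z) \<in> elts X"
        using end_el_mem[OF g, of w "Suc k"] B by (auto simp: elts_def)
      ultimately have "(0, z) = (Suc k, w)" using B by (intro tri_antisym[OF X])
      then show False by simp
    qed
    then have "(?f a, ?f b) \<in> (prec X \<inter> {(a, b). fst a \<noteq> 0 \<and> fst b \<noteq> 0})\<^sup>*"
      using path_from[OF g that(1)] A ab by auto
    from down1[OF this] that(2) show ?thesis
      by (simp add: inv_f_f[OF inj])
  qed
  have tri: "(a, b) \<in> tri ?H \<longleftrightarrow> a \<in> elts ?H \<and> b \<in> elts ?H \<and> (?f a, ?f b) \<in> tri X" for a b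
  proof -
    have "?f a \<in> elts X" if "a \<in> elts ?H" for a using that mem by (cases a) auto
    then show ?thesis unfolding tri_def using up down by blast
  qed
  have L: "linear_order_on (elts X) (tri X)" using X by (simp add: glob_card_def)
  have fE: "?f a \<in> elts X" if "a \<in> elts ?H" for a using that mem by (cases a) auto
  have fI: "?f a = ?f b \<longleftrightarrow> a = b" for a b by (cases a; cases b) auto
  have "linear_order_on (elts ?H) (tri ?H)"
    unfolding linear_order_on_def partial_order_on_def preorder_on_def
  proof (intro conjI)
    show "refl_on (elts ?H) (tri ?H)"
      by (auto simp: refl_on_def tri_def)
    show "tri ?H \<subseteq> elts ?H \<times> elts ?H" by (auto simp: tri_def)
    show "trans (tri ?H)" by (auto simp: trans_def tri_def)
    show "antisym (tri ?H)"
      using L fI unfolding antisym_def tri linear_order_on_def partial_order_on_def by blast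
    show "total_on (elts ?H) (tri ?H)"
      using L fI fE unfolding total_on_def tri linear_order_on_def by blast
  qed
  with gs fin show ?thesis by (simp add: glob_card_def)
qed


lemma finite_linear_list:
  assumes "finite A" "linear_order_on A r"
  shows "\<exists>!xs. distinct xs \<and> set xs = A \<and> sorted_wrt (\<lambda>x y. (x, y) \<in> r) xs"
proof -
  have an: "antisym r" and tot: "total_on A r" and tr: "trans r"
    using assms(2) by (auto simp: linear_order_on_def partial_order_on_def preorder_on_def)
  have "\<exists>xs. distinct xs \<and> set xs = B \<and> sorted_wrt (\<lambda>x y. (x, y) \<in> r) xs" if "B \<subseteq> A" for B
    using finite_subset[OF that assms(1)] that
  proof (induction B rule: finite_psubset_induct)
    case (psubset B)
    show ?case
    proof (cases "B = {}")
      case False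
      have "\<exists>m \<in> B. \<forall>b \<in> B. b \<noteq> m \<longrightarrow> (m, b) \<in> r"
        using psubset(1) False psubset.prems
      proof (induction B rule: finite_ne_induct)
        case (insert x F)
        then obtain m where m: "m \<in> F" "\<forall>b \<in> F. b \<noteq> m \<longrightarrow> (m, b) \<in> r" by auto
        show ?case
        proof (cases "(m, x) \<in> r")
          case True
          then show ?thesis using m by auto
        next
          case False
          then have "(x, m) \<in> r" using tot m insert by (auto simp: total_on_def)
          then show ?thesis using m tr by (auto dest: transD)
        qed
      qed simp
      then obtain m where m: "m \<in> B" "\<forall>b \<in> B. b \<noteq> m \<longrightarrow> (m, b) \<in> r" by blast
      then obtain xs where "distinct xs" "set xs = B - {m}" "sorted_wrt (\<lambda>x y. (x, y) \<in> r) xs"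
        using psubset(2)[of "B - {m}"] psubset.prems by blast
      then have "distinct (m # xs) \<and> set (m # xs) = B \<and> sorted_wrt (\<lambda>x y. (x, y) \<in> r) (m # xs)"
        using m by auto
      then show ?thesis by blast
    qed simp
  qed
  moreover have "xs = ys" if "distinct xs" "distinct ys" "set xs = set ys"
    "sorted_wrt (\<lambda>x y. (x, y) \<in> r) xs" "sorted_wrt (\<lambda>x y. (x, y) \<in> r) ys" for xs ys
    using that
  proof (induction xs arbitrary: ys)
    case (Cons x xs)
    then obtain y ys' where ys: "ys = y # ys'" by (cases ys) auto
    have "x = y"
    proof (rule ccontr)
      assume "x \<noteq> y"
      then have "y \<in> set xs" "x \<in> set ys'" using Cons.prems ys by auto
      then show False using Cons.prems ys an \<open>x \<noteq> y\<close> by (auto dest: antisymD)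
    qed
    moreover have "set xs = set ys'"
      using Cons.prems ys \<open>x = y\<close> by auto
    ultimately show ?case using Cons ys by auto
  qed simp
  ultimately show ?thesis by blast
qed

lemma obj_list:
  assumes "glob_card X"
  shows "distinct (obj_list X)" "set (obj_list X) = el X 0"
    "sorted_wrt (\<lambda>x y. ((0, x), (0, y)) \<in> tri X) (obj_list X)"
proof -
  let ?r = "{(x, y). ((0, x), (0, y)) \<in> tri X}"
  have L: "linear_order_on (elts X) (tri X)" and fin: "finite (elts X)"
    using assms by (auto simp: glob_card_def)
  have "el X 0 = (\<lambda>x. (0, x)) -` elts X" by (auto simp: elts_def)
  then have "finite (el X 0)"
    using fin by (metis Pair_inject finite_vimageI injI)
  moreover have "linear_order_on (el X 0) ?r"
  proof -
    have E: "(0, x) \<in> elts X \<longleftrightarrow> x \<in> el X 0" for x by (simp add: elts_def)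
    have T: "(a, b) \<in> tri X \<Longrightarrow> a \<in> elts X \<and> b \<in> elts X" for a b by (simp add: tri_def)
    have "refl_on (elts X) (tri X)" "trans (tri X)" "antisym (tri X)" "total_on (elts X) (tri X)"
      using L by (auto simp: linear_order_on_def partial_order_on_def preorder_on_def)
    note L' = refl_onD[OF this(1)] transD[OF this(2)] antisymD[OF this(3)] this(4)[unfolded total_on_def]
    show ?thesis
      unfolding linear_order_on_def partial_order_on_def preorder_on_def
    proof (intro conjI)
      show "refl_on (el X 0) ?r" using L'(1) T E by (simp add: refl_on_def)
      show "?r \<subseteq> el X 0 \<times> el X 0" using T E by blast
      show "trans ?r" using L'(2) by (blast intro: transI)
      show "antisym ?r" using L'(3) by (blast intro: antisymI)
      show "total_on (el X 0) ?r" using L'(4) E by (simp add: total_on_def)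
    qed
  qed
  ultimately have "\<exists>!xs. distinct xs \<and> set xs = el X 0 \<and>
      sorted_wrt (\<lambda>x y. ((0, x), (0, y)) \<in> tri X) xs"
    using finite_linear_list[of "el X 0" ?r] by simp
  from theI'[OF this, folded obj_list_def]
  show "distinct (obj_list X)" "set (obj_list X) = el X 0"
    "sorted_wrt (\<lambda>x y. ((0, x), (0, y)) \<in> tri X) (obj_list X)" by auto
qed

lemma consec_iff_zip:
  assumes X: "glob_card X"
  shows "consec X 0 x y \<longleftrightarrow> (x, y) \<in> set (zip (obj_list X) (tl (obj_list X)))"
proof -
  let ?xs = "obj_list X"
  note o = obj_list[OF X]
  have an: "antisym (tri X)" and rf: "\<And>a. a \<in> elts X \<Longrightarrow> (a, a) \<in> tri X"
    using X by (auto simp: glob_card_def linear_order_on_def partial_order_on_def preorder_on_def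
        intro: refl_onD)
  have le: "((0, ?xs ! i), (0, ?xs ! j)) \<in> tri X \<longleftrightarrow> i \<le> j"
    if "i < length ?xs" "j < length ?xs" for i j
  proof -
    have 1: "((0, ?xs ! i), (0, ?xs ! j)) \<in> tri X" if "i < j" "j < length ?xs" for i j
      using o(3) that by (auto simp: sorted_wrt_iff_nth_less)
    have 2: "?xs ! i = ?xs ! j \<longleftrightarrow> i = j"
      using o(1) that by (simp add: nth_eq_iff_index_eq)
    have 3: "((0, ?xs ! i), (0, ?xs ! i)) \<in> tri X"
    proof -
      have "?xs ! i \<in> el X 0" using o(2) that(1) nth_mem by blast
      then show ?thesis using rf[of "(0, ?xs ! i)"] by (simp add: elts_def)
    qed
    show ?thesis
    proof (cases i j rule: linorder_cases)
      case greater
      have "((0, ?xs ! i), (0, ?xs ! j)) \<notin> tri X"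
      proof
        assume "((0, ?xs ! i), (0, ?xs ! j)) \<in> tri X"
        then have "(0 :: nat, ?xs ! i) = (0, ?xs ! j)"
          using antisymD[OF an] 1[OF greater that(1)] by blast
        then show False using 2 greater by simp
      qed
      then show ?thesis using greater by simp
    next
      case less
      then show ?thesis using 1[OF less that(2)] by simp
    next
      case equal
      then show ?thesis using 3 by simp
    qed
  qed
  have "consec X 0 x y \<longleftrightarrow> (\<exists>i. Suc i < length ?xs \<and> x = ?xs ! i \<and> y = ?xs ! Suc i)"
  proof
    assume c: "consec X 0 x y"
    then obtain i j where ij: "i < length ?xs" "j < length ?xs" "x = ?xs ! i" "y = ?xs ! j"
      using o(2) by (metis consec_def in_set_conv_nth)
    then have "i \<le> j" "i \<noteq> j" using le[of i j] c by (auto simp: consec_def)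
    then have s: "Suc i \<le> j" "Suc i < length ?xs" using ij(2) by linarith+
    have "?xs ! Suc i \<in> el X 0" using o(2) nth_mem[OF s(2)] by blast
    moreover have "((0, x), (0, ?xs ! Suc i)) \<in> tri X"
      unfolding ij(3) using le[OF ij(1) s(2)] by simp
    moreover have "((0, ?xs ! Suc i), (0, y)) \<in> tri X"
      unfolding ij(4) using le[OF s(2) ij(2)] s(1) by simp
    ultimately have "?xs ! Suc i = x \<or> ?xs ! Suc i = y" using c by (simp add: consec_def)
    then have "Suc i = i \<or> Suc i = j"
      unfolding ij(3,4) using nth_eq_iff_index_eq[OF o(1) s(2)] ij(1,2) by blast
    then have "Suc i = j" by simp
    then show "\<exists>i. Suc i < length ?xs \<and> x = ?xs ! i \<and> y = ?xs ! Suc i"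
      using ij(3,4) s(2) by blast
  next
    assume "\<exists>i. Suc i < length ?xs \<and> x = ?xs ! i \<and> y = ?xs ! Suc i"
    then obtain i where i: "Suc i < length ?xs" "x = ?xs ! i" "y = ?xs ! Suc i" by auto
    show "consec X 0 x y" unfolding consec_def
    proof (intro conjI ballI impI)
      show "x \<in> el X 0" "y \<in> el X 0"
        unfolding i(2,3) using i(1) o(2) nth_mem[of _ ?xs] by (blast dest: Suc_lessD)+
      show "x \<noteq> y" using i o(1) by (simp add: nth_eq_iff_index_eq)
      show "((0, x), (0, y)) \<in> tri X" using i le[of i "Suc i"] by simp
      fix z assume "z \<in> el X 0" and z: "((0, x), (0, z)) \<in> tri X \<and> ((0, z), (0, y)) \<in> tri X"
      then obtain j where j: "j < length ?xs" "z = ?xs ! j" using o(2) by (metis in_set_conv_nth)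
      have "i \<le> j" using z j i(1) le[of i j] unfolding i(2) by simp
      moreover have "j \<le> Suc i" using z j i(1) le[of j "Suc i"] unfolding i(3) by simp
      ultimately show "z = x \<or> z = y" using i j by (metis le_SucE le_antisym)
    qed
  qed
  also have "\<dots> \<longleftrightarrow> (x, y) \<in> set (zip ?xs (tl ?xs))"
  proof -
    have "i < length ?xs \<and> i < length (tl ?xs) \<longleftrightarrow> Suc i < length ?xs" for i by auto
    moreover have "tl ?xs ! i = ?xs ! Suc i" if "Suc i < length ?xs" for i
      using that by (simp add: nth_tl)
    ultimately have "x = ?xs ! i \<and> y = ?xs ! Suc i \<and> Suc i < length ?xs \<longleftrightarrow>
        ?xs ! i = x \<and> tl ?xs ! i = y \<and> i < length ?xs \<and> i < length (tl ?xs)" for i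
      by metis
    then show ?thesis unfolding in_set_zip fst_conv snd_conv by blast
  qed
  finally show ?thesis .
qed

lemma ghom_nonempty:
  assumes X: "glob_card X" and c: "consec X 0 y z"
  shows "el (ghom X y z) 0 \<noteq> {}"
proof -
  have "((0, y), (0, z)) \<in> (prec X)\<^sup>*" "y \<noteq> z" using c by (auto simp: consec_def tri_def)
  then obtain e where e: "((0, y), e) \<in> prec X" "(e, (0, z)) \<in> (prec X)\<^sup>*"
    by (metis Pair_inject converse_rtranclE)
  then obtain w where w: "e = (1, w)" "w \<in> el X 1" by (auto simp: prec_def)
  have "w \<in> el (ghom X y z) 0"
    using e w c by (auto simp: ghom_def tri_def elts_def consec_def)
  then show ?thesis by blast
qed

lemma ordinal_graph_Gam:
  assumes "glob_card X"
  shows "ordinal_graph (Gam X)"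
proof -
  have Emp: "ordinal_graph_dim n Empty" for n :: nat by (cases n) auto
  have "ordinal_graph_dim n (Gam X)" if "glob_card X" "\<forall>m > n. el X m = {}" for n and X :: "'a gset"
    using that
  proof (induction n arbitrary: X)
    case 0
    have nc: "\<not> consec X 0 x y" for x y
      using ghom_nonempty[OF 0(1), of x y] 0(2) by (auto simp: ghom_def)
    have "length (obj_list X) \<le> 1"
    proof (rule ccontr)
      assume "\<not> length (obj_list X) \<le> 1"
      then obtain x y zs where "obj_list X = x # y # zs"
        by (metis One_nat_def le_zero_eq length_Cons list.exhaust list.size(3) not_less_eq_eq nat_le_linear)
      then show False using nc[of x y] consec_iff_zip[OF 0(1), of x y] by simp
    qed
    then show ?case using nc by (simp add: Gam.simps[of X])
  next
    case (Suc n)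
    show ?case
    proof (cases "el X 0 = {}")
      case True
      then show ?thesis by (simp add: Gam.simps[of X])
    next
      case False
      have fin: "finite (elts X)" using Suc by (simp add: glob_card_def)
      have G: "Gam X = Graph (obj_list X) (\<lambda>x y. if consec X 0 x y then Gam (ghom X x y) else Empty)"
        using fin False by (subst Gam.simps) simp
      have E: "ordinal_graph_dim n (Gam (ghom X x y))" "obs (Gam (ghom X x y)) \<noteq> []"
        if c: "consec X 0 x y" for x y
      proof -
        have H: "glob_card (ghom X x y)" by (rule glob_card_ghom[OF Suc(2) c])
        have "\<forall>m > n. el (ghom X x y) m = {}" using Suc(3) by (auto simp: ghom_def)
        then show "ordinal_graph_dim n (Gam (ghom X x y))" using Suc(1) H by blast
        have "finite (elts (ghom X x y))" using H by (simp add: glob_card_def)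
        then have "obs (Gam (ghom X x y)) = obj_list (ghom X x y)"
          using ghom_nonempty[OF Suc(2) c] by (subst Gam.simps) simp
        then show "obs (Gam (ghom X x y)) \<noteq> []"
          using obj_list(2)[OF H] ghom_nonempty[OF Suc(2) c] by auto
      qed
      show ?thesis
        using E Emp obj_list(1)[OF Suc(2)] consec_iff_zip[OF Suc(2)] by (auto simp: G)
    qed
  qed
  moreover have "\<exists>n. \<forall>m > n. el X m = {}"
  proof -
    have "finite (fst ` elts X)" using assms by (simp add: glob_card_def)
    then obtain n where "\<forall>k \<in> fst ` elts X. k \<le> n" using finite_nat_set_iff_bounded_le by metis
    then have "el X m = {}" if "m > n" for m
      using that by (fastforce simp: elts_def image_iff)
    then show ?thesis by blast
  qed
  ultimately show ?thesis using assms by (auto simp: ordinal_graph_def)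
qed

end

theory Submission
  imports Defs
begin

text \<open>
  A nonempty globular cardinal \<open>Y\<close> is the same thing as the increasing list of its objects together with
  a nonempty globular cardinal \<open>Y(y, z)\<close> for every two consecutive objects: the homs of a cardinal
  are cardinals, and conversely the order of \<open>Y\<close> can be recovered by inserting the order of each
  hom between its two end points (\<open>glob_card_spineI\<close>).  A morphism \<open>Y \<rightarrow> X\<close> sends consecutive
  objects to consecutive objects, so that an object of the slice over \<open>X\<close> of dimension at most
  \<open>n + 1\<close> is a segment of consecutive objects of \<open>X\<close> and, over each of the homs of \<open>X\<close> in this
  segment, a slice object of dimension at most \<open>n\<close>.  That is also the recursive description of the
  \<open>(n + 1)\<close>-cells of the free \<open>\<omega>\<close>-category on \<open>\<Gamma> X\<close>, and \<open>L_rep\<close> is the translation.  By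
  induction on \<open>n\<close> it is a complete invariant of slice objects that takes every possible value
  (\<open>L_rep_giso\<close>, \<open>L_rep_inj\<close>, \<open>L_rep_in_gcells\<close>, \<open>L_rep_surj\<close>), whence \<open>L\<close> is bijective on cells:
  its inverse sends a cell \<open>c\<close> to the class \<open>rep_class X n c\<close> of all slice objects with value \<open>c\<close>.

  The operations are compared by the same induction.  The sources and targets of \<open>Y\<close> in dimension
  \<open>m + 1\<close> have the objects of \<open>Y\<close>, and their homs are the sources and targets in dimension \<open>m\<close> of
  the homs of \<open>Y\<close> (\<open>hom_card_bnd\<close>); this is the recursion for domains and codomains of cells.  The
  pushout defining a composite along an \<open>m\<close>-cell is the union of two cardinals that meet in the
  \<open>m\<close>-target of one and the \<open>m\<close>-source of the other.  For \<open>m = 0\<close> it concatenates the two lists of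
  objects, and for \<open>m > 0\<close> its homs are unions of the same kind with \<open>m - 1\<close> in place of \<open>m\<close>
  (\<open>L_rep_union\<close>).

  It remains to see that both sides are \<open>\<omega>\<close>-categories.  A family of functors into \<open>n\<close>-categories
  that is jointly injective on cells reflects the axioms (\<open>is_ncat_reflect\<close>).  On the side of graphs
  this applies to the projections from a hom to its factors, and makes the free \<open>\<omega>\<close>-category on an
  ordinal graph an \<open>\<omega>\<close>-category by induction on the dimension of the graph; on the side of globular
  cardinals it applies to \<open>L\<close> itself.
\<close>

section \<open>Reflecting the axioms of an \<open>n\<close>-category\<close>

text \<open>
  The bare closure of the cells under the operations: what can be checked for a candidate structure
  before any of the axioms.
\<close>

definition closed_ocat :: "'c ocat \<Rightarrow> bool" where
  "closed_ocat C \<longleftrightarrow>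
     (\<forall>m n. \<forall>a \<in> ncells C n. m < n \<longrightarrow> mdom C m n a \<in> ncells C m \<and> mcod C m n a \<in> ncells C m) \<and>
     (\<forall>n. \<forall>a \<in> ncells C n. ident C n a \<in> ncells C (Suc n)) \<and>
     (\<forall>m n. \<forall>a \<in> ncells C n. \<forall>b \<in> ncells C n.
        m < n \<and> mdom C m n b = mcod C m n a \<longrightarrow> mcomp C m n b a \<in> ncells C n)"

lemma closed_ocatD:
  assumes "closed_ocat C"
  shows "a \<in> ncells C n \<Longrightarrow> m < n \<Longrightarrow> mdom C m n a \<in> ncells C m"
    and "a \<in> ncells C n \<Longrightarrow> m < n \<Longrightarrow> mcod C m n a \<in> ncells C m"
    and "a \<in> ncells C n \<Longrightarrow> ident C n a \<in> ncells C (Suc n)"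
    and "a \<in> ncells C n \<Longrightarrow> b \<in> ncells C n \<Longrightarrow> m < n \<Longrightarrow> mdom C m n b = mcod C m n a \<Longrightarrow>
           mcomp C m n b a \<in> ncells C n"
  using assms unfolding closed_ocat_def by blast+

lemma ofunctorD:
  assumes "ofunctor C D F"
  shows "a \<in> ncells C n \<Longrightarrow> F n a \<in> ncells D n"
    and "a \<in> ncells C n \<Longrightarrow> m < n \<Longrightarrow> F m (mdom C m n a) = mdom D m n (F n a)"
    and "a \<in> ncells C n \<Longrightarrow> m < n \<Longrightarrow> F m (mcod C m n a) = mcod D m n (F n a)"
    and "a \<in> ncells C n \<Longrightarrow> F (Suc n) (ident C n a) = ident D n (F n a)"
    and "a \<in> ncells C n \<Longrightarrow> b \<in> ncells C n \<Longrightarrow> m < n \<Longrightarrow> mdom C m n b = mcod C m n a \<Longrightarrow>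
           F n (mcomp C m n b a) = mcomp D m n (F n b) (F n a)"
  using assms unfolding ofunctor_def by blast+

lemma hom_ocat_sel [simp]:
  "a \<in> ncells (hom_ocat C x y) n \<longleftrightarrow>
     a \<in> ncells C (Suc n) \<and> mdom C 0 (Suc n) a = x \<and> mcod C 0 (Suc n) a = y"
  "mdom (hom_ocat C x y) m n = mdom C (Suc m) (Suc n)"
  "mcod (hom_ocat C x y) m n = mcod C (Suc m) (Suc n)"
  "ident (hom_ocat C x y) n = ident C (Suc n)"
  "mcomp (hom_ocat C x y) m n = mcomp C (Suc m) (Suc n)"
  by (simp_all add: hom_ocat_def)

lemma prod_ocat_sel [simp]:
  "ncells (prod_ocat C D) n = ncells C n \<times> ncells D n"
  "mdom (prod_ocat C D) m n (a, b) = (mdom C m n a, mdom D m n b)"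
  "mcod (prod_ocat C D) m n (a, b) = (mcod C m n a, mcod D m n b)"
  "ident (prod_ocat C D) n (a, b) = (ident C n a, ident D n b)"
  "mcomp (prod_ocat C D) m n (a, b) (a', b') = (mcomp C m n a a', mcomp D m n b b')"
  by (simp_all add: prod_ocat_def)

lemma idents_mem: "closed_ocat C \<Longrightarrow> x \<in> ncells C 0 \<Longrightarrow> idents C n x \<in> ncells C n"
  by (induction n) (auto intro: closed_ocatD)

lemma functor_idents:
  "closed_ocat C \<Longrightarrow> ofunctor C D F \<Longrightarrow> x \<in> ncells C 0 \<Longrightarrow>
     F n (idents C n x) = idents D n (F 0 x)"
  by (induction n) (auto simp: ofunctorD(4) idents_mem)

lemma closed_discrete:
  assumes C: "discrete_ocat C"
  shows "closed_ocat C"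
proof -
  have bij: "bij_betw (idents C n) (ncells C 0) (ncells C n)" for n
    using C by (simp add: discrete_ocat_def)
  have ops: "mdom C m n (idents C n x) = idents C m x" "mcod C m n (idents C n x) = idents C m x"
    "mcomp C m n (idents C n x) (idents C n x) = idents C n x"
    if "x \<in> ncells C 0" "m < n" for x m n
    using C that by (auto simp: discrete_ocat_def)
  have mem: "idents C n x \<in> ncells C n" if "x \<in> ncells C 0" for n x
    using bij_betwE[OF bij] that by blast
  have ex: "\<exists>x \<in> ncells C 0. a = idents C n x" if "a \<in> ncells C n" for n a
    using bij_betw_imp_surj_on[OF bij] that by blast
  show ?thesis
    unfolding closed_ocat_def
  proof (intro conjI allI ballI impI)
    fix m n a assume "a \<in> ncells C n" "m < n"
    then show "mdom C m n a \<in> ncells C m" "mcod C m n a \<in> ncells C m"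
      using ex ops mem by metis+
  next
    fix n a assume "a \<in> ncells C n"
    then obtain x where "x \<in> ncells C 0" "a = idents C n x" using ex by blast
    then show "ident C n a \<in> ncells C (Suc n)" using mem[of x "Suc n"] by simp
  next
    fix m n a b assume a: "a \<in> ncells C n" and b: "b \<in> ncells C n"
      and c: "m < n \<and> mdom C m n b = mcod C m n a"
    obtain x y where xy: "x \<in> ncells C 0" "a = idents C n x" "y \<in> ncells C 0" "b = idents C n y"
      using ex a b by metis
    then have "idents C m y = idents C m x" using c ops(1)[of y m n] ops(2)[of x m n] by simp
    then have "y = x" using bij_betw_imp_inj_on[OF bij] xy by (meson inj_onD)
    then show "mcomp C m n b a \<in> ncells C n" using xy ops c mem by simp
  qed
qed

text \<open>
  For composition along an \<open>m\<close>-cell with \<open>m > 0\<close> the two cells must be seen to lie in the same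
  hom; this holds since domains and codomains in a hom stay in that hom.
\<close>

lemma closed_ncat: "is_ncat n C \<Longrightarrow> closed_ocat C"
proof (induction n arbitrary: C)
  case 0
  then show ?case by (simp add: closed_discrete)
next
  case (Suc n)
  have ends: "mdom C 0 (Suc k) a \<in> ncells C 0" "mcod C 0 (Suc k) a \<in> ncells C 0"
    if "a \<in> ncells C (Suc k)" for k a
    using Suc.prems that by auto
  have hom: "closed_ocat (hom_ocat C x y)" if "x \<in> ncells C 0" "y \<in> ncells C 0" for x y
    using Suc.IH Suc.prems that by auto
  note hom_ends = hom[OF ends]
  have dc: "mdom C m k a \<in> ncells C m \<and> mcod C m k a \<in> ncells C m
      \<and> (0 < m \<longrightarrow> mdom C 0 m (mdom C m k a) = mdom C 0 k a \<and> mcod C 0 m (mdom C m k a) = mcod C 0 k a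
         \<and> mdom C 0 m (mcod C m k a) = mdom C 0 k a \<and> mcod C 0 m (mcod C m k a) = mcod C 0 k a)"
    if a: "a \<in> ncells C k" "m < k" for m k a
  proof -
    obtain k' where k: "k = Suc k'" using a(2) by (cases k) auto
    show ?thesis
    proof (cases m)
      case 0
      then show ?thesis using ends a k by simp
    next
      case (Suc m')
      then show ?thesis
        using closed_ocatD(1,2)[OF hom_ends, of a k' a k' a k' m'] a k by simp
    qed
  qed
  show ?case
    unfolding closed_ocat_def
  proof (intro conjI allI ballI impI)
    fix m k a assume "a \<in> ncells C k" "m < k"
    then show "mdom C m k a \<in> ncells C m" "mcod C m k a \<in> ncells C m" using dc by auto
  next
    fix k a assume a: "a \<in> ncells C k"
    show "ident C k a \<in> ncells C (Suc k)"
    proof (cases k)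
      case 0
      then show ?thesis using a Suc.prems by auto
    next
      case (Suc k')
      then show ?thesis using closed_ocatD(3)[OF hom_ends, of a k' a k' a k'] a by simp
    qed
  next
    fix m k a b assume a: "a \<in> ncells C k" and b: "b \<in> ncells C k"
      and c: "m < k \<and> mdom C m k b = mcod C m k a"
    obtain k' where k: "k = Suc k'" using c by (cases k) auto
    show "mcomp C m k b a \<in> ncells C k"
    proof (cases m)
      case 0
      let ?x = "mdom C 0 k a" and ?y = "mcod C 0 k a" and ?z = "mcod C 0 k b"
      have "ofunctor (prod_ocat (hom_ocat C ?y ?z) (hom_ocat C ?x ?y)) (hom_ocat C ?x ?z)
          (\<lambda>k (b, a). mcomp C 0 (Suc k) b a)"
        using Suc.prems ends a b k by auto
      from ofunctorD(1)[OF this, of "(b, a)" k'] show ?thesis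
        using a b c k 0 by simp
    next
      case (Suc m')
      have "mdom C 0 k b = mdom C 0 k a" "mcod C 0 k b = mcod C 0 k a"
        using dc[OF a, of m] dc[OF b, of m] c Suc by auto
      then show ?thesis
        using closed_ocatD(4)[OF hom_ends, of a k' a k' a k' b m'] a b c k Suc by simp
    qed
  qed
qed

text \<open>
  All axioms of an \<open>n\<close>-category are equations between cells, or say that a cell lies in a
  hom, which is again an equation for its end points; such equations may be tested after applying
  functors that jointly separate cells.  The one existence statement, that a cell of a \<open>0\<close>-category
  is an iterated identity, also becomes an equation, since the only candidate is its \<open>0\<close>-domain.
  The family may be empty; \<open>C\<close> then has at most one cell in each dimension, like the hom from
  an object of a free \<open>\<omega>\<close>-category on an ordinal graph to itself.
\<close>

lemma is_ncat_reflect: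
  assumes "closed_ocat C"
    and "\<And>i. i \<in> I \<Longrightarrow> is_ncat n (D i)"
    and "\<And>i. i \<in> I \<Longrightarrow> ofunctor C (D i) (F i)"
    and "\<And>k a b. a \<in> ncells C k \<Longrightarrow> b \<in> ncells C k \<Longrightarrow> (\<And>i. i \<in> I \<Longrightarrow> F i k a = F i k b) \<Longrightarrow> a = b"
  shows "is_ncat n C"
  using assms
proof (induction n arbitrary: C D F)
  case 0
  note cl = closed_ocatD[OF 0(1)] and ext = 0(4)
  have D: "discrete_ocat (D i)" if "i \<in> I" for i using 0(2) that by simp
  note fI = functor_idents[OF 0(1) 0(3)] and mem = idents_mem[OF 0(1)]
  have bijD: "bij_betw (idents (D i) k) (ncells (D i) 0) (ncells (D i) k)" if "i \<in> I" for i k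
    using D[OF that] by (simp add: discrete_ocat_def)
  have opsD: "mdom (D i) m k (idents (D i) k x) = idents (D i) m x"
    "mcod (D i) m k (idents (D i) k x) = idents (D i) m x"
    "mcomp (D i) m k (idents (D i) k x) (idents (D i) k x) = idents (D i) k x"
    if "i \<in> I" "x \<in> ncells (D i) 0" "m < k" for i x m k
    using D[OF that(1)] that by (auto simp: discrete_ocat_def)
  have dom: "mdom C m k (idents C k x) = idents C m x" and cod: "mcod C m k (idents C k x) = idents C m x"
    if x: "x \<in> ncells C 0" "m < k" for x m k
  proof -
    show "mdom C m k (idents C k x) = idents C m x"
      using x by (intro ext[of _ m])
        (simp_all add: cl mem fI ofunctorD[OF 0(3)] opsD)
    show "mcod C m k (idents C k x) = idents C m x"
      using x by (intro ext[of _ m])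
        (simp_all add: cl mem fI ofunctorD[OF 0(3)] opsD)
  qed
  have comp: "mcomp C m k (idents C k x) (idents C k x) = idents C k x"
    if x: "x \<in> ncells C 0" "m < k" for x m k
    using x by (intro ext[of _ k])
      (simp_all add: cl mem fI ofunctorD[OF 0(3)] opsD dom cod)
  have "bij_betw (idents C k) (ncells C 0) (ncells C k)" for k
  proof (rule bij_betw_imageI)
    show "inj_on (idents C k) (ncells C 0)"
    proof (rule inj_onI)
      fix x y assume xy: "x \<in> ncells C 0" "y \<in> ncells C 0" "idents C k x = idents C k y"
      show "x = y"
      proof (rule ext[of _ 0, OF xy(1,2)])
        fix i assume i: "i \<in> I"
        have "idents (D i) k (F i 0 x) = idents (D i) k (F i 0 y)"
          using fI[OF i] xy by metis
        then show "F i 0 x = F i 0 y"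
          using bij_betw_imp_inj_on[OF bijD[OF i]] ofunctorD(1)[OF 0(3)[OF i]] xy by (meson inj_onD)
      qed
    qed
    show "idents C k ` ncells C 0 = ncells C k"
    proof (intro equalityI subsetI)
      fix a assume a: "a \<in> ncells C k"
      show "a \<in> idents C k ` ncells C 0"
      proof (cases "k = 0")
        case False
        let ?x = "mdom C 0 k a"
        have x: "?x \<in> ncells C 0" using cl(1) a False by blast
        have "a = idents C k ?x"
        proof (rule ext[OF a mem[OF x]])
          fix i assume i: "i \<in> I"
          obtain y where y: "y \<in> ncells (D i) 0" "F i k a = idents (D i) k y"
            using bij_betw_imp_surj_on[OF bijD[OF i, of k]] ofunctorD(1)[OF 0(3)[OF i] a] by blast
          have "F i 0 ?x = y"
            using ofunctorD(2)[OF 0(3)[OF i] a, of 0] y opsD[OF i y(1), of 0 k] False by simp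
          then show "F i k a = F i k (idents C k ?x)" using fI[OF i x] y by simp
        qed
        then show ?thesis using x by blast
      qed (use a in auto)
    qed (use mem in auto)
  qed
  then show ?case using dom cod comp by (auto simp: discrete_ocat_def)
next
  case (Suc n)
  note cl = closed_ocatD[OF Suc.prems(1)] and ext = Suc.prems(4)
  note fn = ofunctorD[OF Suc.prems(3)]
  have D: "\<And>x y. x \<in> ncells (D i) 0 \<Longrightarrow> y \<in> ncells (D i) 0 \<Longrightarrow> is_ncat n (hom_ocat (D i) x y)"
    "\<And>x. x \<in> ncells (D i) 0 \<Longrightarrow> ident (D i) 0 x \<in> ncells (hom_ocat (D i) x x) 0"
    "\<And>x y z. x \<in> ncells (D i) 0 \<Longrightarrow> y \<in> ncells (D i) 0 \<Longrightarrow> z \<in> ncells (D i) 0 \<Longrightarrow>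
        ofunctor (prod_ocat (hom_ocat (D i) y z) (hom_ocat (D i) x y)) (hom_ocat (D i) x z)
          (\<lambda>k (b, a). mcomp (D i) 0 (Suc k) b a)"
    "\<And>w x y z k a b c. w \<in> ncells (D i) 0 \<Longrightarrow> x \<in> ncells (D i) 0 \<Longrightarrow> y \<in> ncells (D i) 0 \<Longrightarrow>
        z \<in> ncells (D i) 0 \<Longrightarrow> a \<in> ncells (hom_ocat (D i) w x) k \<Longrightarrow>
        b \<in> ncells (hom_ocat (D i) x y) k \<Longrightarrow> c \<in> ncells (hom_ocat (D i) y z) k \<Longrightarrow>
          mcomp (D i) 0 (Suc k) c (mcomp (D i) 0 (Suc k) b a) =
          mcomp (D i) 0 (Suc k) (mcomp (D i) 0 (Suc k) c b) a"
    "\<And>x y k a. x \<in> ncells (D i) 0 \<Longrightarrow> y \<in> ncells (D i) 0 \<Longrightarrow> a \<in> ncells (hom_ocat (D i) x y) k \<Longrightarrow>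
        mcomp (D i) 0 (Suc k) a (idents (D i) (Suc k) x) = a \<and>
        mcomp (D i) 0 (Suc k) (idents (D i) (Suc k) y) a = a"
    if "i \<in> I" for i
    using Suc.prems(2)[OF that] unfolding is_ncat.simps by blast+
  have Fhom: "F i (Suc k) a \<in> ncells (hom_ocat (D i) (F i 0 x) (F i 0 y)) k"
    if "i \<in> I" "a \<in> ncells (hom_ocat C x y) k" for i k a x y
    using that fn[OF that(1), of a "Suc k"] by (auto simp del: One_nat_def)
  have F0: "F i 0 x \<in> ncells (D i) 0" if "i \<in> I" "x \<in> ncells C 0" for i x
    using fn(1) that by blast
  \<comment> \<open>a cell lies in a hom of \<open>C\<close> as soon as all its images lie in the corresponding homs\<close>
  have hom_mem: "u \<in> ncells (hom_ocat C x y) k"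
    if "u \<in> ncells C (Suc k)" "x \<in> ncells C 0" "y \<in> ncells C 0"
      "\<And>i. i \<in> I \<Longrightarrow> F i (Suc k) u \<in> ncells (hom_ocat (D i) (F i 0 x) (F i 0 y)) k" for u x y k
  proof -
    have "mdom C 0 (Suc k) u = x"
      using that fn[OF _ that(1)] by (intro ext[of _ 0]) (simp_all add: cl)
    moreover have "mcod C 0 (Suc k) u = y"
      using that fn[OF _ that(1)] by (intro ext[of _ 0]) (simp_all add: cl)
    ultimately show ?thesis using that(1) by simp
  qed
  have homD: "closed_ocat (hom_ocat (D i) (F i 0 x) (F i 0 y))"
    if "i \<in> I" "x \<in> ncells C 0" "y \<in> ncells C 0" for i x y
    using closed_ncat D(1) F0 that by metis
  have homF: "ofunctor (hom_ocat C x y) (hom_ocat (D i) (F i 0 x) (F i 0 y)) (\<lambda>k. F i (Suc k))"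
    if i: "i \<in> I" for i x y
    unfolding ofunctor_def using Fhom[OF i] fn[OF i] by auto
  have homC: "closed_ocat (hom_ocat C x y)" if xy: "x \<in> ncells C 0" "y \<in> ncells C 0" for x y
    unfolding closed_ocat_def
  proof (intro conjI allI ballI impI)
    fix m k a assume a: "a \<in> ncells (hom_ocat C x y) k" "m < k"
    have "F i (Suc m) (mdom (hom_ocat C x y) m k a) \<in> ncells (hom_ocat (D i) (F i 0 x) (F i 0 y)) m"
      "F i (Suc m) (mcod (hom_ocat C x y) m k a) \<in> ncells (hom_ocat (D i) (F i 0 x) (F i 0 y)) m"
      if i: "i \<in> I" for i
      using closed_ocatD(1,2)[OF homD[OF i xy] Fhom[OF i a(1)] a(2)] ofunctorD(2,3)[OF homF[OF i] a]
      by (simp_all only:)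
    then show "mdom (hom_ocat C x y) m k a \<in> ncells (hom_ocat C x y) m"
      "mcod (hom_ocat C x y) m k a \<in> ncells (hom_ocat C x y) m"
      using a xy cl by (auto intro!: hom_mem simp del: hom_ocat_sel(1)) (auto simp: cl)
  next
    fix k a assume a: "a \<in> ncells (hom_ocat C x y) k"
    have "F i (Suc (Suc k)) (ident (hom_ocat C x y) k a) \<in> ncells (hom_ocat (D i) (F i 0 x) (F i 0 y)) (Suc k)"
      if i: "i \<in> I" for i
      using closed_ocatD(3)[OF homD[OF i xy] Fhom[OF i a(1)]] ofunctorD(4)[OF homF[OF i] a]
      by (simp_all only:)
    then show "ident (hom_ocat C x y) k a \<in> ncells (hom_ocat C x y) (Suc k)"
      using a xy cl by (auto intro!: hom_mem simp del: hom_ocat_sel(1)) (auto simp: cl)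
  next
    fix m k a b assume a: "a \<in> ncells (hom_ocat C x y) k" and b: "b \<in> ncells (hom_ocat C x y) k"
      and c: "m < k \<and> mdom (hom_ocat C x y) m k b = mcod (hom_ocat C x y) m k a"
    have "F i (Suc k) (mcomp (hom_ocat C x y) m k b a) \<in> ncells (hom_ocat (D i) (F i 0 x) (F i 0 y)) k"
      if i: "i \<in> I" for i
    proof -
      have "mdom (hom_ocat (D i) (F i 0 x) (F i 0 y)) m k (F i (Suc k) b) =
          mcod (hom_ocat (D i) (F i 0 x) (F i 0 y)) m k (F i (Suc k) a)"
        using ofunctorD(2,3)[OF homF[OF i]] a b c by metis
      from closed_ocatD(4)[OF homD[OF i xy] Fhom[OF i a] Fhom[OF i b] conjunct1[OF c] this]
      show ?thesis using ofunctorD(5)[OF homF[OF i] a b] c by (simp only:)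
    qed
    moreover have "mcomp (hom_ocat C x y) m k b a \<in> ncells C (Suc k)"
      using a b c cl(4)[of a "Suc k" b "Suc m"] by simp
    ultimately show "mcomp (hom_ocat C x y) m k b a \<in> ncells (hom_ocat C x y) k"
      using xy by (intro hom_mem)
  qed
  have hom_ncat: "is_ncat n (hom_ocat C x y)" if xy: "x \<in> ncells C 0" "y \<in> ncells C 0" for x y
  proof (rule Suc.IH[OF homC[OF xy], where D = "\<lambda>i. hom_ocat (D i) (F i 0 x) (F i 0 y)"])
    show "is_ncat n (hom_ocat (D i) (F i 0 x) (F i 0 y))" if "i \<in> I" for i
      using D(1) F0 that xy by blast
    show "ofunctor (hom_ocat C x y) (hom_ocat (D i) (F i 0 x) (F i 0 y)) (\<lambda>k. F i (Suc k))"
      if "i \<in> I" for i using homF[OF that] .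
    show "a = b" if "a \<in> ncells (hom_ocat C x y) k" "b \<in> ncells (hom_ocat C x y) k"
      "\<And>i. i \<in> I \<Longrightarrow> F i (Suc k) a = F i (Suc k) b" for a b k
      using ext[of a "Suc k" b] that by auto
  qed
  have comp_hom: "mcomp C 0 (Suc k) b a \<in> ncells (hom_ocat C x z) k"
    "\<And>i. i \<in> I \<Longrightarrow> F i (Suc k) (mcomp C 0 (Suc k) b a) = mcomp (D i) 0 (Suc k) (F i (Suc k) b) (F i (Suc k) a)"
    if xyz: "x \<in> ncells C 0" "y \<in> ncells C 0" "z \<in> ncells C 0"
      and ab: "a \<in> ncells (hom_ocat C x y) k" "b \<in> ncells (hom_ocat C y z) k" for x y z a b k
  proof -
    show F: "F i (Suc k) (mcomp C 0 (Suc k) b a) = mcomp (D i) 0 (Suc k) (F i (Suc k) b) (F i (Suc k) a)"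
      if "i \<in> I" for i using ab that fn(5) by auto
    have "mcomp (D i) 0 (Suc k) (F i (Suc k) b) (F i (Suc k) a)
        \<in> ncells (hom_ocat (D i) (F i 0 x) (F i 0 z)) k" if i: "i \<in> I" for i
      using ofunctorD(1)[OF D(3)[OF i F0[OF i xyz(1)] F0[OF i xyz(2)] F0[OF i xyz(3)]],
          of "(F i (Suc k) b, F i (Suc k) a)" k] Fhom[OF i ab(1)] Fhom[OF i ab(2)]
      unfolding prod_ocat_sel case_prod_conv by blast
    then show "mcomp C 0 (Suc k) b a \<in> ncells (hom_ocat C x z) k"
      using ab xyz by (intro hom_mem) (simp_all only: F, auto intro: cl)
  qed
  have comp_fun: "ofunctor (prod_ocat (hom_ocat C y z) (hom_ocat C x y)) (hom_ocat C x z)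
          (\<lambda>k (b, a). mcomp C 0 (Suc k) b a)"
    if xyz: "x \<in> ncells C 0" "y \<in> ncells C 0" "z \<in> ncells C 0" for x y z
  proof -
    note ch = comp_hom[OF xyz]
    have fD: "ofunctor (prod_ocat (hom_ocat (D i) (F i 0 y) (F i 0 z)) (hom_ocat (D i) (F i 0 x) (F i 0 y)))
        (hom_ocat (D i) (F i 0 x) (F i 0 z)) (\<lambda>k (b, a). mcomp (D i) 0 (Suc k) b a)" if "i \<in> I" for i
      using D(3)[OF that] F0[OF that] xyz by blast
    note Fc = ofunctorD[OF fD, unfolded prod_ocat_sel]
    note chom = closed_ocatD[OF homC]
    note Fh = ofunctorD[OF homF]
    have hext: "u = v" if "u \<in> ncells (hom_ocat C x z) k" "v \<in> ncells (hom_ocat C x z) k"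
      "\<And>i. i \<in> I \<Longrightarrow> F i (Suc k) u = F i (Suc k) v" for u v k
      using ext[of u "Suc k" v] that by auto
    have dcomp: "mcomp C 0 (Suc m) (mdom (hom_ocat C y z) m k b) (mdom (hom_ocat C x y) m k a) =
          mdom (hom_ocat C x z) m k (mcomp C 0 (Suc k) b a)"
      if ab: "b \<in> ncells (hom_ocat C y z) k" "a \<in> ncells (hom_ocat C x y) k" and m: "m < k" for m k b a
    proof -
      note d = chom(1)[OF xyz(2,3) ab(1) m] chom(1)[OF xyz(1,2) ab(2) m]
      show ?thesis
      proof (rule hext[OF ch(1)[OF d(2,1)] chom(1)[OF xyz(1,3) ch(1)[OF ab(2,1)] m]])
        fix i assume i: "i \<in> I"
        show "F i (Suc m) (mcomp C 0 (Suc m) (mdom (hom_ocat C y z) m k b) (mdom (hom_ocat C x y) m k a)) =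
          F i (Suc m) (mdom (hom_ocat C x z) m k (mcomp C 0 (Suc k) b a))"
          unfolding Fh(2)[OF i ch(1)[OF ab(2,1)] m] ch(2)[OF d(2,1) i] ch(2)[OF ab(2,1) i]
            Fh(2)[OF i ab(1) m] Fh(2)[OF i ab(2) m]
          using Fc(2)[OF i, of "(F i (Suc k) b, F i (Suc k) a)" k m] Fhom[OF i] ab m
          by (simp del: hom_ocat_sel)
      qed
    qed
    have ccomp: "mcomp C 0 (Suc m) (mcod (hom_ocat C y z) m k b) (mcod (hom_ocat C x y) m k a) =
          mcod (hom_ocat C x z) m k (mcomp C 0 (Suc k) b a)"
      if ab: "b \<in> ncells (hom_ocat C y z) k" "a \<in> ncells (hom_ocat C x y) k" and m: "m < k" for m k b a
    proof -
      note d = chom(2)[OF xyz(2,3) ab(1) m] chom(2)[OF xyz(1,2) ab(2) m]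
      show ?thesis
      proof (rule hext[OF ch(1)[OF d(2,1)] chom(2)[OF xyz(1,3) ch(1)[OF ab(2,1)] m]])
        fix i assume i: "i \<in> I"
        show "F i (Suc m) (mcomp C 0 (Suc m) (mcod (hom_ocat C y z) m k b) (mcod (hom_ocat C x y) m k a)) =
          F i (Suc m) (mcod (hom_ocat C x z) m k (mcomp C 0 (Suc k) b a))"
          unfolding Fh(3)[OF i ch(1)[OF ab(2,1)] m] ch(2)[OF d(2,1) i] ch(2)[OF ab(2,1) i]
            Fh(3)[OF i ab(1) m] Fh(3)[OF i ab(2) m]
          using Fc(3)[OF i, of "(F i (Suc k) b, F i (Suc k) a)" k m] Fhom[OF i] ab m
          by (simp del: hom_ocat_sel)
      qed
    qed
    show ?thesis
      unfolding ofunctor_def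
    proof (intro conjI allI ballI impI; clarsimp simp del: hom_ocat_sel)
      fix k b a assume ab: "b \<in> ncells (hom_ocat C y z) k" "a \<in> ncells (hom_ocat C x y) k"
      show "mcomp C 0 (Suc k) b a \<in> ncells (hom_ocat C x z) k" using ch(1) ab by blast
    next
      fix m k b a assume ab: "b \<in> ncells (hom_ocat C y z) k" "a \<in> ncells (hom_ocat C x y) k" and m: "m < k"
      show "mcomp C 0 (Suc m) (mdom (hom_ocat C y z) m k b) (mdom (hom_ocat C x y) m k a) =
          mdom (hom_ocat C x z) m k (mcomp C 0 (Suc k) b a)" using dcomp[OF ab m] .
      show "mcomp C 0 (Suc m) (mcod (hom_ocat C y z) m k b) (mcod (hom_ocat C x y) m k a) =
          mcod (hom_ocat C x z) m k (mcomp C 0 (Suc k) b a)" using ccomp[OF ab m] .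
    next
      fix k b a assume ab: "b \<in> ncells (hom_ocat C y z) k" "a \<in> ncells (hom_ocat C x y) k"
      note d = chom(3)[OF xyz(2,3) ab(1)] chom(3)[OF xyz(1,2) ab(2)]
      show "mcomp C 0 (Suc (Suc k)) (ident (hom_ocat C y z) k b) (ident (hom_ocat C x y) k a) =
          ident (hom_ocat C x z) k (mcomp C 0 (Suc k) b a)"
      proof (rule hext[OF ch(1)[OF d(2,1)] chom(3)[OF xyz(1,3) ch(1)[OF ab(2,1)]]])
        fix i assume i: "i \<in> I"
        show "F i (Suc (Suc k)) (mcomp C 0 (Suc (Suc k)) (ident (hom_ocat C y z) k b) (ident (hom_ocat C x y) k a)) =
          F i (Suc (Suc k)) (ident (hom_ocat C x z) k (mcomp C 0 (Suc k) b a))"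
          unfolding Fh(4)[OF i ch(1)[OF ab(2,1)]] ch(2)[OF d(2,1) i] ch(2)[OF ab(2,1) i]
            Fh(4)[OF i ab(1)] Fh(4)[OF i ab(2)]
          using Fc(4)[OF i, of "(F i (Suc k) b, F i (Suc k) a)" k] Fhom[OF i] ab
          by (simp del: hom_ocat_sel)
      qed
    next
      fix m k b a b' a'
      assume ab: "b \<in> ncells (hom_ocat C y z) k" "a \<in> ncells (hom_ocat C x y) k"
        and ab': "b' \<in> ncells (hom_ocat C y z) k" "a' \<in> ncells (hom_ocat C x y) k"
        and m: "m < k"
        and c: "mdom (hom_ocat C y z) m k b' = mcod (hom_ocat C y z) m k b"
          "mdom (hom_ocat C x y) m k a' = mcod (hom_ocat C x y) m k a"
      note d = chom(4)[OF xyz(2,3) ab(1) ab'(1) m c(1)] chom(4)[OF xyz(1,2) ab(2) ab'(2) m c(2)]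
      have e: "mdom (hom_ocat C x z) m k (mcomp C 0 (Suc k) b' a') =
          mcod (hom_ocat C x z) m k (mcomp C 0 (Suc k) b a)"
      proof -
        have "mdom (hom_ocat C x z) m k (mcomp C 0 (Suc k) b' a') =
            mcomp C 0 (Suc m) (mdom (hom_ocat C y z) m k b') (mdom (hom_ocat C x y) m k a')"
          using dcomp[OF ab' m] by simp
        also have "\<dots> = mcod (hom_ocat C x z) m k (mcomp C 0 (Suc k) b a)"
          unfolding c using ccomp[OF ab m] .
        finally show ?thesis .
      qed
      show "mcomp C 0 (Suc k) (mcomp (hom_ocat C y z) m k b' b) (mcomp (hom_ocat C x y) m k a' a) =
          mcomp (hom_ocat C x z) m k (mcomp C 0 (Suc k) b' a') (mcomp C 0 (Suc k) b a)"
      proof (rule hext[OF ch(1)[OF d(2,1)]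
              chom(4)[OF xyz(1,3) ch(1)[OF ab(2,1)] ch(1)[OF ab'(2,1)] m e]])
        fix i assume i: "i \<in> I"
        show "F i (Suc k) (mcomp C 0 (Suc k) (mcomp (hom_ocat C y z) m k b' b) (mcomp (hom_ocat C x y) m k a' a)) =
          F i (Suc k) (mcomp (hom_ocat C x z) m k (mcomp C 0 (Suc k) b' a') (mcomp C 0 (Suc k) b a))"
          unfolding Fh(5)[OF i ch(1)[OF ab(2,1)] ch(1)[OF ab'(2,1)] m e]
            ch(2)[OF d(2,1) i] ch(2)[OF ab(2,1) i] ch(2)[OF ab'(2,1) i]
            Fh(5)[OF i ab(1) ab'(1) m c(1)] Fh(5)[OF i ab(2) ab'(2) m c(2)]
          using Fc(5)[OF i, of "(F i (Suc k) b, F i (Suc k) a)" k "(F i (Suc k) b', F i (Suc k) a')" m]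
            Fhom[OF i ab(1)] Fhom[OF i ab(2)] Fhom[OF i ab'(1)] Fhom[OF i ab'(2)] m
            Fh(2)[OF i ab'(1) m] Fh(3)[OF i ab(1) m] Fh(2)[OF i ab'(2) m] Fh(3)[OF i ab(2) m] c
          by (simp del: hom_ocat_sel)
      qed
    qed
  qed
  have id0: "ident C 0 x \<in> ncells (hom_ocat C x x) 0" if x: "x \<in> ncells C 0" for x
  proof (rule hom_mem[OF cl(3)[OF x] x x])
    fix i assume i: "i \<in> I"
    show "F i (Suc 0) (ident C 0 x) \<in> ncells (hom_ocat (D i) (F i 0 x) (F i 0 x)) 0"
      using D(2)[OF i F0[OF i x]] fn(4)[OF i x] by simp
  qed
  have ids: "idents C (Suc k) x \<in> ncells (hom_ocat C x x) k" if x: "x \<in> ncells C 0" for k x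
  proof (induction k)
    case (Suc k)
    from closed_ocatD(3)[OF homC[OF x x] this] show ?case by simp
  qed (use id0[OF x] in simp)
  show ?case
    unfolding is_ncat.simps
  proof (intro conjI ballI allI)
    fix k a assume "a \<in> ncells C (Suc k)"
    then show "mdom C 0 (Suc k) a \<in> ncells C 0" "mcod C 0 (Suc k) a \<in> ncells C 0"
      using cl(1,2) by blast+
  next
    fix x y assume "x \<in> ncells C 0" "y \<in> ncells C 0"
    then show "is_ncat n (hom_ocat C x y)" by (rule hom_ncat)
  next
    fix x assume "x \<in> ncells C 0"
    then show "ident C 0 x \<in> ncells (hom_ocat C x x) 0" by (rule id0)
  next
    fix x y z assume "x \<in> ncells C 0" "y \<in> ncells C 0" "z \<in> ncells C 0"
    then show "ofunctor (prod_ocat (hom_ocat C y z) (hom_ocat C x y)) (hom_ocat C x z)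
          (\<lambda>k (b, a). mcomp C 0 (Suc k) b a)" by (rule comp_fun)
  next
    fix w x y z k a b c
    assume o: "w \<in> ncells C 0" "x \<in> ncells C 0" "y \<in> ncells C 0" "z \<in> ncells C 0"
      and a: "a \<in> ncells (hom_ocat C w x) k" and b: "b \<in> ncells (hom_ocat C x y) k"
      and c: "c \<in> ncells (hom_ocat C y z) k"
    note ba = comp_hom[OF o(1,2,3) a b] and cb = comp_hom[OF o(2,3,4) b c]
    note c_ba = comp_hom[OF o(1,3,4) ba(1) c] and cb_a = comp_hom[OF o(1,2,4) a cb(1)]
    show "mcomp C 0 (Suc k) c (mcomp C 0 (Suc k) b a) = mcomp C 0 (Suc k) (mcomp C 0 (Suc k) c b) a"
    proof (rule ext)
      show "mcomp C 0 (Suc k) c (mcomp C 0 (Suc k) b a) \<in> ncells C (Suc k)"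
        "mcomp C 0 (Suc k) (mcomp C 0 (Suc k) c b) a \<in> ncells C (Suc k)"
        using c_ba(1) cb_a(1) by simp_all
      fix i assume i: "i \<in> I"
      show "F i (Suc k) (mcomp C 0 (Suc k) c (mcomp C 0 (Suc k) b a)) =
          F i (Suc k) (mcomp C 0 (Suc k) (mcomp C 0 (Suc k) c b) a)"
        unfolding c_ba(2)[OF i] cb_a(2)[OF i] ba(2)[OF i] cb(2)[OF i]
        by (rule D(4)[OF i F0[OF i o(1)] F0[OF i o(2)] F0[OF i o(3)] F0[OF i o(4)]
              Fhom[OF i a] Fhom[OF i b] Fhom[OF i c]])
    qed
  next
    fix x y k a assume o: "x \<in> ncells C 0" "y \<in> ncells C 0" and a: "a \<in> ncells (hom_ocat C x y) k"
    note l = comp_hom[OF o(1,1,2) ids[OF o(1)] a] and r = comp_hom[OF o(1,2,2) a ids[OF o(2)]]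
    have aC: "a \<in> ncells C (Suc k)" using a by simp
    have unit: "mcomp (D i) 0 (Suc k) (F i (Suc k) a) (F i (Suc k) (idents C (Suc k) x)) = F i (Suc k) a"
      "mcomp (D i) 0 (Suc k) (F i (Suc k) (idents C (Suc k) y)) (F i (Suc k) a) = F i (Suc k) a"
      if i: "i \<in> I" for i
      using D(5)[OF i F0[OF i o(1)] F0[OF i o(2)] Fhom[OF i a]]
        functor_idents[OF Suc.prems(1) Suc.prems(3)[OF i] o(1), of "Suc k"]
        functor_idents[OF Suc.prems(1) Suc.prems(3)[OF i] o(2), of "Suc k"] by simp_all
    show "mcomp C 0 (Suc k) a (idents C (Suc k) x) = a"
      using l(1) by (intro ext[OF _ aC]) (simp, simp only: l(2) unit)
    show "mcomp C 0 (Suc k) (idents C (Suc k) y) a = a"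
      using r(1) by (intro ext[OF _ aC]) (simp, simp only: r(2) unit)
  qed
qed

section \<open>The free \<open>\<omega>\<close>-category on an ordinal graph is an \<open>\<omega>\<close>-category\<close>

lemma free_graph_sel [simp]:
  "ncells (free_graph G) n = gcells n G"
  "mdom (free_graph G) m n = gdom m" "mcod (free_graph G) m n = gcod m"
  "ident (free_graph G) n = gident" "mcomp (free_graph G) m n = gcomp m"
  by (simp_all add: free_graph_def)

lemma Arr_in_gcells:
  assumes "distinct (obs G)" "h < length (obs G)" "k < length (obs G)"
  shows "Arr (obs G ! h) (obs G ! k) cs \<in> gcells (Suc n) G \<longleftrightarrow>
    h \<le> k \<and> length cs = k - h \<and>
    (\<forall>i < k - h. cs ! i \<in> gcells n (edge G (obs G ! (h + i)) (obs G ! Suc (h + i))))"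
proof
  assume "Arr (obs G ! h) (obs G ! k) cs \<in> gcells (Suc n) G"
  then obtain h' k' where *: "obs G ! h = obs G ! h'" "obs G ! k = obs G ! k'"
    "h' \<le> k'" "k' < length (obs G)" "length cs = k' - h'"
    "\<forall>i < k' - h'. cs ! i \<in> gcells n (edge G (obs G ! (h' + i)) (obs G ! Suc (h' + i)))"
    by auto
  then have "h = h'" "k = k'" using assms nth_eq_iff_index_eq[OF assms(1)] by auto
  then show "h \<le> k \<and> length cs = k - h \<and>
    (\<forall>i < k - h. cs ! i \<in> gcells n (edge G (obs G ! (h + i)) (obs G ! Suc (h + i))))"
    using * by simp
qed (use assms in auto)

lemma gcells_SucE:
  assumes "c \<in> gcells (Suc n) G"
  obtains h k cs where "c = Arr (obs G ! h) (obs G ! k) cs" "h \<le> k" "k < length (obs G)"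
    "length cs = k - h" "\<And>i. i < k - h \<Longrightarrow> cs ! i \<in> gcells n (edge G (obs G ! (h + i)) (obs G ! Suc (h + i)))"
  using assms by auto

lemma ncat_free_graph_dim0:
  assumes "length (obs G) \<le> 1"
  shows "is_ncat 0 (free_graph G)"
proof (cases "obs G")
  case Nil
  then have "gcells n G = {}" for n by (cases n) auto
  then show ?thesis by (simp add: discrete_ocat_def bij_betw_def)
next
  case (Cons x xs)
  then have o: "obs G = [x]" using assms by simp
  have c: "gcells n G = {idents (free_graph G) n (Obj x)}"
    and i: "idents (free_graph G) n (Obj x) = (if n = 0 then Obj x else Arr x x [])" for n
  proof -
    show i: "idents (free_graph G) n (Obj x) = (if n = 0 then Obj x else Arr x x [])" for n
      by (induction n) auto
    show "gcells n G = {idents (free_graph G) n (Obj x)}"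
      unfolding i using o by (cases n) auto
  qed
  show ?thesis
    unfolding is_ncat.simps discrete_ocat_def free_graph_sel
  proof (intro conjI allI ballI impI)
    show "bij_betw (idents (free_graph G) n) (gcells 0 G) (gcells n G)" for n
      unfolding c[of n] using o by (simp add: bij_betw_def)
  next
    fix y m n assume y: "y \<in> gcells 0 G" and m: "m < (n :: nat)"
    have "y = Obj x" using y o by simp
    then show "gdom m (idents (free_graph G) n y) = idents (free_graph G) m y"
      "gcod m (idents (free_graph G) n y) = idents (free_graph G) m y"
      "gcomp m (idents (free_graph G) n y) (idents (free_graph G) n y) = idents (free_graph G) n y"
      using m by (cases m; simp add: i)+
  qed
qed

text \<open>
  The hom from \<open>x\<^sub>h\<close> to \<open>x\<^sub>k\<close> is a product, and its projections are jointly injective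
  functors to the free \<open>\<omega>\<close>-categories on the edge-objects.  Composition of homs is
  concatenation, for which associativity, the unit laws and interchange are laws of lists.
\<close>

lemma ncat_free_graph: "ordinal_graph_dim n G \<Longrightarrow> is_ncat n (free_graph G)"
proof (induction n arbitrary: G)
  case 0
  then show ?case using ncat_free_graph_dim0[of G] by simp
next
  case (Suc n)
  let ?F = "free_graph G" and ?xs = "obs G"
  have dist: "distinct ?xs" using Suc.prems by simp
  have edge: "is_ncat n (free_graph (edge G x y))" if "x \<in> set ?xs" "y \<in> set ?xs" for x y
    using Suc that by simp
  note Arr_iff = Arr_in_gcells[OF dist]
  have arr: "\<exists>cs. a = Arr (?xs ! h) (?xs ! k) cs \<and> h \<le> k \<and> length cs = k - h \<and>
      (\<forall>i < k - h. cs ! i \<in> gcells m (edge G (?xs ! (h + i)) (?xs ! Suc (h + i))))"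
    if "a \<in> ncells (hom_ocat ?F (Obj (?xs ! h)) (Obj (?xs ! k))) m" "h < length ?xs" "k < length ?xs"
    for a h k m
  proof -
    have a: "a \<in> gcells (Suc m) G" "gdom 0 a = Obj (?xs ! h)" "gcod 0 a = Obj (?xs ! k)"
      using that(1) by auto
    then obtain cs where "a = Arr (?xs ! h) (?xs ! k) cs" by (auto elim!: gcells_SucE)
    then show ?thesis using a Arr_iff[OF that(2,3)] by blast
  qed
  have mem: "Arr (?xs ! h) (?xs ! k) cs \<in> ncells (hom_ocat ?F (Obj (?xs ! h)) (Obj (?xs ! k))) m \<longleftrightarrow>
      h \<le> k \<and> length cs = k - h \<and>
      (\<forall>i < k - h. cs ! i \<in> gcells m (edge G (?xs ! (h + i)) (?xs ! Suc (h + i))))"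
    if "h < length ?xs" "k < length ?xs" for cs h k m
    using Arr_iff[OF that] by simp
  have obj: "\<exists>h < length ?xs. x = Obj (?xs ! h)" if "x \<in> gcells 0 G" for x
    using that by (auto simp: in_set_conv_nth)
  have hom: "is_ncat n (hom_ocat ?F (Obj (?xs ! h)) (Obj (?xs ! k)))"
    if hk: "h < length ?xs" "k < length ?xs" for h k
  proof -
    let ?H = "hom_ocat ?F (Obj (?xs ! h)) (Obj (?xs ! k))"
    let ?D = "\<lambda>i. free_graph (edge G (?xs ! (h + i)) (?xs ! Suc (h + i)))"
    let ?p = "\<lambda>i (m :: nat) c. (case c of Arr x y cs \<Rightarrow> cs ! i | Obj x \<Rightarrow> c)"
    note arr = arr[OF _ hk] and mem = mem[OF hk]
    have D: "is_ncat n (?D i)" if "i < k - h" for i using edge hk that by simp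
    note cl = closed_ncat[OF D]
    note dcl = closed_ocatD(1)[OF cl, simplified] and ccl = closed_ocatD(2)[OF cl, simplified]
      and icl = closed_ocatD(3)[OF cl, simplified] and mcl = closed_ocatD(4)[OF cl, simplified]
    show ?thesis
    proof (rule is_ncat_reflect[of _ "{i. i < k - h}" _ ?D ?p])
      show "closed_ocat ?H"
        unfolding closed_ocat_def
      proof (intro conjI allI ballI impI)
        fix m l a assume a: "a \<in> ncells ?H l" "m < l"
        then show "mdom ?H m l a \<in> ncells ?H m" "mcod ?H m l a \<in> ncells ?H m"
          using arr[OF a(1)] dcl[OF _ _ a(2)] ccl[OF _ _ a(2)] by (auto simp: mem simp del: hom_ocat_sel(1))
      next
        fix l a assume a: "a \<in> ncells ?H l"
        then show "ident ?H l a \<in> ncells ?H (Suc l)"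
          using arr[OF a(1)] icl by (auto simp: mem simp del: hom_ocat_sel(1))
      next
        fix m l a b assume a: "a \<in> ncells ?H l" and b: "b \<in> ncells ?H l"
          and c: "m < l \<and> mdom ?H m l b = mcod ?H m l a"
        obtain cs where cs: "a = Arr (?xs ! h) (?xs ! k) cs" "length cs = k - h" "h \<le> k"
            "\<And>i. i < k - h \<Longrightarrow> cs ! i \<in> gcells l (edge G (?xs ! (h + i)) (?xs ! Suc (h + i)))"
          using arr[OF a] by auto
        obtain ds where ds: "b = Arr (?xs ! h) (?xs ! k) ds" "length ds = k - h"
            "\<And>i. i < k - h \<Longrightarrow> ds ! i \<in> gcells l (edge G (?xs ! (h + i)) (?xs ! Suc (h + i)))"
          using arr[OF b] by auto
        have "map (gdom m) ds = map (gcod m) cs" using c cs(1) ds(1) by simp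
        then have "gdom m (ds ! i) = gcod m (cs ! i)" if "i < k - h" for i
          using that cs(2) ds(2) by (metis nth_map)
        then show "mcomp ?H m l b a \<in> ncells ?H l"
          using c mcl cs ds by (auto simp: mem simp del: hom_ocat_sel(1))
      qed
      show "is_ncat n (?D i)" if "i \<in> {i. i < k - h}" for i using D that by simp
      show "ofunctor ?H (?D i) (?p i)" if i: "i \<in> {i. i < k - h}" for i
        unfolding ofunctor_def
      proof (intro conjI allI ballI impI)
        fix l a assume a: "a \<in> ncells ?H l"
        show "?p i l a \<in> ncells (?D i) l" using arr[OF a] i by auto
        show "?p i (Suc l) (ident ?H l a) = ident (?D i) l (?p i l a)" using arr[OF a] i by auto
      next
        fix m l a assume a: "a \<in> ncells ?H l" "m < l"
        show "?p i m (mdom ?H m l a) = mdom (?D i) m l (?p i l a)" using arr[OF a(1)] i by auto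
        show "?p i m (mcod ?H m l a) = mcod (?D i) m l (?p i l a)" using arr[OF a(1)] i by auto
      next
        fix m l a b assume a: "a \<in> ncells ?H l" and b: "b \<in> ncells ?H l"
          and c: "m < l \<and> mdom ?H m l b = mcod ?H m l a"
        show "?p i l (mcomp ?H m l b a) = mcomp (?D i) m l (?p i l b) (?p i l a)"
          using arr[OF a] arr[OF b] i by auto
      qed
      show "a = b" if "a \<in> ncells ?H l" "b \<in> ncells ?H l"
        "\<And>i. i \<in> {i. i < k - h} \<Longrightarrow> ?p i l a = ?p i l b" for l a b
        using arr[OF that(1)] arr[OF that(2)] that(3) by (auto intro: nth_equalityI)
    qed
  qed
  have ids: "idents ?F (Suc m) (Obj x) = Arr x x []" for m x
    by (induction m) auto
  have arr': "\<exists>h k cs. x = Obj (?xs ! h) \<and> y = Obj (?xs ! k) \<and> h < length ?xs \<and> k < length ?xs \<and>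
      a = Arr (?xs ! h) (?xs ! k) cs \<and> h \<le> k \<and> length cs = k - h \<and>
      (\<forall>i < k - h. cs ! i \<in> gcells m (edge G (?xs ! (h + i)) (?xs ! Suc (h + i))))"
    if "a \<in> ncells (hom_ocat ?F x y) m" "x \<in> gcells 0 G" "y \<in> gcells 0 G" for a x y m
    using obj[OF that(2)] obj[OF that(3)] arr that(1) by blast
  have comp: "ofunctor (prod_ocat (hom_ocat ?F y z) (hom_ocat ?F x y)) (hom_ocat ?F x z)
          (\<lambda>k (b, a). mcomp ?F 0 (Suc k) b a)"
    if o: "x \<in> gcells 0 G" "y \<in> gcells 0 G" "z \<in> gcells 0 G" for x y z
  proof -
    obtain j where j: "j < length ?xs" "x = Obj (?xs ! j)" using obj[OF o(1)] by blast
    obtain k where k: "k < length ?xs" "y = Obj (?xs ! k)" using obj[OF o(2)] by blast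
    obtain l where l: "l < length ?xs" "z = Obj (?xs ! l)" using obj[OF o(3)] by blast
    show ?thesis
      unfolding ofunctor_def
    proof (intro conjI allI ballI impI; clarsimp simp del: hom_ocat_sel(1))
      fix m b a assume b: "b \<in> ncells (hom_ocat ?F y z) m" and a: "a \<in> ncells (hom_ocat ?F x y) m"
      obtain cs where cs: "a = Arr (?xs ! j) (?xs ! k) cs" "length cs = k - j" "j \<le> k"
            "\<And>i. i < k - j \<Longrightarrow> cs ! i \<in> gcells m (edge G (?xs ! (j + i)) (?xs ! Suc (j + i)))"
        using arr a j k by blast
      obtain ds where ds: "b = Arr (?xs ! k) (?xs ! l) ds" "length ds = l - k" "k \<le> l"
            "\<And>i. i < l - k \<Longrightarrow> ds ! i \<in> gcells m (edge G (?xs ! (k + i)) (?xs ! Suc (k + i)))"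
        using arr b l k by blast
      have "(cs @ ds) ! i \<in> gcells m (edge G (?xs ! (j + i)) (?xs ! Suc (j + i)))" if "i < l - j" for i
      proof (cases "i < k - j")
        case False
        then show ?thesis using ds(4)[of "i - (k - j)"] that cs ds by (simp add: nth_append add.commute)
      qed (use cs in \<open>simp add: nth_append\<close>)
      then show "gcomp 0 b a \<in> ncells (hom_ocat ?F x z) m"
        unfolding j(2) l(2) cs(1) ds(1) gcomp.simps mem[OF j(1) l(1)] using cs ds by simp
      show "gcomp 0 (gident b) (gident a) = gident (gcomp 0 b a)"
        using cs ds by simp
    next
      fix m n b a assume b: "b \<in> ncells (hom_ocat ?F y z) n" and a: "a \<in> ncells (hom_ocat ?F x y) n"
      show "gcomp 0 (gdom (Suc m) b) (gdom (Suc m) a) = gdom (Suc m) (gcomp 0 b a)"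
        "gcomp 0 (gcod (Suc m) b) (gcod (Suc m) a) = gcod (Suc m) (gcomp 0 b a)"
        using arr'[OF a o(1,2)] arr'[OF b o(2,3)] by auto
    next
      fix m n b a b' a' assume b: "b \<in> ncells (hom_ocat ?F y z) n" and a: "a \<in> ncells (hom_ocat ?F x y) n"
       and b': "b' \<in> ncells (hom_ocat ?F y z) n" and a': "a' \<in> ncells (hom_ocat ?F x y) n"
      have nth_inj: "?xs ! h = ?xs ! h' \<longleftrightarrow> h = h'" if "h < length ?xs" "h' < length ?xs" for h h'
        using nth_eq_iff_index_eq[OF dist] that .
      show "gcomp 0 (gcomp (Suc m) b' b) (gcomp (Suc m) a' a) =
          gcomp (Suc m) (gcomp 0 b' a') (gcomp 0 b a)"
        using arr'[OF a o(1,2)] arr'[OF b o(2,3)] arr'[OF a' o(1,2)] arr'[OF b' o(2,3)] nth_inj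
        by (clarsimp simp del: hom_ocat_sel)
    qed
  qed
  show ?case
    unfolding is_ncat.simps free_graph_sel(1)
  proof (intro conjI ballI allI)
    fix k a assume "a \<in> gcells (Suc k) G"
    then show "mdom ?F 0 (Suc k) a \<in> gcells 0 G" "mcod ?F 0 (Suc k) a \<in> gcells 0 G"
      by (auto elim!: gcells_SucE)
  next
    fix x y assume "x \<in> gcells 0 G" "y \<in> gcells 0 G"
    then show "is_ncat n (hom_ocat ?F x y)" using obj hom by metis
  next
    fix x assume "x \<in> gcells 0 G"
    then obtain h where h: "h < length ?xs" "x = Obj (?xs ! h)" using obj by blast
    then show "ident ?F 0 x \<in> ncells (hom_ocat ?F x x) 0" using mem[of h h "[]" 0] by simp
  next
    fix x y z assume "x \<in> gcells 0 G" "y \<in> gcells 0 G" "z \<in> gcells 0 G"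
    then show "ofunctor (prod_ocat (hom_ocat ?F y z) (hom_ocat ?F x y)) (hom_ocat ?F x z)
          (\<lambda>k (b, a). mcomp ?F 0 (Suc k) b a)" by (rule comp)
  next
    fix w x y z k a b c
    assume o: "w \<in> gcells 0 G" "x \<in> gcells 0 G" "y \<in> gcells 0 G" "z \<in> gcells 0 G"
      and a: "a \<in> ncells (hom_ocat ?F w x) k" and b: "b \<in> ncells (hom_ocat ?F x y) k"
      and c: "c \<in> ncells (hom_ocat ?F y z) k"
    show "mcomp ?F 0 (Suc k) c (mcomp ?F 0 (Suc k) b a) = mcomp ?F 0 (Suc k) (mcomp ?F 0 (Suc k) c b) a"
      using arr'[OF a o(1,2)] arr'[OF b o(2,3)] arr'[OF c o(3,4)] by auto
  next
    fix x y k a assume o: "x \<in> gcells 0 G" "y \<in> gcells 0 G" and a: "a \<in> ncells (hom_ocat ?F x y) k"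
    show "mcomp ?F 0 (Suc k) a (idents ?F (Suc k) x) = a"
      "mcomp ?F 0 (Suc k) (idents ?F (Suc k) y) a = a"
      using arr'[OF a o] by (auto simp: ids simp del: idents.simps)
  qed
qed

lemma omega_cat_free_graph: "ordinal_graph G \<Longrightarrow> omega_cat (free_graph G)"
  using ncat_free_graph by (auto simp: ordinal_graph_def omega_cat_def)

section \<open>Globular cardinals as lists of homs\<close>

abbreviation steps :: "'a list \<Rightarrow> ('a \<times> 'a) list" where
  "steps xs \<equiv> zip xs (tl xs)"

lemma in_steps_iff: "(y, z) \<in> set (steps ys) \<longleftrightarrow> (\<exists>i. Suc i < length ys \<and> y = ys ! i \<and> z = ys ! Suc i)"
proof -
  have "i < length (tl ys) \<longleftrightarrow> Suc i < length ys" for i by auto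
  then show ?thesis by (auto simp: in_set_zip nth_tl)
qed

lemma steps_map: "steps (map f xs) = map (map_prod f f) (steps xs)"
  by (simp add: map_tl[symmetric] zip_map_map map_prod_def)

lemma steps_append:
  "xs \<noteq> [] \<Longrightarrow> ys \<noteq> [] \<Longrightarrow> last xs = hd ys \<Longrightarrow> steps (xs @ tl ys) = steps xs @ steps ys"
proof (induction xs)
  case (Cons x xs)
  show ?case
  proof (cases "xs = []")
    case True
    then show ?thesis using Cons.prems by (cases ys) auto
  next
    case False
    then obtain x' xs' where "xs = x' # xs'" by (cases xs) auto
    then show ?thesis using Cons by simp
  qed
qed simp

lemma steps_distinct: "distinct ys \<Longrightarrow> (y, z) \<in> set (steps ys) \<Longrightarrow> y \<noteq> z"
  by (auto simp: in_steps_iff nth_eq_iff_index_eq)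

text \<open>
  The globular set \<open>Y(y, z)\<close> cut out by the iterated \<open>0\<close>-sources and \<open>0\<close>-targets instead of by the
  order.  Membership then depends only on the source and target maps, so that it restricts to
  subsets and is preserved by every morphism.
\<close>

definition hom_card :: "'a gset \<Rightarrow> 'a \<Rightarrow> 'a \<Rightarrow> 'a gset" where
  "hom_card Y y z =
     \<lparr> el = (\<lambda>k. {x \<in> el Y (Suc k). end_el (src Y) (Suc k) x = y \<and> end_el (tgt Y) (Suc k) x = z}),
       src = (\<lambda>k. src Y (Suc k)),
       tgt = (\<lambda>k. tgt Y (Suc k)) \<rparr>"

lemma in_hom_card:
  "x \<in> el (hom_card Y y z) k \<longleftrightarrow>
     x \<in> el Y (Suc k) \<and> end_el (src Y) (Suc k) x = y \<and> end_el (tgt Y) (Suc k) x = z"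
  by (simp add: hom_card_def)

lemma hom_card_sel [simp]:
  "src (hom_card Y y z) k = src Y (Suc k)" "tgt (hom_card Y y z) k = tgt Y (Suc k)"
  by (simp_all add: hom_card_def)

lemma globD:
  assumes "globular_set Y"
  shows "x \<in> el Y (Suc n) \<Longrightarrow> src Y n x \<in> el Y n"
    and "x \<in> el Y (Suc n) \<Longrightarrow> tgt Y n x \<in> el Y n"
    and "x \<in> el Y (Suc (Suc n)) \<Longrightarrow> src Y n (src Y (Suc n) x) = src Y n (tgt Y (Suc n) x)"
    and "x \<in> el Y (Suc (Suc n)) \<Longrightarrow> tgt Y n (src Y (Suc n) x) = tgt Y n (tgt Y (Suc n) x)"
  using assms by (simp_all add: globular_set_def)

lemma end_el_src_tgt:
  assumes "globular_set Y" "x \<in> el Y (Suc (Suc n))"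
  shows "end_el (src Y) (Suc n) (src Y (Suc n) x) = end_el (src Y) (Suc (Suc n)) x"
    and "end_el (src Y) (Suc n) (tgt Y (Suc n) x) = end_el (src Y) (Suc (Suc n)) x"
    and "end_el (tgt Y) (Suc n) (src Y (Suc n) x) = end_el (tgt Y) (Suc (Suc n)) x"
    and "end_el (tgt Y) (Suc n) (tgt Y (Suc n) x) = end_el (tgt Y) (Suc (Suc n)) x"
  using globD(3,4)[OF assms] by simp_all

declare end_el.simps(2) [simp del]

lemma globular_hom_card:
  assumes "globular_set Y"
  shows "globular_set (hom_card Y y z)"
  using globD[OF assms] end_el_src_tgt[OF assms]
  unfolding globular_set_def by (auto simp: in_hom_card)

lemma ghom_eq_hom_card: "glob_card Y \<Longrightarrow> consec Y 0 y z \<Longrightarrow> ghom Y y z = hom_card Y y z"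
  by (rule gset.equality) (auto simp: fun_eq_iff set_eq_iff ghom_iff in_hom_card, simp_all add: ghom_def)

lemma elts_iff: "(k, x) \<in> elts Y \<longleftrightarrow> x \<in> el Y k"
  by (simp add: elts_def)

lemma prec_iff:
  "((j, x), (k, y)) \<in> prec Y \<longleftrightarrow>
     (k = Suc j \<and> y \<in> el Y k \<and> x = src Y j y) \<or> (j = Suc k \<and> x \<in> el Y j \<and> y = tgt Y k x)"
  by (auto simp: prec_def)

lemma prec_src: "x \<in> el Y (Suc n) \<Longrightarrow> ((n, src Y n x), (Suc n, x)) \<in> prec Y"
  and prec_tgt: "x \<in> el Y (Suc n) \<Longrightarrow> ((Suc n, x), (n, tgt Y n x)) \<in> prec Y"
  by (simp_all add: prec_iff)

lemma hom_card_path: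
  assumes "((j, x), (k, w)) \<in> (prec (hom_card Y y z))\<^sup>*"
  shows "((Suc j, x), (Suc k, w)) \<in> (prec Y)\<^sup>*"
  using assms
proof (induction "(k, w)" arbitrary: k w rule: rtrancl_induct)
  case (step b k w)
  obtain k' w' where b: "b = (k', w')" by fastforce
  have "((Suc k', w'), (Suc k, w)) \<in> prec Y"
    using step(2) unfolding b by (auto simp: prec_iff in_hom_card)
  with step(3)[OF b] show ?case by (rule rtrancl_into_rtrancl)
qed simp

lemma triD: "(a, b) \<in> tri Y \<Longrightarrow> a \<in> elts Y \<and> b \<in> elts Y \<and> (a, b) \<in> (prec Y)\<^sup>*"
  by (simp add: tri_def)

lemma glob_cardD:
  assumes "glob_card Y"
  shows "globular_set Y" "finite (elts Y)"
    "\<And>a b. a \<in> elts Y \<Longrightarrow> b \<in> elts Y \<Longrightarrow> (a, b) \<in> (prec Y)\<^sup>* \<or> (b, a) \<in> (prec Y)\<^sup>*"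
proof -
  show "globular_set Y" "finite (elts Y)" using assms by (auto simp: glob_card_def)
  have tot: "total_on (elts Y) (tri Y)" using assms by (simp add: glob_card_def linear_order_on_def)
  fix a b assume ab: "a \<in> elts Y" "b \<in> elts Y"
  show "(a, b) \<in> (prec Y)\<^sup>* \<or> (b, a) \<in> (prec Y)\<^sup>*"
  proof (cases "a = b")
    case False
    then have "(a, b) \<in> tri Y \<or> (b, a) \<in> tri Y" using tot ab unfolding total_on_def by metis
    then show ?thesis by (auto dest: triD)
  qed simp
qed

lemma glob_cardI:
  assumes "globular_set Y" "finite (elts Y)"
    "\<And>a b. a \<in> elts Y \<Longrightarrow> b \<in> elts Y \<Longrightarrow> (a, b) \<in> (prec Y)\<^sup>* \<or> (b, a) \<in> (prec Y)\<^sup>*"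
    "\<And>a b. a \<in> elts Y \<Longrightarrow> b \<in> elts Y \<Longrightarrow> (a, b) \<in> (prec Y)\<^sup>* \<Longrightarrow> (b, a) \<in> (prec Y)\<^sup>* \<Longrightarrow> a = b"
  shows "glob_card Y"
  unfolding glob_card_def linear_order_on_def partial_order_on_def preorder_on_def
proof (intro conjI)
  show "refl_on (elts Y) (tri Y)" by (auto simp: refl_on_def tri_def)
  show "tri Y \<subseteq> elts Y \<times> elts Y" by (auto simp: tri_def)
  show "trans (tri Y)" by (auto simp: trans_def tri_def)
  show "antisym (tri Y)" using assms(4) by (auto simp: antisym_def tri_def)
  show "total_on (elts Y) (tri Y)" using assms(3) by (auto simp: total_on_def tri_def)
qed (use assms in auto)

text \<open>
  \<open>ys\<close> lists the objects of \<open>Y\<close> in an order for which every element of positive dimension lies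
  between two neighbours: the skeleton to which the orders of the homs are attached.
\<close>

definition spine :: "'a gset \<Rightarrow> 'a list \<Rightarrow> bool" where
  "spine Y ys \<longleftrightarrow> globular_set Y \<and> ys \<noteq> [] \<and> distinct ys \<and> set ys = el Y 0 \<and>
     (\<forall>k. \<forall>x \<in> el Y (Suc k). (end_el (src Y) (Suc k) x, end_el (tgt Y) (Suc k) x) \<in> set (steps ys))"

text \<open>
  An object comparable with \<open>x\<close> lies before its \<open>0\<close>-source or after its \<open>0\<close>-target, because a
  path through the elements can enter or leave the hom of \<open>x\<close> only through its end points.
\<close>

lemma consec_ends:
  assumes Y: "glob_card Y" and x: "x \<in> el Y (Suc k)"
  shows "consec Y 0 (end_el (src Y) (Suc k) x) (end_el (tgt Y) (Suc k) x)"
proof -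
  let ?y = "end_el (src Y) (Suc k) x" and ?z = "end_el (tgt Y) (Suc k) x"
  note g = glob_cardD(1)[OF Y]
  note m = end_el_mem[OF g x]
  have xe: "(Suc k, x) \<in> elts Y" using x by (simp add: elts_iff)
  have "?y \<noteq> ?z"
  proof
    assume "?y = ?z"
    then have "(0, ?y) = (Suc k, x)"
      using m xe by (intro tri_antisym[OF Y]) (auto simp: elts_iff)
    then show False by simp
  qed
  moreover have "w = ?y \<or> w = ?z"
    if w: "w \<in> el Y 0" "((0, ?y), (0, w)) \<in> tri Y" "((0, w), (0, ?z)) \<in> tri Y" for w
  proof -
    have we: "(0, w) \<in> elts Y" using w by (simp add: elts_iff)
    from glob_cardD(3)[OF Y xe we] show ?thesis
    proof
      assume "((Suc k, x), (0, w)) \<in> (prec Y)\<^sup>*"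
      from path_from[OF g this] have "((0, ?z), (0, w)) \<in> (prec Y)\<^sup>*" by simp
      then have "(0, ?z) = (0 :: nat, w)"
        using m w we triD[OF w(3)] by (intro tri_antisym[OF Y]) (auto simp: elts_iff)
      then show ?thesis by simp
    next
      assume "((0, w), (Suc k, x)) \<in> (prec Y)\<^sup>*"
      from path_to[OF g this] have "((0, w), (0, ?y)) \<in> (prec Y)\<^sup>*" by simp
      then have "(0, ?y) = (0 :: nat, w)"
        using m w we triD[OF w(2)] by (intro tri_antisym[OF Y]) (auto simp: elts_iff)
      then show ?thesis by simp
    qed
  qed
  ultimately show ?thesis
    using m by (auto simp: consec_def tri_def elts_iff)
qed

lemma spine_obj_list:
  assumes "glob_card Y" "el Y 0 \<noteq> {}"
  shows "spine Y (obj_list Y)"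
  using obj_list[OF assms(1)] assms consec_ends[OF assms(1)]
  unfolding spine_def consec_iff_zip[OF assms(1)] by (auto dest: glob_cardD(1))

lemma glob_card_hom_card:
  assumes "glob_card Y" "consec Y 0 y z"
  shows "glob_card (hom_card Y y z)" "el (hom_card Y y z) 0 \<noteq> {}"
  using glob_card_ghom[OF assms] ghom_nonempty[OF assms] ghom_eq_hom_card[OF assms] by auto

text \<open>
  A \<open>1\<close>-dimensional element of each hom connects the two neighbours.
\<close>

lemma spine_path:
  assumes sp: "spine Y ys"
    and hom: "\<And>y z. (y, z) \<in> set (steps ys) \<Longrightarrow> el (hom_card Y y z) 0 \<noteq> {}"
    and ij: "i \<le> j" "j < length ys"
  shows "((0, ys ! i), (0, ys ! j)) \<in> (prec Y)\<^sup>*"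
  using ij
proof (induction j)
  case (Suc j)
  show ?case
  proof (cases "i = Suc j")
    case False
    have "(ys ! j, ys ! Suc j) \<in> set (steps ys)" using Suc.prems by (auto simp: in_steps_iff)
    then obtain w where w: "w \<in> el Y (Suc 0)" "src Y 0 w = ys ! j" "tgt Y 0 w = ys ! Suc j"
      using hom by (fastforce simp: in_hom_card end_el.simps)
    have "((0, ys ! i), (0, ys ! j)) \<in> (prec Y)\<^sup>*" using Suc False by simp
    also have "((0, ys ! j), (Suc 0, w)) \<in> prec Y" using prec_src[OF w(1)] w by simp
    also have "((Suc 0, w), (0, ys ! Suc j)) \<in> prec Y" using prec_tgt[OF w(1)] w by simp
    finally show ?thesis .
  qed simp
qed simp

text \<open>
  The converse of \<open>spine_obj_list\<close> and \<open>glob_card_hom_card\<close>: the order of each hom, inserted between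
  its two end points, gives a linear order of all elements.  It makes it possible to recognise
  boundaries, unions and images as cardinals by induction on the dimension.
\<close>

lemma glob_card_spineI:
  assumes sp: "spine Y ys"
    and hom: "\<And>y z. (y, z) \<in> set (steps ys) \<Longrightarrow> glob_card (hom_card Y y z) \<and> el (hom_card Y y z) 0 \<noteq> {}"
  shows "glob_card Y" "obj_list Y = ys"
proof -
  have g: "globular_set Y" and dist: "distinct ys" and set: "set ys = el Y 0"
    and ends: "\<And>k x. x \<in> el Y (Suc k) \<Longrightarrow> (end_el (src Y) (Suc k) x, end_el (tgt Y) (Suc k) x) \<in> set (steps ys)"
    using sp by (auto simp: spine_def)
  define idx where "idx = the_inv_into {..<length ys} ((!) ys)"
  have idx: "idx (ys ! i) = i" if "i < length ys" for i
    unfolding idx_def using that dist by (intro the_inv_into_f_f) (auto simp: inj_on_nth)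
  have idx_step: "idx z = Suc (idx y)" if "(y, z) \<in> set (steps ys)" for y z
    using that idx by (auto simp: in_steps_iff)
  \<comment> \<open>a height that separates the objects and the homs, and does not decrease along \<open>prec\<close>\<close>
  define pos where "pos = (\<lambda>(n, x). case n of 0 \<Rightarrow> 2 * idx x | Suc k \<Rightarrow> 2 * idx (end_el (src Y) (Suc k) x) + 1)"
  have pos0: "pos (0, x) = 2 * idx x" and posS: "pos (Suc k, x) = 2 * idx (end_el (src Y) (Suc k) x) + 1" for k x
    by (simp_all add: pos_def)
  have mono: "pos a \<le> pos b" if ab: "(a, b) \<in> prec Y" for a b
  proof -
    obtain j x k y where e: "a = (j, x)" "b = (k, y)" by fastforce
    show ?thesis
    proof (cases j)
      case 0
      then show ?thesis using ab unfolding e by (auto simp: prec_iff pos0 posS end_el.simps)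
    next
      case (Suc j')
      show ?thesis
      proof (cases k)
        case 0
        then have "j' = 0" "x \<in> el Y (Suc 0)" "y = tgt Y 0 x" using ab Suc unfolding e by (auto simp: prec_iff)
        then show ?thesis using idx_step[OF ends[of x 0]] unfolding e Suc 0 by (simp add: pos0 posS end_el.simps)
      next
        fix k' assume k: "k = Suc k'"
        show ?thesis using end_el_step[OF g ab[unfolded e Suc k]] unfolding e Suc k by (simp add: posS)
      qed
    qed
  qed
  have path: "pos a \<le> pos b \<and> (pos a = pos b \<longrightarrow> a = b \<or>
      (\<exists>j x k w. a = (Suc j, x) \<and> b = (Suc k, w) \<and>
         end_el (src Y) (Suc k) w = end_el (src Y) (Suc j) x \<and>
         end_el (tgt Y) (Suc k) w = end_el (tgt Y) (Suc j) x \<and>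
         ((j, x), (k, w)) \<in> (prec (hom_card Y (end_el (src Y) (Suc j) x) (end_el (tgt Y) (Suc j) x)))\<^sup>*))"
    if "(a, b) \<in> (prec Y)\<^sup>*" for a b
    using that
  proof (induction rule: rtrancl_induct)
    case (step b c)
    have bc: "pos b \<le> pos c" using mono[OF step(2)] .
    have "a = c \<or>
      (\<exists>j x k w. a = (Suc j, x) \<and> c = (Suc k, w) \<and>
         end_el (src Y) (Suc k) w = end_el (src Y) (Suc j) x \<and>
         end_el (tgt Y) (Suc k) w = end_el (tgt Y) (Suc j) x \<and>
         ((j, x), (k, w)) \<in> (prec (hom_card Y (end_el (src Y) (Suc j) x) (end_el (tgt Y) (Suc j) x)))\<^sup>*)"
      if "pos a = pos c"
    proof -
      have eq: "pos a = pos b" "pos b = pos c" using that bc step(3) by auto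
      obtain l v where c: "c = (l, v)" by fastforce
      have "fst b \<noteq> 0"
      proof
        assume "fst b = 0"
        then obtain y where b: "b = (0, y)" by (cases b) auto
        then have "l = Suc 0" using step(2) c by (auto simp: prec_iff)
        then have "odd (pos c)" using c posS by simp
        moreover have "even (pos b)" using b pos0 by simp
        ultimately show False using eq by simp
      qed
      then obtain k w where b: "b = (Suc k, w)" by (cases b) (auto simp: gr0_conv_Suc)
      have "l \<noteq> 0"
      proof
        assume "l = 0"
        then have "even (pos c)" using c pos0 by simp
        moreover have "odd (pos b)" using b posS by simp
        ultimately show False using eq by simp
      qed
      then obtain l' where l: "l = Suc l'" by (cases l) auto
      have bc': "((Suc k, w), (Suc l', v)) \<in> prec Y" using step(2) b c l by simp
      note e = end_el_step[OF g bc']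
      have aS: "\<exists>j x. a = (Suc j, x) \<and>
         end_el (src Y) (Suc k) w = end_el (src Y) (Suc j) x \<and>
         end_el (tgt Y) (Suc k) w = end_el (tgt Y) (Suc j) x \<and>
         ((j, x), (k, w)) \<in> (prec (hom_card Y (end_el (src Y) (Suc j) x) (end_el (tgt Y) (Suc j) x)))\<^sup>*"
        using step(3) eq b by auto
      then obtain j x where a: "a = (Suc j, x)"
         "end_el (src Y) (Suc k) w = end_el (src Y) (Suc j) x"
         "end_el (tgt Y) (Suc k) w = end_el (tgt Y) (Suc j) x"
         "((j, x), (k, w)) \<in> (prec (hom_card Y (end_el (src Y) (Suc j) x) (end_el (tgt Y) (Suc j) x)))\<^sup>*"
        by blast
      have "((k, w), (l', v)) \<in> prec (hom_card Y (end_el (src Y) (Suc j) x) (end_el (tgt Y) (Suc j) x))"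
        using bc' prec_elts[OF g bc'] e a by (auto simp: prec_iff in_hom_card elts_iff)
      then show ?thesis using a c l e by (auto intro: rtrancl_into_rtrancl)
    qed
    then show ?case using bc step(3) by auto
  qed simp
  have sh: "(end_el (src Y) (Suc k) x, end_el (tgt Y) (Suc k) x) \<in> set (steps ys)"
    "x \<in> el (hom_card Y (end_el (src Y) (Suc k) x) (end_el (tgt Y) (Suc k) x)) k" if "x \<in> el Y (Suc k)" for x k
    using ends that by (auto simp: in_hom_card)
  show gc: "glob_card Y"
  proof (rule glob_cardI[OF g])
    let ?up = "\<lambda>(k :: nat, a :: 'a). (Suc k, a)"
    have "elts Y \<subseteq> Pair 0 ` set ys \<union> (\<Union>(y, z) \<in> set (steps ys). ?up ` elts (hom_card Y y z))"
    proof
      fix a assume a: "a \<in> elts Y"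
      obtain n x where e: "a = (n, x)" by fastforce
      show "a \<in> Pair 0 ` set ys \<union> (\<Union>(y, z) \<in> set (steps ys). ?up ` elts (hom_card Y y z))"
      proof (cases n)
        case 0
        then show ?thesis using a e set by (auto simp: elts_iff)
      next
        case (Suc k)
        then have x: "x \<in> el Y (Suc k)" using a e by (simp add: elts_iff)
        have "a \<in> ?up ` elts (hom_card Y (end_el (src Y) (Suc k) x) (end_el (tgt Y) (Suc k) x))"
          using sh(2)[OF x] e Suc by (intro image_eqI[of _ _ "(k, x)"]) (simp_all add: elts_iff)
        then show ?thesis using sh(1)[OF x] by blast
      qed
    qed
    moreover have "finite (\<Union>(y, z) \<in> set (steps ys). ?up ` elts (hom_card Y y z))"
      using glob_cardD(2) hom by (intro finite_UN_I) auto
    ultimately show "finite (elts Y)" by (meson finite_UnI finite_imageI finite_set finite_subset)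
  next
    fix a b assume a: "a \<in> elts Y" and b: "b \<in> elts Y"
      and ab: "(a, b) \<in> (prec Y)\<^sup>*" and ba: "(b, a) \<in> (prec Y)\<^sup>*"
    show "a = b"
    proof (rule ccontr)
      assume ne: "a \<noteq> b"
      have "pos a = pos b" using path[OF ab] path[OF ba] by simp
      then obtain j x k w where e: "a = (Suc j, x)" "b = (Suc k, w)"
         "end_el (src Y) (Suc k) w = end_el (src Y) (Suc j) x"
         "end_el (tgt Y) (Suc k) w = end_el (tgt Y) (Suc j) x" and
         1: "((j, x), (k, w)) \<in> (prec (hom_card Y (end_el (src Y) (Suc j) x) (end_el (tgt Y) (Suc j) x)))\<^sup>*"
        using path[OF ab] ne by blast
      have 2: "((k, w), (j, x)) \<in> (prec (hom_card Y (end_el (src Y) (Suc j) x) (end_el (tgt Y) (Suc j) x)))\<^sup>*"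
        using path[OF ba] ne \<open>pos a = pos b\<close> e by auto
      have "(j, x) = (k, w)"
        using 1 2 hom[OF sh(1)[of x j]] a b sh(2)[of x j] sh(2)[of w k] e(3,4)
        unfolding e(1,2) by (intro tri_antisym) (auto simp: elts_iff)
      then show False using ne e by simp
    qed
  next
    fix a b assume a: "a \<in> elts Y" and b: "b \<in> elts Y"
    have spp: "((0, y), (0, z)) \<in> (prec Y)\<^sup>*" if "y \<in> el Y 0" "z \<in> el Y 0" "idx y \<le> idx z" for y z
    proof -
      have "y \<in> set ys" "z \<in> set ys" using that set by auto
      then obtain i j where "i < length ys" "y = ys ! i" "j < length ys" "z = ys ! j"
        by (metis in_set_conv_nth)
      then show ?thesis using spine_path[OF sp _, of i j] hom idx that by auto
    qed
    have idx_inj: "y = z" if "y \<in> el Y 0" "z \<in> el Y 0" "idx y = idx z" for y z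
      using that idx set by (metis in_set_conv_nth)
    have main: "(a, b) \<in> (prec Y)\<^sup>* \<or> (b, a) \<in> (prec Y)\<^sup>*"
      if a: "a \<in> elts Y" and b: "b \<in> elts Y" and le: "pos a \<le> pos b" for a b
    proof -
      obtain j x where ea: "a = (j, x)" by fastforce
      obtain k w where eb: "b = (k, w)" by fastforce
      have xY: "x \<in> el Y j" and wY: "w \<in> el Y k" using a b ea eb by (auto simp: elts_iff)
      note mx = end_el_mem[OF g xY] and mw = end_el_mem[OF g wY]
      show ?thesis
      proof (cases "idx (end_el (tgt Y) j x) \<le> idx (end_el (src Y) k w)")
        case True
        have "((j, x), (k, w)) \<in> (prec Y)\<^sup>*"
          using mx mw spp[OF _ _ True] by (meson rtrancl_trans)
        then show ?thesis using ea eb by simp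
      next
        case False
        show ?thesis
        proof (cases "j = 0")
          case True
          then have "k \<noteq> 0 \<longrightarrow> False" using False le unfolding ea eb
            by (cases k) (auto simp: pos0 posS)
          then show ?thesis using False le ea eb True by (auto simp: pos0)
        next
          case jS: False
          then obtain j' where j: "j = Suc j'" by (cases j) auto
          have kS: "k \<noteq> 0"
            using False le idx_step[OF ends[of x j']] xY unfolding ea eb j by (cases k) (auto simp: pos0 posS)
          then obtain k' where k: "k = Suc k'" by (cases k) auto
          have ix: "idx (end_el (src Y) j x) = idx (end_el (src Y) k w)"
            using False le idx_step[OF ends[of x j']] xY unfolding ea eb j k by (auto simp: posS)
          have s: "end_el (src Y) j x = end_el (src Y) k w"
            using idx_inj[OF _ _ ix] mx mw by blast
          have t: "end_el (tgt Y) j x = end_el (tgt Y) k w"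
            using idx_inj[of "end_el (tgt Y) j x" "end_el (tgt Y) k w"] mx mw ix
              idx_step[OF ends[of x j']] idx_step[OF ends[of w k']] xY wY j k by auto
          let ?H = "hom_card Y (end_el (src Y) j x) (end_el (tgt Y) j x)"
          have H: "glob_card ?H" using hom sh(1)[of x j'] xY j by auto
          have "(j', x) \<in> elts ?H" "(k', w) \<in> elts ?H"
            using xY wY s t j k by (auto simp: elts_iff in_hom_card)
          from glob_cardD(3)[OF H this] show ?thesis
            using hom_card_path ea eb j k by metis
        qed
      qed
    qed
    show "(a, b) \<in> (prec Y)\<^sup>* \<or> (b, a) \<in> (prec Y)\<^sup>*"
      using main[OF a b] main[OF b a] by linarith
  qed
  have sorted: "sorted_wrt (\<lambda>x y. ((0, x), (0, y)) \<in> tri Y) ys"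
    unfolding sorted_wrt_iff_nth_less tri_def
    using spine_path[OF sp] hom set by (auto simp: elts_iff)
  have L: "linear_order_on (el Y 0) {(x, y). ((0, x), (0, y)) \<in> tri Y}"
  proof -
    have an: "\<And>x y. x \<in> el Y 0 \<Longrightarrow> y \<in> el Y 0 \<Longrightarrow> ((0, x), (0, y)) \<in> (prec Y)\<^sup>* \<Longrightarrow> ((0, y), (0, x)) \<in> (prec Y)\<^sup>* \<Longrightarrow> x = y"
      using tri_antisym[OF gc] by (metis elts_iff prod.inject)
    show ?thesis
      unfolding linear_order_on_def partial_order_on_def preorder_on_def
      using an glob_cardD(3)[OF gc]
      by (auto simp: refl_on_def trans_def antisym_def total_on_def tri_def elts_iff)
  qed
  have fin: "finite (el Y 0)" using set by (metis List.finite_set)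
  from finite_linear_list[OF fin L] show "obj_list Y = ys"
    using obj_list[OF gc] dist set sorted by auto
qed

text \<open>
  The cardinals \<open>Y\<close> that may occur in an \<open>n\<close>-cell \<open>Y \<rightarrow> X\<close>.
\<close>

definition glob_card_le :: "nat \<Rightarrow> 'a gset \<Rightarrow> bool" where
  "glob_card_le n Y \<longleftrightarrow> glob_card Y \<and> elts Y \<noteq> {} \<and> (\<forall>m > n. el Y m = {})"

lemma el_0_nonempty: "globular_set Y \<Longrightarrow> elts Y \<noteq> {} \<Longrightarrow> el Y 0 \<noteq> {}"
  using end_el_mem by (fastforce simp: elts_def)

text \<open>
  Together with \<open>glob_card_le_spine\<close> and \<open>glob_card_le_hom\<close> this is a recursive characterisation
  of the cardinals of dimension at most \<open>n + 1\<close>, and with \<open>glob_card_le_0\<close> it replaces the order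
  in all inductions below.
\<close>

lemma glob_card_le_SucI:
  assumes sp: "spine Y ys" and hom: "\<And>y z. (y, z) \<in> set (steps ys) \<Longrightarrow> glob_card_le n (hom_card Y y z)"
  shows "glob_card_le (Suc n) Y" "obj_list Y = ys"
proof -
  have hom': "glob_card (hom_card Y y z) \<and> el (hom_card Y y z) 0 \<noteq> {}" if "(y, z) \<in> set (steps ys)" for y z
    using hom[OF that] el_0_nonempty[of "hom_card Y y z"] glob_cardD(1)[of "hom_card Y y z"]
    by (auto simp: glob_card_le_def)
  note * = glob_card_spineI[OF sp hom']
  show "obj_list Y = ys" by (rule *(2))
  have "el Y m = {}" if m: "m > Suc n" for m
  proof (rule ccontr)
    assume "el Y m \<noteq> {}"
    then obtain x where x: "x \<in> el Y m" by blast
    obtain k where k: "m = Suc k" using m by (cases m) auto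
    have "(end_el (src Y) (Suc k) x, end_el (tgt Y) (Suc k) x) \<in> set (steps ys)"
      using sp x k by (auto simp: spine_def)
    from hom[OF this] have "el (hom_card Y (end_el (src Y) (Suc k) x) (end_el (tgt Y) (Suc k) x)) k = {}"
      using k m by (simp add: glob_card_le_def)
    moreover have "x \<in> el (hom_card Y (end_el (src Y) (Suc k) x) (end_el (tgt Y) (Suc k) x)) k"
      using x k by (simp add: in_hom_card)
    ultimately show False by blast
  qed
  moreover have "el Y 0 \<noteq> {}" using sp by (auto simp: spine_def)
  ultimately show "glob_card_le (Suc n) Y"
    using *(1) by (auto simp: glob_card_le_def elts_def)
qed

lemma glob_card_le_spine: "glob_card_le n Y \<Longrightarrow> spine Y (obj_list Y)"
  by (simp add: glob_card_le_def spine_obj_list el_0_nonempty glob_cardD(1))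

lemma glob_card_le_consec:
  "glob_card_le n Y \<Longrightarrow> consec Y 0 y z \<longleftrightarrow> (y, z) \<in> set (steps (obj_list Y))"
  by (simp add: glob_card_le_def consec_iff_zip)

lemma glob_card_le_hom:
  assumes "glob_card_le (Suc n) Y" "(y, z) \<in> set (steps (obj_list Y))"
  shows "glob_card_le n (hom_card Y y z)"
proof -
  have Y: "glob_card Y" and c: "consec Y 0 y z"
    using assms glob_card_le_consec[OF assms(1)] by (auto simp: glob_card_le_def)
  show ?thesis
    using glob_card_hom_card[OF Y c] assms(1)
    by (auto simp: glob_card_le_def in_hom_card elts_def)
qed

lemma glob_card_le_0:
  "glob_card_le 0 Y \<longleftrightarrow> globular_set Y \<and> (\<exists>y. el Y 0 = {y}) \<and> (\<forall>m > 0. el Y m = {})"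
proof
  assume Y: "glob_card_le 0 Y"
  note sp = glob_card_le_spine[OF Y]
  have "steps (obj_list Y) = []"
  proof (rule ccontr)
    assume "steps (obj_list Y) \<noteq> []"
    then obtain y z where "(y, z) \<in> set (steps (obj_list Y))" by (metis hd_in_set surj_pair)
    then have "consec Y 0 y z" using glob_card_le_consec[OF Y] by blast
    then show False using glob_card_hom_card(2)[of Y y z] Y by (auto simp: glob_card_le_def in_hom_card)
  qed
  then obtain y where "obj_list Y = [y]"
    using sp unfolding spine_def by (cases "obj_list Y"; cases "tl (obj_list Y)") auto
  then have "el Y 0 = {y}" using sp by (auto simp: spine_def)
  then show "globular_set Y \<and> (\<exists>y. el Y 0 = {y}) \<and> (\<forall>m > 0. el Y m = {})"
    using Y by (auto simp: glob_card_le_def glob_cardD(1))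
next
  assume Y: "globular_set Y \<and> (\<exists>y. el Y 0 = {y}) \<and> (\<forall>m > 0. el Y m = {})"
  then obtain y where y: "el Y 0 = {y}" by auto
  then have "spine Y [y]" using Y by (auto simp: spine_def)
  from glob_card_spineI(1)[OF this] show "glob_card_le 0 Y"
    using Y y by (auto simp: glob_card_le_def elts_def)
qed

lemma L_rep_Suc_hom:
  assumes "glob_card Y"
  shows "L_rep (Suc n) Y g =
    Arr (g 0 (hd (obj_list Y))) (g 0 (last (obj_list Y)))
      (map (\<lambda>(y, z). L_rep n (hom_card Y y z) (mor_shift g)) (steps (obj_list Y)))"
  using consec_iff_zip[OF assms] ghom_eq_hom_card[OF assms] by (auto simp: Let_def)

declare L_rep.simps(2) [simp del]

section \<open>Sources and targets of globular cardinals\<close>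

text \<open>
  The order of the hom is contained in the order restricted from \<open>Y\<close>, and both are linear.
\<close>

lemma tri_hom_card:
  assumes Y: "glob_card Y" and c: "consec Y 0 y z"
    and a: "x \<in> el (hom_card Y y z) j" and b: "w \<in> el (hom_card Y y z) k"
  shows "((j, x), (k, w)) \<in> tri (hom_card Y y z) \<longleftrightarrow> ((Suc j, x), (Suc k, w)) \<in> tri Y"
proof
  have e: "(Suc j, x) \<in> elts Y" "(Suc k, w) \<in> elts Y" using a b by (auto simp: elts_iff in_hom_card)
  show "((Suc j, x), (Suc k, w)) \<in> tri Y" if "((j, x), (k, w)) \<in> tri (hom_card Y y z)"
    using that hom_card_path e by (auto simp: tri_def)
  assume *: "((Suc j, x), (Suc k, w)) \<in> tri Y"
  have H: "glob_card (hom_card Y y z)" using glob_card_hom_card[OF Y c] by blast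
  have eH: "(j, x) \<in> elts (hom_card Y y z)" "(k, w) \<in> elts (hom_card Y y z)"
    using a b by (auto simp: elts_iff)
  from glob_cardD(3)[OF H eH] show "((j, x), (k, w)) \<in> tri (hom_card Y y z)"
  proof
    assume "((k, w), (j, x)) \<in> (prec (hom_card Y y z))\<^sup>*"
    then have "(Suc j, x) = (Suc k, w)"
      using hom_card_path triD[OF *] by (intro tri_antisym[OF Y]) auto
    then show ?thesis using eH by (auto simp: tri_def)
  qed (use eH in \<open>simp add: tri_def\<close>)
qed

text \<open>
  An element \<open>w\<close> of dimension \<open>l\<close> between the source and the target of \<open>x\<close> lies in the same hom as
  these, for otherwise it would be separated from one of them by an end point of that hom; so the
  claim descends to the hom.
\<close>

lemma consec_src_tgt:
  assumes "glob_card Y" "x \<in> el Y (Suc l)"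
  shows "consec Y l (src Y l x) (tgt Y l x)"
  using assms
proof (induction l arbitrary: Y)
  case 0
  then show ?case using consec_ends[of Y x 0] by (simp add: end_el.simps)
next
  case (Suc l)
  note g = glob_cardD(1)[OF Suc.prems(1)]
  let ?y = "end_el (src Y) (Suc (Suc l)) x" and ?z = "end_el (tgt Y) (Suc (Suc l)) x"
  let ?H = "hom_card Y ?y ?z" and ?p = "src Y (Suc l) x" and ?q = "tgt Y (Suc l) x"
  have c: "consec Y 0 ?y ?z" using consec_ends[OF Suc.prems] .
  have "x \<in> el ?H (Suc l)" using Suc.prems by (simp add: in_hom_card)
  from Suc.IH[OF glob_card_hom_card(1)[OF Suc.prems(1) c] this]
  have H: "consec ?H l ?p ?q" by simp
  note tri = tri_hom_card[OF Suc.prems(1) c]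
  show ?case
    unfolding consec_def
  proof (intro conjI ballI impI)
    show p: "?p \<in> el Y (Suc l)" and q: "?q \<in> el Y (Suc l)" and "?p \<noteq> ?q"
      using H by (auto simp: consec_def in_hom_card)
    show "((Suc l, ?p), (Suc l, ?q)) \<in> tri Y" using H tri by (auto simp: consec_def)
    fix w assume w: "w \<in> el Y (Suc l)"
      and pwq: "((Suc l, ?p), (Suc l, w)) \<in> tri Y \<and> ((Suc l, w), (Suc l, ?q)) \<in> tri Y"
    have ends: "end_el (src Y) (Suc l) ?p = ?y" "end_el (tgt Y) (Suc l) ?p = ?z"
      "end_el (tgt Y) (Suc l) ?q = ?z"
      using end_el_src_tgt[OF g Suc.prems(2)] by auto
    have "((0, ?z), (Suc l, w)) \<notin> (prec Y)\<^sup>*"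
    proof
      assume zw: "((0, ?z), (Suc l, w)) \<in> (prec Y)\<^sup>*"
      have "((Suc l, w), (0, ?z)) \<in> (prec Y)\<^sup>*"
        using triD[OF conjunct2[OF pwq]] end_el_mem[OF g q] ends by (auto intro: rtrancl_trans)
      then have "(0, ?z) = (Suc l, w)"
        using zw w end_el_mem[OF g q] ends by (intro tri_antisym[OF Suc.prems(1)]) (auto simp: elts_iff)
      then show False by simp
    qed
    then have "same_ends Y (Suc l, ?p) (Suc l, w)"
      using path_from[OF g, of "(Suc l, ?p)" "(Suc l, w)"] triD[OF conjunct1[OF pwq]] ends by auto
    then have "w \<in> el ?H l" using w ends by (simp add: same_ends_def in_hom_card)
    then show "w = ?p \<or> w = ?q" using H pwq tri by (auto simp: consec_def)
  qed
qed

text \<open>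
  The order for \<open>b\<close> true and its converse for \<open>b\<close> false, so that sources and targets are treated
  together.
\<close>

definition tri_dir :: "bool \<Rightarrow> 'a gset \<Rightarrow> (nat \<times> 'a) rel" where
  "tri_dir b Y = (if b then tri Y else (tri Y)\<inverse>)"

definition bnd :: "bool \<Rightarrow> nat \<Rightarrow> 'a gset \<Rightarrow> 'a gset" where
  "bnd b m Y = (if b then gsource m Y else gtarget m Y)"

lemma bnd_boundary: "bnd b m Y = boundary (tri_dir b Y) Y m"
  by (simp add: bnd_def tri_dir_def gsource_def gtarget_def)

lemma bnd_sel [simp]: "src (bnd b m Y) = src Y" "tgt (bnd b m Y) = tgt Y"
  by (simp_all add: bnd_boundary boundary_def gen_subset_def)

definition parallel :: "'a gset \<Rightarrow> nat \<Rightarrow> 'a \<Rightarrow> 'a \<Rightarrow> bool" where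
  "parallel Y m x x' \<longleftrightarrow> (\<forall>l. m = Suc l \<longrightarrow> src Y l x = src Y l x' \<and> tgt Y l x = tgt Y l x')"

lemma gen_subset_closed:
  assumes "globular_subset Y (\<lambda>k. {x. (k, x) \<in> A})"
  shows "el (gen_subset Y A) k = {x. (k, x) \<in> A}"
  using assms unfolding gen_subset_def by auto

lemma tri_dir_antisym:
  assumes "glob_card Y" "(a, c) \<in> tri_dir b Y" "(c, a) \<in> tri_dir b Y"
  shows "a = c"
proof -
  have "(a, c) \<in> tri Y" "(c, a) \<in> tri Y" using assms(2,3) by (auto simp: tri_dir_def split: if_splits)
  from triD[OF this(1)] triD[OF this(2)] show ?thesis by (intro tri_antisym[OF assms(1)]) auto
qed

text \<open>
  In either direction an element of positive dimension has a \<open>0\<close>-dimensional one before it.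
\<close>

lemma least_of_elts:
  assumes Y: "glob_card Y"
  shows "(k, x) \<in> least_of (tri_dir b Y) (elts Y) \<longleftrightarrow>
    k = 0 \<and> x \<in> el Y 0 \<and> (\<forall>x' \<in> el Y 0. ((0, x), (0, x')) \<in> tri_dir b Y)" (is "?l \<longleftrightarrow> ?r")
proof
  note g = glob_cardD(1)[OF Y]
  \<comment> \<open>every element lies above a \<open>0\<close>-dimensional one\<close>
  have down: "\<exists>y \<in> el Y 0. ((0, y), (k, x)) \<in> tri_dir b Y" if "x \<in> el Y k" for k x
    using end_el_mem[OF g that] that unfolding tri_dir_def tri_def
    by (cases b) (auto simp: elts_iff)
  show ?r if ?l
  proof -
    have x: "x \<in> el Y k" and le: "\<And>e. e \<in> elts Y \<Longrightarrow> ((k, x), e) \<in> tri_dir b Y"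
      using that by (auto simp: least_of_def elts_iff)
    obtain y where y: "y \<in> el Y 0" "((0, y), (k, x)) \<in> tri_dir b Y" using down[OF x] by blast
    then have "(0, y) = (k, x)" using le[of "(0, y)"] by (intro tri_dir_antisym[OF Y]) (auto simp: elts_iff)
    then show ?thesis using y le by (auto simp: elts_iff)
  qed
  show ?l if r: ?r
  proof -
    have "((0, x), (j, w)) \<in> tri_dir b Y" if w: "w \<in> el Y j" for j w
    proof -
      obtain y where "y \<in> el Y 0" "((0, y), (j, w)) \<in> tri_dir b Y" using down[OF w] by blast
      then have "((0, x), (0, y)) \<in> tri_dir b Y" "((0, y), (j, w)) \<in> tri_dir b Y" using r by auto
      moreover have "trans (tri_dir b Y)" by (auto simp: trans_def tri_dir_def tri_def)
      ultimately show ?thesis by (rule transD[rotated])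
    qed
    then show ?thesis using r by (auto simp: least_of_def elts_def)
  qed
qed

text \<open>
  The definition admits every element with both ends in \<open>{p, q}\<close>; the order excludes loops
  and elements from \<open>q\<close> to \<open>p\<close>.
\<close>

lemma between_top:
  assumes Y: "glob_card Y" and c: "consec Y l p q"
  shows "between Y l p q (Suc l) = {x \<in> el Y (Suc l). src Y l x = p \<and> tgt Y l x = q}"
proof (intro equalityI subsetI)
  note g = glob_cardD(1)[OF Y]
  have pq: "p \<in> el Y l" "q \<in> el Y l" "p \<noteq> q" "((l, p), (l, q)) \<in> tri Y" using c by (auto simp: consec_def)
  fix x assume "x \<in> between Y l p q (Suc l)"
  then obtain S where S: "globular_subset Y S" "S l = {p, q}" "x \<in> S (Suc l)"
    by (auto simp: between_def)
  then have x: "x \<in> el Y (Suc l)" "src Y l x \<in> {p, q}" "tgt Y l x \<in> {p, q}"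
    unfolding globular_subset_def by blast+
  have "src Y l x \<noteq> tgt Y l x" and "((l, src Y l x), (l, tgt Y l x)) \<in> tri Y"
    using consec_src_tgt[OF Y x(1)] by (auto simp: consec_def)
  moreover have "((l, q), (l, p)) \<notin> tri Y"
    using pq tri_dir_antisym[OF Y, of "(l, p)" "(l, q)" True] by (auto simp: tri_dir_def)
  ultimately show "x \<in> {x \<in> el Y (Suc l). src Y l x = p \<and> tgt Y l x = q}" using x by auto
next
  note g = glob_cardD(1)[OF Y]
  fix x assume x: "x \<in> {x \<in> el Y (Suc l). src Y l x = p \<and> tgt Y l x = q}"
  let ?S = "\<lambda>k. if k < l then el Y k else if k = l then {p, q} else if k = Suc l then {x} else {}"
  have "globular_subset Y ?S"
    using x globD[OF g] c by (auto simp: globular_subset_def consec_def)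
  then have "?S (Suc l) \<in> {S (Suc l) | S. globular_subset Y S \<and> S l = {p, q}}"
    by (intro CollectI exI[of _ ?S]) simp_all
  moreover have "x \<in> ?S (Suc l)" by simp
  ultimately show "x \<in> between Y l p q (Suc l)" unfolding between_def by (rule UnionI)
qed

text \<open>
  In dimension \<open>m\<close> the \<open>m\<close>-source consists of the first element of each nonempty class of parallel
  elements.  Consecutive pairs disappear from the description, since the source and target of an
  \<open>m\<close>-dimensional element are always consecutive; and the right hand side is already closed under
  sources and targets, so that generating a globular subset adds nothing.
\<close>

lemma el_bnd:
  assumes Y: "glob_card Y"
  shows "x \<in> el (bnd b m Y) k \<longleftrightarrow> x \<in> el Y k \<and>
    (k < m \<or> k = m \<and> (\<forall>x' \<in> el Y m. parallel Y m x x' \<longrightarrow> ((m, x), (m, x')) \<in> tri_dir b Y))"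
proof (cases m)
  case 0
  have "globular_subset Y (\<lambda>k. {x. (k, x) \<in> least_of (tri_dir b Y) (elts Y)})"
    by (auto simp: globular_subset_def least_of_elts[OF Y])
  from gen_subset_closed[OF this, of k] show ?thesis
    unfolding bnd_boundary boundary_def 0 by (auto simp: least_of_elts[OF Y] parallel_def)
next
  case (Suc l)
  note g = glob_cardD(1)[OF Y]
  let ?M = "{x \<in> el Y m. \<forall>x' \<in> el Y m. parallel Y m x x' \<longrightarrow> ((m, x), (m, x')) \<in> tri_dir b Y}"
  have top: "(\<Union> {least_of (tri_dir b Y) ({m} \<times> between Y l p q m) | p q. consec Y l p q}) = Pair m ` ?M"
  proof (intro equalityI subsetI)
    fix e assume "e \<in> \<Union> {least_of (tri_dir b Y) ({m} \<times> between Y l p q m) | p q. consec Y l p q}"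
    then obtain p q where c: "consec Y l p q" and e: "e \<in> least_of (tri_dir b Y) ({m} \<times> between Y l p q m)"
      by blast
    then show "e \<in> Pair m ` ?M"
      unfolding Suc between_top[OF Y c] by (auto simp: least_of_def parallel_def)
  next
    fix e assume "e \<in> Pair m ` ?M"
    then obtain x where x: "e = (m, x)" "x \<in> ?M" by blast
    then have c: "consec Y l (src Y l x) (tgt Y l x)" using consec_src_tgt[OF Y] Suc by simp
    have "e \<in> least_of (tri_dir b Y) ({m} \<times> between Y l (src Y l x) (tgt Y l x) m)"
      using x unfolding Suc between_top[OF Y c] by (auto simp: least_of_def parallel_def)
    then show "e \<in> \<Union> {least_of (tri_dir b Y) ({m} \<times> between Y l p q m) | p q. consec Y l p q}"
      using c by blast
  qed
  let ?A = "(SIGMA k:{..l}. el Y k) \<union> Pair m ` ?M"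
  have "globular_subset Y (\<lambda>k. {x. (k, x) \<in> ?A})"
    using globD[OF g] Suc by (auto simp: globular_subset_def)
  from gen_subset_closed[OF this, of k] have "el (bnd b m Y) k = {x. (k, x) \<in> ?A}"
    unfolding bnd_boundary boundary_def using top Suc by simp
  then show ?thesis using Suc by auto
qed

text \<open>
  Elements parallel to an element of a hom lie in that hom, and the order of the hom is the
  restricted one; so it makes no difference whether first elements are taken before or after
  passing to the hom.
\<close>

lemma hom_card_bnd:
  assumes Y: "glob_card Y" and c: "consec Y 0 y z"
  shows "hom_card (bnd b (Suc m) Y) y z = bnd b m (hom_card Y y z)"
proof (rule gset.equality)
  let ?H = "hom_card Y y z"
  have H: "glob_card ?H" using glob_card_hom_card[OF Y c] by blast
  have par: "x' \<in> el ?H k \<and> parallel ?H k x x' \<longleftrightarrow> x' \<in> el Y (Suc k) \<and> parallel Y (Suc k) x x'"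
    if "x \<in> el ?H k" for x x' k
  proof (cases k)
    case 0
    then show ?thesis using that by (auto simp: in_hom_card parallel_def end_el.simps)
  next
    case (Suc j)
    then show ?thesis using that by (auto simp: in_hom_card parallel_def end_el.simps(2)[of _ "Suc j"])
  qed
  have ord: "((k, x), (k, x')) \<in> tri_dir b ?H \<longleftrightarrow> ((Suc k, x), (Suc k, x')) \<in> tri_dir b Y"
    if "x \<in> el ?H k" "x' \<in> el ?H k" for x x' k
    using tri_hom_card[OF Y c] that by (simp add: tri_dir_def)
  have "x \<in> el (hom_card (bnd b (Suc m) Y) y z) k \<longleftrightarrow> x \<in> el (bnd b m ?H) k" for x k
  proof (cases "x \<in> el ?H k")
    case False
    then show ?thesis by (auto simp: in_hom_card el_bnd[OF Y] el_bnd[OF H])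
  next
    case True
    have "(\<forall>x' \<in> el ?H k. parallel ?H k x x' \<longrightarrow> ((k, x), (k, x')) \<in> tri_dir b ?H) \<longleftrightarrow>
        (\<forall>x' \<in> el Y (Suc k). parallel Y (Suc k) x x' \<longrightarrow> ((Suc k, x), (Suc k, x')) \<in> tri_dir b Y)"
      using par[OF True] ord[OF True] by meson
    moreover have "x \<in> el (hom_card (bnd b (Suc m) Y) y z) k \<longleftrightarrow> x \<in> el (bnd b (Suc m) Y) (Suc k)"
      using True by (auto simp: in_hom_card el_bnd[OF Y])
    moreover have "x \<in> el Y (Suc k)" using True by (simp add: in_hom_card)
    ultimately show ?thesis
      using True unfolding el_bnd[OF Y] el_bnd[OF H] by auto
  qed
  then show "el (hom_card (bnd b (Suc m) Y) y z) = el (bnd b m ?H)" by blast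
qed (simp_all add: hom_card_def)

lemma globular_bnd:
  assumes Y: "glob_card Y"
  shows "globular_set (bnd b m Y)"
proof -
  note g = globD[OF glob_cardD(1)[OF Y]]
  have "x \<in> el Y (Suc n) \<and> n < m" if "x \<in> el (bnd b m Y) (Suc n)" for x n
    using that by (auto simp: el_bnd[OF Y])
  moreover have "x \<in> el (bnd b m Y) n" if "x \<in> el Y n" "n < m" for x n
    using that by (simp add: el_bnd[OF Y])
  ultimately show ?thesis
    unfolding globular_set_def bnd_sel using g by blast
qed

lemma el_bnd_0:
  assumes Y: "glob_card Y" "el Y 0 \<noteq> {}"
  shows "el (bnd b 0 Y) 0 = {if b then hd (obj_list Y) else last (obj_list Y)}"
proof -
  let ?ys = "obj_list Y"
  have ne: "?ys \<noteq> []" using obj_list(2)[OF Y(1)] Y(2) by auto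
  have le: "((0, ?ys ! i), (0, ?ys ! j)) \<in> tri Y" if "i \<le> j" "j < length ?ys" for i j
  proof (cases "i = j")
    case True
    have "?ys ! j \<in> el Y 0" using that obj_list(2)[OF Y(1)] nth_mem by blast
    then show ?thesis using True by (simp add: tri_def elts_iff)
  next
    case False
    then show ?thesis using that obj_list(3)[OF Y(1)] by (simp add: sorted_wrt_iff_nth_less)
  qed
  let ?e = "if b then hd ?ys else last ?ys"
  have mem: "?e \<in> el Y 0" using hd_in_set[OF ne] last_in_set[OF ne] unfolding obj_list(2)[OF Y(1)] by simp
  have least: "((0, ?e), (0, y)) \<in> tri_dir b Y" if "y \<in> el Y 0" for y
  proof -
    obtain i where "i < length ?ys" "y = ?ys ! i" using \<open>y \<in> el Y 0\<close> obj_list(2)[OF Y(1)] by (metis in_set_conv_nth)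
    then show ?thesis using le[of 0 i] le[of i "length ?ys - 1"] ne
      by (auto simp: tri_dir_def hd_conv_nth last_conv_nth)
  qed
  have "x = ?e" if "x \<in> el Y 0" "\<And>x'. x' \<in> el Y 0 \<Longrightarrow> ((0, x), (0, x')) \<in> tri_dir b Y" for x
    using tri_dir_antisym[OF Y(1) that(2)[OF mem] least[OF that(1)]] by simp
  moreover have "x \<in> el (bnd b 0 Y) 0 \<longleftrightarrow> x \<in> el Y 0 \<and> (\<forall>x' \<in> el Y 0. ((0, x), (0, x')) \<in> tri_dir b Y)" for x
    by (simp add: el_bnd[OF Y(1)] parallel_def)
  ultimately show ?thesis using mem least by blast
qed

text \<open>
  For \<open>m = 0\<close> the boundary is the first or the last object; for \<open>m > 0\<close> it has the same objects as \<open>Y\<close>,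
  and the induction hypothesis applies to its homs.
\<close>

lemma bnd_L_rep:
  assumes "glob_card_le n Y" "m < n"
  shows "glob_card_le m (bnd b m Y) \<and> L_rep m (bnd b m Y) f = (if b then gdom m else gcod m) (L_rep n Y f)"
  using assms
proof (induction m arbitrary: n Y f)
  case 0
  obtain n' where n: "n = Suc n'" using 0 by (cases n) auto
  have Y: "glob_card Y" "el Y 0 \<noteq> {}"
    using 0 el_0_nonempty glob_cardD(1) by (auto simp: glob_card_le_def)
  note e = el_bnd_0[OF Y, of b]
  have "el (bnd b 0 Y) k = {}" if "k > 0" for k
    using that by (auto simp: el_bnd[OF Y(1)])
  then have "glob_card_le 0 (bnd b 0 Y)"
    using e globular_bnd[OF Y(1)] by (auto simp: glob_card_le_0)
  then show ?case
    using e unfolding n L_rep_Suc_hom[OF Y(1)] by simp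
next
  case (Suc m)
  obtain n' where n: "n = Suc n'" "m < n'" using Suc.prems by (cases n) auto
  note Yn = Suc.prems(1)[unfolded n]
  have Y: "glob_card Y" using Yn by (simp add: glob_card_le_def)
  let ?ys = "obj_list Y" and ?B = "bnd b (Suc m) Y"
  have hom: "hom_card ?B y z = bnd b m (hom_card Y y z)" if "(y, z) \<in> set (steps ?ys)" for y z
    using hom_card_bnd[OF Y] consec_iff_zip[OF Y] that by blast
  note IH = Suc.IH[OF glob_card_le_hom[OF Yn] n(2)]
  have sp: "spine ?B ?ys"
    using glob_card_le_spine[OF Yn] globular_bnd[OF Y] el_bnd[OF Y, of _ b "Suc m"]
    by (auto simp: spine_def)
  have B: "glob_card_le (Suc m) ?B" "obj_list ?B = ?ys"
    using glob_card_le_SucI[OF sp, of m] hom IH by auto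
  then show ?case
    using hom IH L_rep_Suc_hom[of ?B m f] L_rep_Suc_hom[OF Y, of n' f] unfolding n
    by (cases b) (auto simp: glob_card_le_def)
qed

section \<open>The value of \<open>L\<close> as a complete invariant\<close>

lemma gmorD:
  assumes "gmor Y Z h"
  shows "x \<in> el Y n \<Longrightarrow> h n x \<in> el Z n"
    and "x \<in> el Y (Suc n) \<Longrightarrow> h n (src Y n x) = src Z n (h (Suc n) x)"
    and "x \<in> el Y (Suc n) \<Longrightarrow> h n (tgt Y n x) = tgt Z n (h (Suc n) x)"
  using assms by (auto simp: gmor_def)

lemma gmor_end_el:
  assumes "globular_set Y" "gmor Y Z h" "x \<in> el Y n"
  shows "h 0 (end_el (src Y) n x) = end_el (src Z) n (h n x)"
    and "h 0 (end_el (tgt Y) n x) = end_el (tgt Z) n (h n x)"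
proof -
  have "h 0 (end_el (src Y) n x) = end_el (src Z) n (h n x) \<and>
    h 0 (end_el (tgt Y) n x) = end_el (tgt Z) n (h n x)"
    using assms(3)
    by (induction n arbitrary: x) (auto simp: end_el.simps gmorD[OF assms(2)] globD[OF assms(1)])
  then show "h 0 (end_el (src Y) n x) = end_el (src Z) n (h n x)"
    "h 0 (end_el (tgt Y) n x) = end_el (tgt Z) n (h n x)" by auto
qed

lemma gmor_hom_card:
  assumes "globular_set Y" "gmor Y Z h"
  shows "gmor (hom_card Y y z) (hom_card Z (h 0 y) (h 0 z)) (mor_shift h)"
  using gmor_end_el[OF assms] gmorD[OF assms(2)]
  by (auto simp: gmor_def in_hom_card mor_shift_def)

text \<open>
  The inverse maps of a dimensionwise bijective morphism commute with sources and targets.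
\<close>

lemma giso_iff_bij:
  assumes Y: "globular_set Y"
  shows "giso Y Z h \<longleftrightarrow> gmor Y Z h \<and> (\<forall>n. bij_betw (h n) (el Y n) (el Z n))"
proof
  assume "giso Y Z h"
  then obtain g where *: "gmor Y Z h" "gmor Z Y g" "\<And>n x. x \<in> el Y n \<Longrightarrow> g n (h n x) = x"
    "\<And>n y. y \<in> el Z n \<Longrightarrow> h n (g n y) = y"
    by (auto simp: giso_def)
  then have "bij_betw (h n) (el Y n) (el Z n)" for n
    by (intro bij_betw_byWitness[where f' = "g n"]) (auto dest: gmorD)
  then show "gmor Y Z h \<and> (\<forall>n. bij_betw (h n) (el Y n) (el Z n))" using * by blast
next
  assume *: "gmor Y Z h \<and> (\<forall>n. bij_betw (h n) (el Y n) (el Z n))"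
  define g where "g n = inv_into (el Y n) (h n)" for n
  note h = gmorD[OF conjunct1[OF *]]
  have gh: "g n (h n x) = x" if "x \<in> el Y n" for n x
    using * that by (auto simp: g_def bij_betw_def)
  have hg: "h n (g n y) = y" "g n y \<in> el Y n" if "y \<in> el Z n" for n y
    using * that unfolding g_def bij_betw_def by (metis f_inv_into_f inv_into_into)+
  have "gmor Z Y g"
    unfolding gmor_def
  proof (intro conjI allI ballI)
    fix n y assume y: "y \<in> el Z (Suc n)"
    have "g n (src Z n y) = g n (h n (src Y n (g (Suc n) y)))"
      using h(2) hg[OF y] by simp
    then show "g n (src Z n y) = src Y n (g (Suc n) y)"
      using gh globD[OF Y] hg[OF y] by simp
    have "g n (tgt Z n y) = g n (h n (tgt Y n (g (Suc n) y)))"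
      using h(3) hg[OF y] by simp
    then show "g n (tgt Z n y) = tgt Y n (g (Suc n) y)"
      using gh globD[OF Y] hg[OF y] by simp
  qed (use hg in auto)
  then show "giso Y Z h" using * gh hg by (auto simp: giso_def)
qed

lemma giso_hom_card:
  assumes Y: "globular_set Y" and h: "giso Y Z h" and yz: "y \<in> el Y 0" "z \<in> el Y 0"
  shows "giso (hom_card Y y z) (hom_card Z (h 0 y) (h 0 z)) (mor_shift h)"
  unfolding giso_iff_bij[OF globular_hom_card[OF Y]]
proof (intro conjI allI)
  have m: "gmor Y Z h" and b: "\<And>n. bij_betw (h n) (el Y n) (el Z n)"
    using h unfolding giso_iff_bij[OF Y] by auto
  show "gmor (hom_card Y y z) (hom_card Z (h 0 y) (h 0 z)) (mor_shift h)"
    by (rule gmor_hom_card[OF Y m])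
  have inj: "h 0 x = h 0 x' \<longleftrightarrow> x = x'" if "x \<in> el Y 0" "x' \<in> el Y 0" for x x'
    using bij_betw_imp_inj_on[OF b] that by (meson inj_onD)
  fix k
  have *: "x \<in> el (hom_card Y y z) k \<longleftrightarrow> h (Suc k) x \<in> el (hom_card Z (h 0 y) (h 0 z)) k"
    if x: "x \<in> el Y (Suc k)" for x
    using x gmor_end_el[OF Y m x] inj end_el_mem[OF Y x] yz gmorD(1)[OF m]
    unfolding in_hom_card by metis
  have "h (Suc k) ` el (hom_card Y y z) k = el (hom_card Z (h 0 y) (h 0 z)) k"
  proof (intro equalityI subsetI)
    fix w assume w: "w \<in> el (hom_card Z (h 0 y) (h 0 z)) k"
    then obtain x where "x \<in> el Y (Suc k)" "w = h (Suc k) x"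
      using bij_betw_imp_surj_on[OF b[of "Suc k"]] by (auto simp: in_hom_card)
    then show "w \<in> h (Suc k) ` el (hom_card Y y z) k" using * w by blast
  next
    fix w assume "w \<in> h (Suc k) ` el (hom_card Y y z) k"
    then obtain x where "x \<in> el (hom_card Y y z) k" "w = h (Suc k) x" by blast
    then show "w \<in> el (hom_card Z (h 0 y) (h 0 z)) k" using *[of x] by (simp add: in_hom_card)
  qed
  moreover have "inj_on (h (Suc k)) (el (hom_card Y y z) k)"
    using bij_betw_imp_inj_on[OF b[of "Suc k"]] by (rule inj_on_subset) (auto simp: in_hom_card)
  ultimately show "bij_betw (mor_shift h k) (el (hom_card Y y z) k) (el (hom_card Z (h 0 y) (h 0 z)) k)"
    by (simp add: bij_betw_def mor_shift_def)
qed

lemma spine_giso: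
  assumes sp: "spine Y ys" and h: "giso Y Z h" and Z: "globular_set Z"
  shows "spine Z (map (h 0) ys)"
proof -
  have Y: "globular_set Y" using sp by (simp add: spine_def)
  have m: "gmor Y Z h" and b: "\<And>n. bij_betw (h n) (el Y n) (el Z n)"
    using h unfolding giso_iff_bij[OF Y] by auto
  show ?thesis
    unfolding spine_def
  proof (intro conjI allI ballI)
    show "map (h 0) ys \<noteq> []" "distinct (map (h 0) ys)" "set (map (h 0) ys) = el Z 0"
      using sp b[of 0] by (auto simp: spine_def bij_betw_def distinct_map)
    fix k w assume "w \<in> el Z (Suc k)"
    then obtain x where x: "x \<in> el Y (Suc k)" "w = h (Suc k) x"
      using bij_betw_imp_surj_on[OF b[of "Suc k"]] by blast
    have "(end_el (src Y) (Suc k) x, end_el (tgt Y) (Suc k) x) \<in> set (steps ys)"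
      using sp x by (simp add: spine_def)
    then show "(end_el (src Z) (Suc k) w, end_el (tgt Z) (Suc k) w) \<in> set (steps (map (h 0) ys))"
      using gmor_end_el[OF Y m x(1)] x(2) unfolding steps_map by force
  qed (rule Z)
qed

lemma steps_mem: "(y, z) \<in> set (steps ys) \<Longrightarrow> y \<in> set ys \<and> z \<in> set ys"
  by (auto simp: in_steps_iff)

text \<open>
  An isomorphism restricts to the homs, so the recursive characterisation carries the property of
  being a cardinal from \<open>Y\<close> to \<open>Z\<close>, together with the value of \<open>L_rep\<close>.
\<close>

lemma L_rep_giso:
  assumes "glob_card_le n Y" "globular_set Z" "giso Y Z h" "\<forall>k. \<forall>y \<in> el Y k. g k (h k y) = f k y"
  shows "glob_card_le n Z \<and> L_rep n Z g = L_rep n Y f"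
  using assms
proof (induction n arbitrary: Y Z h f g)
  case 0
  have b: "\<And>n. bij_betw (h n) (el Y n) (el Z n)"
    using 0(1,3) giso_iff_bij[of Y Z h] by (auto simp: glob_card_le_0)
  obtain y where y: "el Y 0 = {y}" "\<forall>m > 0. el Y m = {}" using 0(1) by (auto simp: glob_card_le_0)
  moreover have "el Z k = h k ` el Y k" for k using bij_betw_imp_surj_on[OF b] by blast
  ultimately have "el Z 0 = {h 0 y}" "\<forall>m > 0. el Z m = {}" by simp_all
  then show ?case using y 0 by (auto simp: glob_card_le_0)
next
  case (Suc n)
  let ?ys = "obj_list Y"
  have gY: "globular_set Y" and Y: "glob_card Y" using Suc.prems(1) by (auto simp: glob_card_le_def glob_cardD(1))
  note sp = glob_card_le_spine[OF Suc.prems(1)]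
  have set: "set ?ys = el Y 0" using sp by (simp add: spine_def)
  note spZ = spine_giso[OF sp Suc.prems(3,2)]
  have hom: "glob_card_le n (hom_card Z (h 0 y) (h 0 z)) \<and>
      L_rep n (hom_card Z (h 0 y) (h 0 z)) (mor_shift g) = L_rep n (hom_card Y y z) (mor_shift f)"
    if yz: "(y, z) \<in> set (steps ?ys)" for y z
  proof (rule Suc.IH[OF glob_card_le_hom[OF Suc.prems(1) yz] globular_hom_card[OF Suc.prems(2)]])
    show "giso (hom_card Y y z) (hom_card Z (h 0 y) (h 0 z)) (mor_shift h)"
      using giso_hom_card[OF gY Suc.prems(3)] steps_mem[OF yz] set by blast
    show "\<forall>k. \<forall>w \<in> el (hom_card Y y z) k. mor_shift g k (mor_shift h k w) = mor_shift f k w"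
      using Suc.prems(4) by (simp add: mor_shift_def in_hom_card)
  qed
  have hom': "glob_card_le n (hom_card Z y z)" if "(y, z) \<in> set (steps (map (h 0) ?ys))" for y z
    using that hom unfolding steps_map by auto
  have Z: "glob_card_le (Suc n) Z" "obj_list Z = map (h 0) ?ys"
    using glob_card_le_SucI[OF spZ, of n] hom' by auto
  have ne: "?ys \<noteq> []" using sp by (simp add: spine_def)
  have gh: "g 0 (h 0 y) = f 0 y" if "y \<in> set ?ys" for y using Suc.prems(4) that set by blast
  have gZ: "glob_card Z" using Z(1) by (simp add: glob_card_le_def)
  have "L_rep (Suc n) Z g = L_rep (Suc n) Y f"
    unfolding L_rep_Suc_hom[OF gZ] L_rep_Suc_hom[OF Y] Z(2) steps_map
    using ne hom gh by (auto simp: hd_map last_map)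
  then show ?case using Z(1) by blast
qed

text \<open>
  A \<open>1\<close>-dimensional element between consecutive objects is mapped to one between their images.
\<close>

lemma gmor_steps:
  assumes Y: "glob_card Y" and X: "glob_card X" and f: "gmor Y X f"
    and yz: "(y, z) \<in> set (steps (obj_list Y))"
  shows "(f 0 y, f 0 z) \<in> set (steps (obj_list X))"
proof -
  have c: "consec Y 0 y z" using yz consec_iff_zip[OF Y] by blast
  obtain w where w: "w \<in> el (hom_card Y y z) 0" using glob_card_hom_card[OF Y c] by blast
  then have "f (Suc 0) w \<in> el (hom_card X (f 0 y) (f 0 z)) 0"
    using gmorD(1)[OF gmor_hom_card[OF glob_cardD(1)[OF Y] f] w] by (simp add: mor_shift_def)
  then have "consec X 0 (f 0 y) (f 0 z)"
    using consec_ends[OF X, of "f (Suc 0) w" 0] by (auto simp: in_hom_card)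
  then show ?thesis using consec_iff_zip[OF X] by blast
qed

lemma steps_segment:
  assumes "distinct xs" "ys \<noteq> []" "hd ys \<in> set xs" "set (steps ys) \<subseteq> set (steps xs)"
  shows "\<exists>h. h + length ys \<le> length xs \<and> (\<forall>i < length ys. ys ! i = xs ! (h + i))"
proof -
  obtain h where h: "h < length xs" "hd ys = xs ! h" using assms(3) by (metis in_set_conv_nth)
  have "h + i < length xs \<and> ys ! i = xs ! (h + i)" if "i < length ys" for i
    using that
  proof (induction i)
    case 0
    then show ?case using h by (simp add: hd_conv_nth assms)
  next
    case (Suc i)
    have "(ys ! i, ys ! Suc i) \<in> set (steps ys)"
      using Suc.prems unfolding in_steps_iff by blast
    then have "(ys ! i, ys ! Suc i) \<in> set (steps xs)" using assms(4) by blast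
    then obtain j where "Suc j < length xs" "ys ! i = xs ! j" "ys ! Suc i = xs ! Suc j"
      by (auto simp: in_steps_iff)
    moreover have "h + i < length xs" "ys ! i = xs ! (h + i)" using Suc by auto
    ultimately show ?case using nth_eq_iff_index_eq[OF assms(1), of "h + i" j] by auto
  qed
  note * = this
  moreover have "h + length ys \<le> length xs" using *[of "length ys - 1"] assms(2) by (cases ys) auto
  ultimately show ?thesis by blast
qed

text \<open>
  Consequently the objects of \<open>Y\<close> are mapped bijectively to a segment of those of \<open>X\<close>, and a
  morphism is determined on objects by the image of the first one and the number of objects.
\<close>

lemma gmor_segment:
  assumes Y: "glob_card Y" "el Y 0 \<noteq> {}" and X: "glob_card X" and f: "gmor Y X f"
  shows "\<exists>h. h + length (obj_list Y) \<le> length (obj_list X) \<and>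
    (\<forall>i < length (obj_list Y). f 0 (obj_list Y ! i) = obj_list X ! (h + i))"
proof -
  have ne: "obj_list Y \<noteq> []" using Y obj_list(2)[OF Y(1)] by auto
  then have "hd (obj_list Y) \<in> el Y 0" using obj_list(2)[OF Y(1)] hd_in_set by blast
  then have "hd (map (f 0) (obj_list Y)) \<in> set (obj_list X)"
    using gmorD(1)[OF f] obj_list(2)[OF X] ne by (simp add: hd_map)
  moreover have "set (steps (map (f 0) (obj_list Y))) \<subseteq> set (steps (obj_list X))"
    unfolding steps_map using gmor_steps[OF Y(1) X f] by auto
  ultimately show ?thesis
    using steps_segment[OF obj_list(1)[OF X], of "map (f 0) (obj_list Y)"] ne by auto
qed

lemma obs_Gam: "glob_card X \<Longrightarrow> obs (Gam X) = obj_list X"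
  using obj_list(2)[of X] glob_cardD(2)[of X] by (subst Gam.simps) auto

lemma edge_Gam:
  assumes X: "glob_card X" and c: "(x, y) \<in> set (steps (obj_list X))"
  shows "edge (Gam X) x y = Gam (hom_card X x y)"
proof -
  have "consec X 0 x y" using c consec_iff_zip[OF X] by blast
  moreover from this have "el X 0 \<noteq> {}" by (auto simp: consec_def)
  ultimately show ?thesis
    using glob_cardD(2)[OF X] ghom_eq_hom_card[OF X] by (subst Gam.simps) simp
qed

lemma gcells_Gam_Suc:
  assumes X: "glob_card X"
  shows "c \<in> gcells (Suc n) (Gam X) \<longleftrightarrow> (\<exists>h k cs. c = Arr (obj_list X ! h) (obj_list X ! k) cs \<and>
    h \<le> k \<and> k < length (obj_list X) \<and> length cs = k - h \<and>
    (\<forall>i < k - h. cs ! i \<in> gcells n (Gam (hom_card X (obj_list X ! (h + i)) (obj_list X ! Suc (h + i))))))"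
proof -
  have "edge (Gam X) (obj_list X ! (h + i)) (obj_list X ! Suc (h + i)) =
      Gam (hom_card X (obj_list X ! (h + i)) (obj_list X ! Suc (h + i)))"
    if "k < length (obj_list X)" "i < k - h" for h k i
    using that by (intro edge_Gam[OF X]) (auto simp: in_steps_iff intro!: exI[of _ "h + i"])
  then have *: "(\<forall>i < k - h. cs ! i \<in> gcells n (edge (Gam X) (obj_list X ! (h + i)) (obj_list X ! Suc (h + i)))) \<longleftrightarrow>
      (\<forall>i < k - h. cs ! i \<in> gcells n (Gam (hom_card X (obj_list X ! (h + i)) (obj_list X ! Suc (h + i)))))"
    if "k < length (obj_list X)" for h k cs
    using that by simp
  show ?thesis
    unfolding gcells.simps obs_Gam[OF X] mem_Collect_eq
    by (intro ex_cong1 conj_cong refl *)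
qed

lemma L_rep_in_gcells:
  assumes "glob_card_le n Y" "glob_card X" "gmor Y X f"
  shows "L_rep n Y f \<in> gcells n (Gam X)"
  using assms
proof (induction n arbitrary: Y X f)
  case 0
  then obtain y where "el Y 0 = {y}" by (auto simp: glob_card_le_0)
  then show ?case using gmorD(1)[OF 0(3), of y 0] obj_list(2)[OF 0(2)] obs_Gam[OF 0(2)] by simp
next
  case (Suc n)
  note X = Suc.prems(2) and f = Suc.prems(3)
  let ?ys = "obj_list Y" and ?xs = "obj_list X"
  have Y: "glob_card Y" "el Y 0 \<noteq> {}"
    using Suc.prems(1) el_0_nonempty[of Y] glob_cardD(1)[of Y] by (auto simp: glob_card_le_def)
  have ne: "?ys \<noteq> []" using Y obj_list(2)[OF Y(1)] by auto
  obtain h where h: "h + length ?ys \<le> length ?xs" "\<And>i. i < length ?ys \<Longrightarrow> f 0 (?ys ! i) = ?xs ! (h + i)"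
    using gmor_segment[OF Y X f] by blast
  let ?cs = "map (\<lambda>(y, z). L_rep n (hom_card Y y z) (mor_shift f)) (steps ?ys)"
  let ?k = "h + (length ?ys - 1)"
  have "?cs ! i \<in> gcells n (Gam (hom_card X (?xs ! (h + i)) (?xs ! Suc (h + i))))" if i: "i < ?k - h" for i
  proof -
    have i': "Suc i < length ?ys" using i by simp
    have st: "(?ys ! i, ?ys ! Suc i) \<in> set (steps ?ys)" using i' by (auto simp: in_steps_iff)
    have "consec X 0 (f 0 (?ys ! i)) (f 0 (?ys ! Suc i))"
      using gmor_steps[OF Y(1) X f st] consec_iff_zip[OF X] by blast
    from Suc.IH[OF glob_card_le_hom[OF Suc.prems(1) st] glob_card_hom_card(1)[OF X this]
        gmor_hom_card[OF glob_cardD(1)[OF Y(1)] f]]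
    show ?thesis using i' h(2)[of i] h(2)[of "Suc i"] by (simp add: nth_tl)
  qed
  moreover have "f 0 (hd ?ys) = ?xs ! h" "f 0 (last ?ys) = ?xs ! ?k"
    using h(2)[of 0] h(2)[of "length ?ys - 1"] ne by (auto simp: hd_conv_nth last_conv_nth)
  ultimately show ?case
    unfolding gcells_Gam_Suc[OF X] L_rep_Suc_hom[OF Y(1)] using h(1) ne
    by (intro exI[of _ h] exI[of _ ?k] exI[of _ ?cs]) (cases ?ys, auto)
qed

text \<open>
  Equal values have equally many objects with the same images in \<open>X\<close>, and over each step of this
  segment the induction hypothesis gives an isomorphism of homs; these glue.
\<close>

lemma L_rep_inj:
  assumes "glob_card_le n Y" "glob_card_le n Z" "glob_card X" "gmor Y X f" "gmor Z X g"
    "L_rep n Y f = L_rep n Z g"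
  shows "\<exists>h. slice_iso Y f Z g h"
  using assms
proof (induction n arbitrary: X Y Z f g)
  case 0
  then obtain y z where y: "globular_set Y" "el Y 0 = {y}" "\<And>m. m > 0 \<Longrightarrow> el Y m = {}"
    and z: "el Z 0 = {z}" "\<And>m. m > 0 \<Longrightarrow> el Z m = {}"
    unfolding glob_card_le_0 by blast
  have "gmor Y Z (\<lambda>_ _. z)"
    unfolding gmor_def
  proof (intro conjI allI ballI)
    show "z \<in> el Z n" if "x \<in> el Y n" for n x using y z that by (cases n) auto
  qed (use y in auto)
  moreover have "bij_betw (\<lambda>_. z) (el Y n) (el Z n)" for n
    using y z by (cases n) (auto simp: bij_betw_def)
  moreover have "g n z = f n x" if "x \<in> el Y n" for n x
    using 0(6) y z that by (cases n) auto
  ultimately show ?case unfolding slice_iso_def giso_iff_bij[OF y(1)] by blast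
next
  case (Suc n)
  note X = Suc.prems(3) and f = Suc.prems(4) and g = Suc.prems(5)
  let ?ys = "obj_list Y" and ?zs = "obj_list Z" and ?xs = "obj_list X"
  have Y: "glob_card Y" "el Y 0 \<noteq> {}" and Z: "glob_card Z" "el Z 0 \<noteq> {}"
    using Suc.prems(1,2) el_0_nonempty[of Y] glob_cardD(1)[of Y] el_0_nonempty[of Z] glob_cardD(1)[of Z]
    by (auto simp: glob_card_le_def)
  note gY = glob_cardD(1)[OF Y(1)] and gZ = glob_cardD(1)[OF Z(1)]
  note spY = glob_card_le_spine[OF Suc.prems(1)] and spZ = glob_card_le_spine[OF Suc.prems(2)]
  have ne: "?ys \<noteq> []" "?zs \<noteq> []" using spY spZ by (auto simp: spine_def)
  have dist: "distinct ?ys" "distinct ?zs" using spY spZ by (auto simp: spine_def)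
  note eq = Suc.prems(6)[unfolded L_rep_Suc_hom[OF Y(1)] L_rep_Suc_hom[OF Z(1)]]
  have "length (steps ?ys) = length (steps ?zs)" using eq map_eq_imp_length_eq by blast
  then have len: "length ?ys = length ?zs"
  proof -
    have "length ?ys > 0" "length ?zs > 0" using ne by auto
    moreover assume "length (steps ?ys) = length (steps ?zs)"
    then have "length ?ys - 1 = length ?zs - 1" by simp
    ultimately show ?thesis by linarith
  qed
  obtain h where h: "h + length ?ys \<le> length ?xs" "\<And>i. i < length ?ys \<Longrightarrow> f 0 (?ys ! i) = ?xs ! (h + i)"
    using gmor_segment[OF Y X f] by blast
  obtain h' where h': "h' + length ?zs \<le> length ?xs" "\<And>i. i < length ?zs \<Longrightarrow> g 0 (?zs ! i) = ?xs ! (h' + i)"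
    using gmor_segment[OF Z X g] by blast
  have "?xs ! h = ?xs ! h'" using eq h(2)[of 0] h'(2)[of 0] ne by (simp add: hd_conv_nth)
  then have "h = h'" using nth_eq_iff_index_eq[OF obj_list(1)[OF X], of h h'] h(1) h'(1) ne len
    by (simp add: length_greater_0_conv[symmetric] del: length_greater_0_conv)
  then have fg: "f 0 (?ys ! i) = g 0 (?zs ! i)" if "i < length ?ys" for i
    using h h' len that by simp
  have "\<exists>H. slice_iso (hom_card Y (?ys ! i) (?ys ! Suc i)) (mor_shift f)
        (hom_card Z (?zs ! i) (?zs ! Suc i)) (mor_shift g) H" if i: "Suc i < length ?ys" for i
  proof -
    have stY: "(?ys ! i, ?ys ! Suc i) \<in> set (steps ?ys)" and stZ: "(?zs ! i, ?zs ! Suc i) \<in> set (steps ?zs)"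
      using i len by (auto simp: in_steps_iff)
    have c: "consec X 0 (f 0 (?ys ! i)) (f 0 (?ys ! Suc i))"
      using gmor_steps[OF Y(1) X f stY] consec_iff_zip[OF X] by blast
    have gm: "gmor (hom_card Z (?zs ! i) (?zs ! Suc i)) (hom_card X (f 0 (?ys ! i)) (f 0 (?ys ! Suc i))) (mor_shift g)"
      using gmor_hom_card[OF gZ g, of "?zs ! i" "?zs ! Suc i"] fg[of i] fg[of "Suc i"] i by simp
    have "map (\<lambda>(y, z). L_rep n (hom_card Y y z) (mor_shift f)) (steps ?ys) ! i =
        map (\<lambda>(y, z). L_rep n (hom_card Z y z) (mor_shift g)) (steps ?zs) ! i"
      using eq by simp
    then have "L_rep n (hom_card Y (?ys ! i) (?ys ! Suc i)) (mor_shift f) =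
        L_rep n (hom_card Z (?zs ! i) (?zs ! Suc i)) (mor_shift g)"
      using i len by (simp add: nth_tl)
    from Suc.IH[OF glob_card_le_hom[OF Suc.prems(1) stY] glob_card_le_hom[OF Suc.prems(2) stZ]
        glob_card_hom_card(1)[OF X c] gmor_hom_card[OF gY f] gm this]
    show ?thesis .
  qed
  then obtain H where H: "\<And>i. Suc i < length ?ys \<Longrightarrow> slice_iso (hom_card Y (?ys ! i) (?ys ! Suc i)) (mor_shift f)
        (hom_card Z (?zs ! i) (?zs ! Suc i)) (mor_shift g) (H i)"
    by metis
  have Hm: "gmor (hom_card Y (?ys ! i) (?ys ! Suc i)) (hom_card Z (?zs ! i) (?zs ! Suc i)) (H i)"
    and Hb: "bij_betw (H i k) (el (hom_card Y (?ys ! i) (?ys ! Suc i)) k) (el (hom_card Z (?zs ! i) (?zs ! Suc i)) k)"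
    and Hf: "x \<in> el (hom_card Y (?ys ! i) (?ys ! Suc i)) k \<Longrightarrow> g (Suc k) (H i k x) = f (Suc k) x"
    if "Suc i < length ?ys" for i k x
    using H[OF that] unfolding slice_iso_def giso_iff_bij[OF globular_hom_card[OF gY]] mor_shift_def by auto
  define idx where "idx = the_inv_into {..<length ?ys} ((!) ?ys)"
  have idx: "idx (?ys ! i) = i" if "i < length ?ys" for i
    unfolding idx_def using that dist by (intro the_inv_into_f_f) (auto simp: inj_on_nth)
  \<comment> \<open>objects are matched by their position, other elements by the isomorphism for their hom\<close>
  define \<Phi> where "\<Phi> k x = (case k of 0 \<Rightarrow> ?zs ! idx x | Suc k' \<Rightarrow> H (idx (end_el (src Y) k x)) k' x)" for k x
  have \<Phi>0: "\<Phi> 0 (?ys ! i) = ?zs ! i" if "i < length ?ys" for i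
    using idx that by (simp add: \<Phi>_def)
  have \<Phi>S: "\<Phi> (Suc k) x = H i k x" if "Suc i < length ?ys" "x \<in> el (hom_card Y (?ys ! i) (?ys ! Suc i)) k" for i k x
    using that idx by (simp add: \<Phi>_def in_hom_card)
  have \<Phi>H: "\<Phi> (Suc k) x \<in> el (hom_card Z (?zs ! i) (?zs ! Suc i)) k"
    if "Suc i < length ?ys" "x \<in> el (hom_card Y (?ys ! i) (?ys ! Suc i)) k" for i k x
    using \<Phi>S[OF that] gmorD(1)[OF Hm[OF that(1)] that(2)] by simp
  have ob: "\<exists>i < length ?ys. x = ?ys ! i" if "x \<in> el Y 0" for x
    using that obj_list(2)[OF Y(1)] by (metis in_set_conv_nth)
  have inhom: "\<exists>i. Suc i < length ?ys \<and> x \<in> el (hom_card Y (?ys ! i) (?ys ! Suc i)) k" if "x \<in> el Y (Suc k)" for x k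
    using that spY unfolding spine_def in_steps_iff in_hom_card by blast
  have inhomZ: "\<exists>i. Suc i < length ?ys \<and> x \<in> el (hom_card Z (?zs ! i) (?zs ! Suc i)) k" if "x \<in> el Z (Suc k)" for x k
    using that spZ len unfolding spine_def in_steps_iff in_hom_card by metis
  have mor: "gmor Y Z \<Phi>"
    unfolding gmor_def
  proof (intro conjI allI ballI)
    fix k x assume x: "x \<in> el Y k"
    show "\<Phi> k x \<in> el Z k"
    proof (cases k)
      case 0
      then obtain i where "i < length ?ys" "x = ?ys ! i" using ob x by blast
      then show ?thesis using \<Phi>0 len obj_list(2)[OF Z(1)] 0 by (metis nth_mem)
    next
      case (Suc k')
      then show ?thesis using inhom x \<Phi>H by (metis in_hom_card)
    qed
  next
    fix k x assume x: "x \<in> el Y (Suc k)"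
    obtain i where i: "Suc i < length ?ys" "x \<in> el (hom_card Y (?ys ! i) (?ys ! Suc i)) k"
      using inhom[OF x] by blast
    note P = \<Phi>H[OF i]
    have "\<Phi> k (src Y k x) = src Z k (\<Phi> (Suc k) x) \<and> \<Phi> k (tgt Y k x) = tgt Z k (\<Phi> (Suc k) x)"
    proof (cases k)
      case 0
      then have "src Y 0 x = ?ys ! i" "tgt Y 0 x = ?ys ! Suc i" "src Z 0 (\<Phi> (Suc 0) x) = ?zs ! i"
        "tgt Z 0 (\<Phi> (Suc 0) x) = ?zs ! Suc i"
        using i P by (auto simp: in_hom_card end_el.simps)
      then show ?thesis using 0 \<Phi>0 i by simp
    next
      case (Suc k')
      have s: "src Y k x \<in> el (hom_card Y (?ys ! i) (?ys ! Suc i)) k'" "tgt Y k x \<in> el (hom_card Y (?ys ! i) (?ys ! Suc i)) k'"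
        using globD(1,2)[OF globular_hom_card[OF gY], of x _ _ k'] i Suc by auto
      show ?thesis
        unfolding Suc \<Phi>S[OF i(1) s(1)[unfolded Suc]] \<Phi>S[OF i(1) s(2)[unfolded Suc]] \<Phi>S[OF i[unfolded Suc]]
        using gmorD(2,3)[OF Hm[OF i(1)]] i Suc by simp
    qed
    then show "\<Phi> k (src Y k x) = src Z k (\<Phi> (Suc k) x)" "\<Phi> k (tgt Y k x) = tgt Z k (\<Phi> (Suc k) x)" by auto
  qed
  have bij: "bij_betw (\<Phi> k) (el Y k) (el Z k)" for k
  proof (rule bij_betw_imageI)
    show "inj_on (\<Phi> k) (el Y k)"
    proof (rule inj_onI)
      fix x x' assume x: "x \<in> el Y k" "x' \<in> el Y k" and e: "\<Phi> k x = \<Phi> k x'"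
      show "x = x'"
      proof (cases k)
        case 0
        then obtain i j where "i < length ?ys" "x = ?ys ! i" "j < length ?ys" "x' = ?ys ! j"
          using ob x by metis
        then show ?thesis using e \<Phi>0 0 len nth_eq_iff_index_eq[OF dist(2), of i j] by simp
      next
        case (Suc k')
        obtain i where i: "Suc i < length ?ys" "x \<in> el (hom_card Y (?ys ! i) (?ys ! Suc i)) k'"
          using inhom x Suc by blast
        obtain j where j: "Suc j < length ?ys" "x' \<in> el (hom_card Y (?ys ! j) (?ys ! Suc j)) k'"
          using inhom x Suc by blast
        have "?zs ! i = ?zs ! j" using \<Phi>H[OF i] \<Phi>H[OF j] e Suc by (auto simp: in_hom_card)
        then have "i = j" using i(1) j(1) len nth_eq_iff_index_eq[OF dist(2), of i j] by simp
        then show ?thesis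
          using e Suc \<Phi>S[OF i] \<Phi>S[OF j] i j bij_betw_imp_inj_on[OF Hb[OF i(1)]] by (metis inj_onD)
      qed
    qed
    show "\<Phi> k ` el Y k = el Z k"
    proof (intro equalityI subsetI)
      fix w assume w: "w \<in> el Z k"
      show "w \<in> \<Phi> k ` el Y k"
      proof (cases k)
        case 0
        then obtain i where i: "i < length ?ys" "w = ?zs ! i"
          using w obj_list(2)[OF Z(1)] len by (metis in_set_conv_nth)
        then have "?ys ! i \<in> el Y 0" using obj_list(2)[OF Y(1)] nth_mem by blast
        then show ?thesis using \<Phi>0 i 0 by force
      next
        case (Suc k')
        obtain i where i: "Suc i < length ?ys" "w \<in> el (hom_card Z (?zs ! i) (?zs ! Suc i)) k'"
          using inhomZ w Suc by blast
        then obtain x where x: "x \<in> el (hom_card Y (?ys ! i) (?ys ! Suc i)) k'" "w = H i k' x"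
          using bij_betw_imp_surj_on[OF Hb[OF i(1)]] by blast
        then have "w = \<Phi> k x" "x \<in> el Y k" using \<Phi>S[OF i(1) x(1)] Suc by (auto simp: in_hom_card)
        then show ?thesis by blast
      qed
    qed (use gmorD(1)[OF mor] in auto)
  qed
  have "g k (\<Phi> k x) = f k x" if x: "x \<in> el Y k" for k x
  proof (cases k)
    case 0
    then show ?thesis using ob x \<Phi>0 fg by metis
  next
    case (Suc k')
    then show ?thesis using inhom x \<Phi>S Hf by metis
  qed
  then show ?case unfolding slice_iso_def giso_iff_bij[OF gY] using mor bij by blast
qed

text \<open>
  Isomorphism classes contain only objects with natural numbers as elements; this lemma
  provides such representatives for constructions carried out in other types.
\<close>

lemma ex_nat_relabelling:
  fixes P :: "'b gset"
  assumes "globular_set P" "finite (elts P)" "gmor P X f"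
  shows "\<exists>(Y :: nat gset) g h. globular_set Y \<and> gmor Y X g \<and> slice_iso P f Y g h"
proof -
  let ?V = "snd ` elts P"
  obtain e :: "'b \<Rightarrow> nat" where e: "inj_on e ?V"
    using assms(2) finite_imp_inj_to_nat_seg[of ?V] by auto
  have V: "x \<in> el P n \<Longrightarrow> x \<in> ?V" for x n by (force simp: elts_def)
  define d where "d = inv_into ?V e"
  have d: "d (e x) = x" if "x \<in> el P n" for x n using V[OF that] e by (simp add: d_def)
  let ?Y = "\<lparr> el = (\<lambda>n. e ` el P n), src = (\<lambda>n y. e (src P n (d y))), tgt = (\<lambda>n y. e (tgt P n (d y))) \<rparr>"
  let ?g = "\<lambda>n y. f n (d y)"
  note g = globD[OF assms(1)]
  have dg: "d (e (src P n x)) = src P n x" "d (e (tgt P n x)) = tgt P n x" if "x \<in> el P (Suc n)" for n x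
    using d g(1,2) that by blast+
  have "globular_set ?Y" unfolding globular_set_def by (auto simp: d dg g)
  moreover have "gmor ?Y X ?g" unfolding gmor_def using gmorD[OF assms(3)] by (auto simp: d dg)
  moreover have "gmor P ?Y (\<lambda>_. e)" unfolding gmor_def by (auto simp: d)
  moreover have "bij_betw e (el P n) (el ?Y n)" for n
    using e V by (auto simp: bij_betw_def intro: inj_on_subset)
  moreover have "?g n (e x) = f n x" if "x \<in> el P n" for n x using d that by simp
  ultimately show ?thesis unfolding slice_iso_def giso_iff_bij[OF assms(1)] by blast
qed

text \<open>
  Given cardinals \<open>Y\<^sub>i\<close> over the successive homs of a segment of \<open>X\<close>, their suspensions
  are strung together end to end.
\<close>

lemma L_rep_surj:
  assumes "glob_card X" "c \<in> gcells n (Gam X)"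
  shows "\<exists>(Y :: nat gset) f. glob_card_le n Y \<and> gmor Y X f \<and> L_rep n Y f = c"
  using assms
proof (induction n arbitrary: X c)
  case 0
  then obtain x where x: "c = Obj x" "x \<in> el X 0"
    using obs_Gam[OF 0(1)] obj_list(2)[OF 0(1)] by auto
  let ?Y = "\<lparr> el = (\<lambda>n. if n = 0 then {0} else {}), src = \<lambda>_ y. y, tgt = \<lambda>_ y. y \<rparr> :: nat gset"
  have "glob_card_le 0 ?Y" by (simp add: glob_card_le_0 globular_set_def)
  moreover have "gmor ?Y X (\<lambda>_ _. x)" using x by (simp add: gmor_def)
  moreover have "L_rep 0 ?Y (\<lambda>_ _. x) = c" using x by simp
  ultimately show ?case by blast
next
  case (Suc n)
  note X = Suc.prems(1)
  let ?xs = "obj_list X"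
  let ?H = "\<lambda>h i. hom_card X (?xs ! (h + i)) (?xs ! Suc (h + i))"
  obtain h k cs where c: "c = Arr (?xs ! h) (?xs ! k) cs" "h \<le> k" "k < length ?xs" "length cs = k - h"
    "\<And>i. i < k - h \<Longrightarrow> cs ! i \<in> gcells n (Gam (?H h i))"
    using Suc.prems(2) unfolding gcells_Gam_Suc[OF X] by blast
  let ?p = "k - h"
  have "\<exists>(Y :: nat gset) f. glob_card_le n Y \<and> gmor Y (?H h i) f \<and> L_rep n Y f = cs ! i" if i: "i < ?p" for i
  proof (rule Suc.IH[OF glob_card_hom_card(1)[OF X] c(5)[OF i]])
    show "consec X 0 (?xs ! (h + i)) (?xs ! Suc (h + i))"
      unfolding consec_iff_zip[OF X] using i c(3) by (auto simp: in_steps_iff intro!: exI[of _ "h + i"])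
  qed
  then obtain Y :: "nat \<Rightarrow> nat gset" and f where
    Y: "\<And>i. i < ?p \<Longrightarrow> glob_card_le n (Y i)" and f: "\<And>i. i < ?p \<Longrightarrow> gmor (Y i) (?H h i) (f i)"
    and L: "\<And>i. i < ?p \<Longrightarrow> L_rep n (Y i) (f i) = cs ! i"
    by metis
  \<comment> \<open>the object \<open>(i, 0)\<close> for \<open>i \<le> k - h\<close>, and the element \<open>x\<close> of \<open>Y i\<close>, raised by one dimension and
    placed between objects number \<open>i\<close> and \<open>i + 1\<close>, as \<open>(i, x)\<close>\<close>
  define P :: "(nat \<times> nat) gset" where
    "P = \<lparr> el = (\<lambda>l. case l of 0 \<Rightarrow> {..?p} \<times> {0} | Suc m \<Rightarrow> (SIGMA i:{..<?p}. el (Y i) m)),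
           src = (\<lambda>l (i, x). case l of 0 \<Rightarrow> (i, 0) | Suc m \<Rightarrow> (i, src (Y i) m x)),
           tgt = (\<lambda>l (i, x). case l of 0 \<Rightarrow> (Suc i, 0) | Suc m \<Rightarrow> (i, tgt (Y i) m x)) \<rparr>"
  define F where "F l = (\<lambda>(i, x). case l of 0 \<Rightarrow> ?xs ! (h + i) | Suc m \<Rightarrow> f i m x)" for l
  have P: "el P 0 = {..?p} \<times> {0}" "\<And>m. el P (Suc m) = (SIGMA i:{..<?p}. el (Y i) m)"
    "\<And>i x. src P 0 (i, x) = (i, 0)" "\<And>i x m. src P (Suc m) (i, x) = (i, src (Y i) m x)"
    "\<And>i x. tgt P 0 (i, x) = (Suc i, 0)" "\<And>i x m. tgt P (Suc m) (i, x) = (i, tgt (Y i) m x)"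
    by (simp_all add: P_def)
  have F: "\<And>i x. F 0 (i, x) = ?xs ! (h + i)" "\<And>i x m. F (Suc m) (i, x) = f i m x"
    by (simp_all add: F_def)
  have gYi: "globular_set (Y i)" if "i < ?p" for i
    using Y[OF that] by (simp add: glob_card_le_def glob_cardD(1))
  have ends: "end_el (src P) (Suc m) (i, x) = (i, 0)" "end_el (tgt P) (Suc m) (i, x) = (Suc i, 0)" for m i x
    by (induction m arbitrary: x) (simp_all add: end_el.simps(2)[of _ "Suc _"] P, simp_all add: end_el.simps P)
  have gP: "globular_set P"
    unfolding globular_set_def
  proof (intro conjI allI ballI)
    fix l x assume x: "x \<in> el P (Suc l)"
    then show "src P l x \<in> el P l" "tgt P l x \<in> el P l"
      by (cases l; auto simp: P globD(1,2)[OF gYi])+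
  next
    fix l x assume x: "x \<in> el P (Suc (Suc l))"
    then show "src P l (src P (Suc l) x) = src P l (tgt P (Suc l) x)"
      "tgt P l (src P (Suc l) x) = tgt P l (tgt P (Suc l) x)"
      by (cases l; auto simp: P globD(3,4)[OF gYi])+
  qed
  let ?os = "map (\<lambda>i. (i, 0 :: nat)) [0..<Suc ?p]"
  have steps: "(y, z) \<in> set (steps ?os) \<longleftrightarrow> (\<exists>i < ?p. y = (i, 0) \<and> z = (Suc i, 0))" for y z
    by (auto simp: in_steps_iff nth_append simp del: upt_Suc)
  have sp: "spine P ?os"
    unfolding spine_def
  proof (intro conjI allI ballI)
    show "set ?os = el P 0" by (auto simp: P)
    show "distinct ?os" by (auto simp: distinct_map inj_on_def)
    fix m x assume "x \<in> el P (Suc m)"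
    then show "(end_el (src P) (Suc m) x, end_el (tgt P) (Suc m) x) \<in> set (steps ?os)"
      unfolding steps by (auto simp: P ends)
  qed (use gP in auto)
  have hom: "glob_card_le n (hom_card P (i, 0) (Suc i, 0)) \<and>
      L_rep n (hom_card P (i, 0) (Suc i, 0)) (mor_shift F) = cs ! i" if i: "i < ?p" for i
  proof -
    have e: "el (hom_card P (i, 0) (Suc i, 0)) m = Pair i ` el (Y i) m" for m
      using i by (auto simp: in_hom_card P ends)
    have "giso (Y i) (hom_card P (i, 0) (Suc i, 0)) (\<lambda>_. Pair i)"
      unfolding giso_iff_bij[OF gYi[OF i]] by (auto simp: gmor_def e P bij_betw_def inj_on_def)
    from L_rep_giso[OF Y[OF i] globular_hom_card[OF gP] this, of "mor_shift F" "f i"]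
    show ?thesis using L[OF i] by (simp add: mor_shift_def F)
  qed
  have Pn: "glob_card_le (Suc n) P" "obj_list P = ?os"
    using glob_card_le_SucI[OF sp, of n] hom unfolding steps by blast+
  have gmF: "gmor P X F"
    unfolding gmor_def
  proof (intro conjI allI ballI)
    fix l x assume "x \<in> el P l"
    then show "F l x \<in> el X l"
    proof (cases l)
      case 0
      have "?xs ! (h + i) \<in> el X 0" if "i \<le> ?p" for i
        using that c(2,3) obj_list(2)[OF X] nth_mem[of "h + i" ?xs] by auto
      then show ?thesis using \<open>x \<in> el P l\<close> 0 by (auto simp: P F)
    next
      case (Suc m)
      then show ?thesis using \<open>x \<in> el P l\<close> gmorD(1)[OF f] by (auto simp: P F in_hom_card)
    qed
  next
    fix l x assume "x \<in> el P (Suc l)"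
    then obtain i w where x: "x = (i, w)" "i < ?p" "w \<in> el (Y i) l" by (auto simp: P)
    note m = gmorD[OF f[OF x(2)]]
    have "f i l w \<in> el (?H h i) l" using m(1) x(3) .
    then show "F l (src P l x) = src X l (F (Suc l) x)" "F l (tgt P l x) = tgt X l (F (Suc l) x)"
      unfolding x(1) using x(3) m(2,3) by (cases l; auto simp: P F in_hom_card end_el.simps)+
  qed
  have gP: "glob_card P" using Pn(1) by (simp add: glob_card_le_def)
  have "map (\<lambda>(y, z). L_rep n (hom_card P y z) (mor_shift F)) (steps ?os) = cs"
    using hom c(4) by (intro nth_equalityI) (auto simp: nth_tl nth_append simp del: upt_Suc)
  then have "L_rep (Suc n) P F = c"
    unfolding L_rep_Suc_hom[OF gP] Pn(2) c(1) using c(2) by (simp add: hd_map last_map F del: upt_Suc)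
  moreover obtain Z :: "nat gset" and g r where "globular_set Z" "gmor Z X g" "slice_iso P F Z g r"
    using ex_nat_relabelling[OF glob_cardD(1,2)[OF gP] gmF] by blast
  moreover from this have "glob_card_le (Suc n) Z \<and> L_rep (Suc n) Z g = L_rep (Suc n) P F"
    by (intro L_rep_giso[OF Pn(1)]) (auto simp: slice_iso_def)
  ultimately show ?case by metis
qed

section \<open>Composites as unions\<close>

text \<open>
  Composition of cells, with all cardinals taken inside one globular set \<open>P\<close>; the common part of
  \<open>A\<close> and \<open>B\<close> is at once the \<open>m\<close>-target of \<open>A\<close> and the \<open>m\<close>-source of \<open>B\<close>.  For \<open>m > 0\<close> all hypotheses
  pass to the homs of \<open>P\<close>.
\<close>

lemma L_rep_union:
  assumes "glob_card_le n A" "glob_card_le n B" "m < n"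
    and "src A = src P" "tgt A = tgt P" "src B = src P" "tgt B = tgt P"
    and "\<And>k. el P k = el A k \<union> el B k"
    and "\<And>k. el (bnd False m A) k = el A k \<inter> el B k"
    and "\<And>k. el (bnd True m B) k = el A k \<inter> el B k"
  shows "glob_card_le n P \<and> L_rep n P f = gcomp m (L_rep n B f) (L_rep n A f)"
  using assms
proof (induction m arbitrary: n A B P f)
  case 0
  obtain n' where n: "n = Suc n'" using 0(3) by (cases n) auto
  note An = 0(1)[unfolded n] and Bn = 0(2)[unfolded n]
  note sAP = 0(4,5) and sBP = 0(6,7) and un = 0(8)
  have A: "glob_card A" "el A 0 \<noteq> {}" and B: "glob_card B" "el B 0 \<noteq> {}"
    using An Bn el_0_nonempty[of A] el_0_nonempty[of B] glob_cardD(1)[of A] glob_cardD(1)[of B]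
    by (auto simp: glob_card_le_def)
  let ?as = "obj_list A" and ?bs = "obj_list B"
  note spA = glob_card_le_spine[OF An, unfolded spine_def] and spB = glob_card_le_spine[OF Bn, unfolded spine_def]
  have int0: "el A 0 \<inter> el B 0 = {last ?as}" "el A 0 \<inter> el B 0 = {hd ?bs}"
    using el_bnd_0[OF A, of False] el_bnd_0[OF B, of True] 0(9,10) by auto
  have ne: "?as \<noteq> []" "?bs \<noteq> []" using spA spB by auto
  have meet: "last ?as = hd ?bs" using int0 by auto
  let ?ys = "?as @ tl ?bs"
  have st: "steps ?ys = steps ?as @ steps ?bs" by (rule steps_append[OF ne meet])
  have bs: "?bs = hd ?bs # tl ?bs" using ne by simp
  have sets: "set ?as = el A 0" "set ?bs = el B 0" using spA spB by auto
  have gP: "globular_set P"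
    using globD[OF glob_cardD(1)[OF A(1)]] globD[OF glob_cardD(1)[OF B(1)]] un
    unfolding globular_set_def sAP sBP by auto
  have sp: "spine P ?ys"
    unfolding spine_def
  proof (intro conjI allI ballI)
    have "set ?bs = insert (hd ?bs) (set (tl ?bs))" "hd ?bs \<notin> set (tl ?bs)" "distinct (tl ?bs)"
      using bs spB by (metis list.simps(15), metis distinct.simps(2), metis distinct_tl)
    moreover have "x = hd ?bs" if "x \<in> set ?as" "x \<in> set ?bs" for x
      using that int0(2) unfolding sets by blast
    ultimately have "set ?as \<inter> set (tl ?bs) = {}" "distinct (tl ?bs)" by auto
    moreover have "set ?ys = set ?as \<union> set ?bs"
      using \<open>set ?bs = insert (hd ?bs) (set (tl ?bs))\<close> meet last_in_set[OF ne(1)] by auto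
    ultimately show "distinct ?ys" "set ?ys = el P 0" using spA un sets by auto
    fix k x assume "x \<in> el P (Suc k)"
    then consider "x \<in> el A (Suc k)" | "x \<in> el B (Suc k)" using un by blast
    then show "(end_el (src P) (Suc k) x, end_el (tgt P) (Suc k) x) \<in> set (steps ?ys)"
    proof cases
      case 1
      then show ?thesis using spA sAP st by auto
    next
      case 2
      then show ?thesis using spB sBP st by auto
    qed
  qed (use ne gP in auto)
  \<comment> \<open>the end points of a common step would be two different common objects\<close>
  have no_common: False if "(y, z) \<in> set (steps ?as)" "(y, z) \<in> set (steps ?bs)" for y z
  proof -
    have "y \<in> el A 0 \<inter> el B 0" "z \<in> el A 0 \<inter> el B 0"
      using steps_mem[OF that(1)] steps_mem[OF that(2)] sets by auto
    then have "y = z" unfolding int0(1) by simp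
    then show False using steps_distinct[OF _ that(1)] spA by blast
  qed
  have homA: "hom_card P y z = hom_card A y z" if "(y, z) \<in> set (steps ?as)" for y z
  proof (rule gset.equality)
    have "x \<in> el (hom_card P y z) k \<longleftrightarrow> x \<in> el (hom_card A y z) k" for x k
      using no_common[OF that] spB un[of "Suc k"] sAP sBP by (auto simp: in_hom_card)
    then show "el (hom_card P y z) = el (hom_card A y z)" by blast
  qed (simp_all add: hom_card_def sAP)
  have homB: "hom_card P y z = hom_card B y z" if "(y, z) \<in> set (steps ?bs)" for y z
  proof (rule gset.equality)
    have "x \<in> el (hom_card P y z) k \<longleftrightarrow> x \<in> el (hom_card B y z) k" for x k
      using no_common[OF _ that] spA un[of "Suc k"] sAP sBP by (auto simp: in_hom_card)
    then show "el (hom_card P y z) = el (hom_card B y z)" by blast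
  qed (simp_all add: hom_card_def sBP)
  have "glob_card_le n' (hom_card P y z)" if "(y, z) \<in> set (steps ?ys)" for y z
    using that homA homB glob_card_le_hom[OF An] glob_card_le_hom[OF Bn] unfolding st by auto
  then have P: "glob_card_le (Suc n') P" "obj_list P = ?ys"
    using glob_card_le_SucI[OF sp, of n'] by auto
  then have gcP: "glob_card P" by (simp add: glob_card_le_def)
  have "last ?ys = last ?bs" using bs meet by (metis last_ConsL last_ConsR last_append)
  then show ?case
    using P(1) homA homB ne
    unfolding n L_rep_Suc_hom[OF gcP] L_rep_Suc_hom[OF A(1)] L_rep_Suc_hom[OF B(1)] P(2) st by auto
next
  case (Suc m)
  obtain n' where n: "n = Suc n'" "m < n'" using Suc.prems(3) by (cases n) auto
  note An = Suc.prems(1)[unfolded n] and Bn = Suc.prems(2)[unfolded n]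
  note sAP = Suc.prems(4,5) and sBP = Suc.prems(6,7) and un = Suc.prems(8)
    and bA = Suc.prems(9) and bB = Suc.prems(10)
  have A: "glob_card A" and B: "glob_card B" using An Bn by (auto simp: glob_card_le_def)
  note spA = glob_card_le_spine[OF An] and spB = glob_card_le_spine[OF Bn]
  let ?ys = "obj_list A"
  \<comment> \<open>both boundaries are the same globular set, which has all objects of \<open>A\<close> and of \<open>B\<close>\<close>
  have eq: "bnd False (Suc m) A = bnd True (Suc m) B"
    using bA bB sAP sBP by (intro gset.equality) auto
  have objs: "obj_list (bnd b (Suc m) C) = obj_list C"
    if C: "glob_card_le (Suc n') C" for b and C :: "'a gset"
  proof -
    have gC: "glob_card C" using C by (simp add: glob_card_le_def)
    have "spine (bnd b (Suc m) C) (obj_list C)"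
      using glob_card_le_spine[OF C] globular_bnd[OF gC] el_bnd[OF gC, of _ b "Suc m"]
      by (auto simp: spine_def)
    moreover have "glob_card_le m (hom_card (bnd b (Suc m) C) y z)" if "(y, z) \<in> set (steps (obj_list C))" for y z
      using conjunct1[OF bnd_L_rep[OF glob_card_le_hom[OF C that] n(2)]] hom_card_bnd[OF gC, of y z b m]
        consec_iff_zip[OF gC] that by simp
    ultimately show ?thesis by (rule glob_card_le_SucI(2))
  qed
  have ys: "obj_list B = ?ys" using objs[OF An, of False] objs[OF Bn, of True] eq by simp
  have el0: "el B 0 = el A 0" using spA spB ys by (simp add: spine_def)
  have gP: "globular_set P"
    using globD[OF glob_cardD(1)[OF A]] globD[OF glob_cardD(1)[OF B]] un
    unfolding globular_set_def sAP sBP by auto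
  have sp: "spine P ?ys"
    using spA spB gP un el0 sAP sBP ys unfolding spine_def by auto
  have hom: "glob_card_le n' (hom_card P y z) \<and> L_rep n' (hom_card P y z) (mor_shift f) =
      gcomp m (L_rep n' (hom_card B y z) (mor_shift f)) (L_rep n' (hom_card A y z) (mor_shift f))"
    if yz: "(y, z) \<in> set (steps ?ys)" for y z
  proof (rule Suc.IH)
    show "glob_card_le n' (hom_card A y z)" "glob_card_le n' (hom_card B y z)"
      using glob_card_le_hom[OF An] glob_card_le_hom[OF Bn] yz ys by auto
    have cA: "consec A 0 y z" and cB: "consec B 0 y z"
      using consec_iff_zip[OF A] consec_iff_zip[OF B] yz ys by auto
    show "el (hom_card P y z) k = el (hom_card A y z) k \<union> el (hom_card B y z) k" for k
      using un sAP sBP by (auto simp: in_hom_card)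
    show "el (bnd False m (hom_card A y z)) k = el (hom_card A y z) k \<inter> el (hom_card B y z) k" for k
      unfolding hom_card_bnd[OF A cA, symmetric] using bA[of "Suc k"] sAP sBP by (auto simp: in_hom_card)
    show "el (bnd True m (hom_card B y z)) k = el (hom_card A y z) k \<inter> el (hom_card B y z) k" for k
      unfolding hom_card_bnd[OF B cB, symmetric] using bB[of "Suc k"] sAP sBP by (auto simp: in_hom_card)
  qed (use n(2) sAP sBP in \<open>auto simp: hom_card_def\<close>)
  have P: "glob_card_le (Suc n') P" "obj_list P = ?ys"
    using glob_card_le_SucI[OF sp, of n'] hom by auto
  then have gcP: "glob_card P" by (simp add: glob_card_le_def)
  show ?case
    using P(1) hom
    unfolding n L_rep_Suc_hom[OF gcP] L_rep_Suc_hom[OF A(1)] L_rep_Suc_hom[OF B(1)] P(2) ys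
      gcomp.simps map2_map_map by auto
qed

lemma gmor_path:
  assumes "globular_set Y" "gmor Y Z h" "((j, x), (k, w)) \<in> (prec Y)\<^sup>*"
  shows "((j, h j x), (k, h k w)) \<in> (prec Z)\<^sup>*"
  using assms(3)
proof (induction "(k, w)" arbitrary: k w rule: rtrancl_induct)
  case (step b k w)
  obtain k' w' where b: "b = (k', w')" by fastforce
  have "((k', h k' w'), (k, h k w)) \<in> prec Z"
    using step(2) gmorD[OF assms(2)] unfolding b prec_iff by auto
  with step(3)[OF b] show ?case by (rule rtrancl_into_rtrancl)
qed simp

text \<open>
  By \<open>el_bnd\<close> the boundary is determined by sources, targets and the order, which an isomorphism
  preserves in both directions.
\<close>

lemma el_bnd_giso:
  assumes Y: "glob_card Y" and Z: "glob_card Z" and h: "giso Y Z h"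
  shows "el (bnd b m Z) k = h k ` el (bnd b m Y) k"
proof -
  note gY = glob_cardD(1)[OF Y]
  have mor: "gmor Y Z h" and bij: "\<And>n. bij_betw (h n) (el Y n) (el Z n)"
    using h unfolding giso_iff_bij[OF gY] by auto
  note m' = gmorD[OF mor]
  have inj: "h n x = h n y \<longleftrightarrow> x = y" if "x \<in> el Y n" "y \<in> el Y n" for n x y
    using bij_betw_imp_inj_on[OF bij] that by (meson inj_onD)
  have surj: "el Z n = h n ` el Y n" for n using bij_betw_imp_surj_on[OF bij] by blast
  have tri: "((j, x), (l, w)) \<in> tri Y \<longleftrightarrow> ((j, h j x), (l, h l w)) \<in> tri Z"
    if xw: "x \<in> el Y j" "w \<in> el Y l" for j x l w
  proof
    show "((j, h j x), (l, h l w)) \<in> tri Z" if "((j, x), (l, w)) \<in> tri Y"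
      using gmor_path[OF gY mor] that xw m'(1) by (auto simp: tri_def elts_iff)
    assume *: "((j, h j x), (l, h l w)) \<in> tri Z"
    have e: "(j, x) \<in> elts Y" "(l, w) \<in> elts Y" using xw by (auto simp: elts_iff)
    from glob_cardD(3)[OF Y e] show "((j, x), (l, w)) \<in> tri Y"
    proof
      assume "((l, w), (j, x)) \<in> (prec Y)\<^sup>*"
      then have "(j, h j x) = (l, h l w)"
        using gmor_path[OF gY mor] triD[OF *] by (intro tri_antisym[OF Z]) auto
      then have "(j, x) = (l, w)" using inj xw by auto
      then show ?thesis using e by (auto simp: tri_def)
    qed (use e in \<open>simp add: tri_def\<close>)
  qed
  have par: "parallel Z m (h m x) (h m y) \<longleftrightarrow> parallel Y m x y" if "x \<in> el Y m" "y \<in> el Y m" for x y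
    using that m'(2,3)[symmetric] inj globD(1,2)[OF gY] by (auto simp: parallel_def)
  have "h k x \<in> el (bnd b m Z) k \<longleftrightarrow> x \<in> el (bnd b m Y) k" if x: "x \<in> el Y k" for x
    unfolding el_bnd[OF Y] el_bnd[OF Z] surj[of m] tri_dir_def using x m'(1) tri par by auto
  moreover have "el (bnd b m Z) k \<subseteq> h k ` el Y k" "el (bnd b m Y) k \<subseteq> el Y k"
    using el_bnd[OF Y] el_bnd[OF Z] surj by auto
  ultimately show ?thesis by blast
qed

lemma globular_image:
  assumes "globular_set Y" "gmor Y Z h" "\<And>k. el Z k = h k ` el Y k"
  shows "globular_set Z"
  using globD[OF assms(1)] gmorD(2,3)[OF assms(2), symmetric]
  unfolding globular_set_def assms(3) by auto

lemma equiv_glue: "equiv UNIV (glue W d n)"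
  unfolding glue_def Let_def
  by (intro equivI refl_rtrancl sym_rtrancl trans_rtrancl) (auto simp: sym_def)

lemma glue_class: "glue W d n `` {a} = glue W d n `` {b} \<longleftrightarrow> (a, b) \<in> glue W d n"
  using equiv_glue[of W d n] eq_equiv_class_iff[of UNIV "glue W d n" a b] by simp

lemma glue_Image:
  assumes "a \<in> S" "\<And>b. b \<in> S \<Longrightarrow> (a, b) \<in> glue W d n"
  shows "glue W d n `` S = glue W d n `` {a}"
  using assms equiv_glue[of W d n] unfolding equiv_def by (auto dest: transD symD)

text \<open>
  Since \<open>d\<close> is injective, no class has more than two elements: the generated equivalence relation adds
  only the identity to the generating pairs and their converses.
\<close>

lemma glue_iff:
  assumes "inj_on (d n) (el W n)"
  shows "(a, b) \<in> glue W d n \<longleftrightarrow> a = b \<or> (\<exists>w \<in> el W n. a = Inl (d n w) \<and> b = Inr w)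
    \<or> (\<exists>w \<in> el W n. b = Inl (d n w) \<and> a = Inr w)"
proof
  let ?R = "{(Inl (d n w), Inr w) | w. w \<in> el W n}"
  assume "(a, b) \<in> glue W d n"
  then have "(a, b) \<in> (?R \<union> ?R\<inverse>)\<^sup>*" by (simp add: glue_def Let_def)
  then show "a = b \<or> (\<exists>w \<in> el W n. a = Inl (d n w) \<and> b = Inr w) \<or> (\<exists>w \<in> el W n. b = Inl (d n w) \<and> a = Inr w)"
  proof (induction rule: rtrancl_induct)
    case (step b c)
    then show ?case using assms by (auto dest: inj_onD)
  qed simp
next
  let ?R = "{(Inl (d n w), Inr w) | w. w \<in> el W n}"
  assume "a = b \<or> (\<exists>w \<in> el W n. a = Inl (d n w) \<and> b = Inr w) \<or> (\<exists>w \<in> el W n. b = Inl (d n w) \<and> a = Inr w)"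
  then have "a = b \<or> (a, b) \<in> ?R \<union> ?R\<inverse>" by blast
  then show "(a, b) \<in> glue W d n" by (auto simp: glue_def Let_def)
qed

text \<open>
  Both maps into the pushout are injective, because it is glued along an isomorphism between subsets.
  It is therefore the union of copies of \<open>Y\<close> and \<open>Z\<close>, whose intersection is the copy of the common
  boundary.
\<close>

lemma pushout_cell:
  assumes Yn: "glob_card_le n Y" and Zn: "glob_card_le n Z" and f: "gmor Y X f" and g: "gmor Z X g"
    and mn: "m < n" and iso: "slice_iso (gsource m Z) g (gtarget m Y) f d"
  shows "glob_card_le n (pushout Y Z (gsource m Z) d)" (is "?c1")
    and "gmor (pushout Y Z (gsource m Z) d) X (pushout_mor f g)" (is "?c2")
    and "L_rep n (pushout Y Z (gsource m Z) d) (pushout_mor f g) = gcomp m (L_rep n Z g) (L_rep n Y f)" (is "?c3")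
proof -
  let ?W = "gsource m Z" and ?V = "gtarget m Y"
  let ?P = "pushout Y Z ?W d" and ?F = "pushout_mor f g"
  have Y: "glob_card Y" and Z: "glob_card Z" using Yn Zn by (auto simp: glob_card_le_def)
  note gY = glob_cardD(1)[OF Y] and gZ = glob_cardD(1)[OF Z]
  have bW: "?W = bnd True m Z" and bV: "?V = bnd False m Y" by (simp_all add: bnd_def)
  have gW: "globular_set ?W" unfolding bW by (rule globular_bnd[OF Z])
  have sW: "src ?W = src Z" "tgt ?W = tgt Z" and sV: "src ?V = src Y" "tgt ?V = tgt Y"
    unfolding bW bV by simp_all
  have subW: "w \<in> el Z k" if "w \<in> el ?W k" for w k using that unfolding bW by (simp add: el_bnd[OF Z])
  have subV: "v \<in> el Y k" if "v \<in> el ?V k" for v k using that unfolding bV by (simp add: el_bnd[OF Y])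
  have dm: "gmor ?W ?V d" and db: "\<And>k. bij_betw (d k) (el ?W k) (el ?V k)"
    and df: "\<And>k w. w \<in> el ?W k \<Longrightarrow> f k (d k w) = g k w"
    using iso unfolding slice_iso_def giso_iff_bij[OF gW] by auto
  have dV: "d k w \<in> el ?V k" if "w \<in> el ?W k" for w k using gmorD(1)[OF dm that] .
  have ds: "d k (src Z k w) = src Y k (d (Suc k) w)" "d k (tgt Z k w) = tgt Y k (d (Suc k) w)"
    "src Z k w \<in> el ?W k" "tgt Z k w \<in> el ?W k" if "w \<in> el ?W (Suc k)" for w k
    using gmorD(2,3)[OF dm that] globD(1,2)[OF gW that] unfolding sW sV by auto
  note glue = glue_iff[of d _ ?W, OF bij_betw_imp_inj_on[OF db]]
  define i where "i k y = glue ?W d k `` {Inl y}" for k y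
  define j where "j k z = glue ?W d k `` {Inr z}" for k z
  have ij: "i k y = j k z \<longleftrightarrow> z \<in> el ?W k \<and> y = d k z" for k y z
    unfolding i_def j_def glue_class glue by auto
  have i_inj: "i k y = i k y' \<longleftrightarrow> y = y'" for k y y'
    unfolding i_def glue_class glue by auto
  have j_inj: "j k z = j k z' \<longleftrightarrow> z = z'" for k z z'
    unfolding j_def glue_class glue by auto
  have elP: "el ?P k = i k ` el Y k \<union> j k ` el Z k" for k
    by (auto simp: pushout_def quotient_def i_def j_def Plus_def)
  have iP: "src ?P k (i (Suc k) y) = i k (src Y k y)" "tgt ?P k (i (Suc k) y) = i k (tgt Y k y)" for k y
    unfolding i_def pushout_def gset.simps
    by (rule glue_Image; force simp: glue ds)+
  have jP: "src ?P k (j (Suc k) z) = j k (src Z k z)" "tgt ?P k (j (Suc k) z) = j k (tgt Z k z)" for k z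
    unfolding j_def pushout_def gset.simps
    by (rule glue_Image; force simp: glue ds)+
  have Fi: "?F k (i k y) = f k y" for k y
  proof -
    have "case_sum (f k) (g k) ` i k y = {f k y}"
      unfolding i_def using df by (force simp: glue)
    then show ?thesis by (simp add: pushout_mor_def)
  qed
  have Fj: "?F k (j k z) = g k z" for k z
  proof -
    have "case_sum (f k) (g k) ` j k z = {g k z}"
      unfolding j_def using df by (force simp: glue)
    then show ?thesis by (simp add: pushout_mor_def)
  qed
  show ?c2
    unfolding gmor_def elP using gmorD[OF f] gmorD[OF g] by (auto simp: Fi Fj iP jP)
  \<comment> \<open>the pushout is the union of the images of \<open>Y\<close> and \<open>Z\<close>\<close>
  let ?A = "?P \<lparr>el := \<lambda>k. i k ` el Y k\<rparr>" and ?B = "?P \<lparr>el := \<lambda>k. j k ` el Z k\<rparr>"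
  have A: "giso Y ?A i" and B: "giso Z ?B j"
    unfolding giso_iff_bij[OF gY] giso_iff_bij[OF gZ]
    by (auto simp: gmor_def iP jP bij_betw_def inj_on_def i_inj j_inj)
  have gA: "globular_set ?A" using A globular_image[OF gY, of ?A i] by (auto simp: giso_def)
  have gB: "globular_set ?B" using B globular_image[OF gZ, of ?B j] by (auto simp: giso_def)
  have LA: "glob_card_le n ?A \<and> L_rep n ?A ?F = L_rep n Y f"
    by (rule L_rep_giso[OF Yn gA A]) (simp add: Fi)
  have LB: "glob_card_le n ?B \<and> L_rep n ?B ?F = L_rep n Z g"
    by (rule L_rep_giso[OF Zn gB B]) (simp add: Fj)
  have cA: "glob_card ?A" and cB: "glob_card ?B" using LA LB by (auto simp: glob_card_le_def)
  have int: "i k ` el Y k \<inter> j k ` el Z k = i k ` el ?V k" "i k ` el Y k \<inter> j k ` el Z k = j k ` el ?W k" for k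
  proof -
    have V: "el ?V k = d k ` el ?W k" using bij_betw_imp_surj_on[OF db] by blast
    have *: "j k w = i k (d k w)" if "w \<in> el ?W k" for w using ij that by metis
    show "i k ` el Y k \<inter> j k ` el Z k = j k ` el ?W k"
    proof (intro equalityI subsetI)
      fix q assume "q \<in> i k ` el Y k \<inter> j k ` el Z k"
      then obtain y z where "q = i k y" "q = j k z" by blast
      then show "q \<in> j k ` el ?W k" using ij by blast
    next
      fix q assume "q \<in> j k ` el ?W k"
      then obtain w where w: "w \<in> el ?W k" "q = j k w" by blast
      then show "q \<in> i k ` el Y k \<inter> j k ` el Z k" using *[OF w(1)] subW subV dV by blast
    qed
    moreover have "j k ` el ?W k = i k ` el ?V k" unfolding V image_image using * by auto
    ultimately show "i k ` el Y k \<inter> j k ` el Z k = i k ` el ?V k" by simp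
  qed
  have "glob_card_le n ?P \<and> L_rep n ?P ?F = gcomp m (L_rep n ?B ?F) (L_rep n ?A ?F)"
  proof (rule L_rep_union[OF conjunct1[OF LA] conjunct1[OF LB] mn])
    show "el ?P k = el ?A k \<union> el ?B k" for k using elP by simp
    show "el (bnd False m ?A) k = el ?A k \<inter> el ?B k" for k
      unfolding el_bnd_giso[OF Y cA A] using int(1)[of k] unfolding bV by simp
    show "el (bnd True m ?B) k = el ?A k \<inter> el ?B k" for k
      unfolding el_bnd_giso[OF Z cB B] using int(2)[of k] unfolding bW by simp
  qed simp_all
  then show ?c1 ?c3 using LA LB by auto
qed

section \<open>The isomorphism\<close>

text \<open>
  As a function of the cell \<open>c\<close> of the free \<open>\<omega>\<close>-category on \<open>\<Gamma> X\<close>, the inverse of \<open>L\<close>.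
\<close>

definition rep_class :: "'a gset \<Rightarrow> nat \<Rightarrow> 'a gcell \<Rightarrow> 'a slice_obj set" where
  "rep_class X n c = {(Z, g). glob_card_le n Z \<and> gmor Z X g \<and> L_rep n Z g = c}"

text \<open>
  Isomorphism classes of \<open>n\<close>-cells are the fibres of \<open>L_rep n\<close>, also for classes of objects whose
  elements are of another type than \<open>nat\<close>.
\<close>

lemma iso_class_eq:
  assumes X: "glob_card X" and P: "glob_card_le n P" "gmor P X f"
  shows "iso_class X P f = rep_class X n (L_rep n P f)"
proof (intro equalityI subsetI; clarify)
  fix Z g assume "(Z, g) \<in> iso_class X P f"
  then obtain h where Z: "glob_card Z" "gmor Z X g" and h: "giso P Z h" "\<forall>k. \<forall>y \<in> el P k. g k (h k y) = f k y"
    by (auto simp: iso_class_def slice_objs_def slice_iso_def)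
  show "(Z, g) \<in> rep_class X n (L_rep n P f)"
    using L_rep_giso[OF P(1) glob_cardD(1)[OF Z(1)] h] Z(2) by (simp add: rep_class_def)
next
  fix Z g assume "(Z, g) \<in> rep_class X n (L_rep n P f)"
  then have Z: "glob_card_le n Z" "gmor Z X g" "L_rep n P f = L_rep n Z g" by (auto simp: rep_class_def)
  from L_rep_inj[OF P(1) Z(1) X P(2) Z(2,3)] Z show "(Z, g) \<in> iso_class X P f"
    by (auto simp: iso_class_def slice_objs_def glob_card_le_def)
qed

lemma rep_class_nonempty:
  "glob_card X \<Longrightarrow> c \<in> gcells n (Gam X) \<Longrightarrow> \<exists>Y f. (Y, f) \<in> rep_class X n c"
  using L_rep_surj by (fastforce simp: rep_class_def)

lemma ncells_free_glob:
  assumes X: "glob_card X"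
  shows "ncells (free_glob X) n = rep_class X n ` gcells n (Gam X)"
proof (intro equalityI subsetI)
  fix A assume "A \<in> ncells (free_glob X) n"
  then obtain Y f where A: "A = iso_class X Y f"
    and "(Y, f) \<in> slice_objs X" "elts Y \<noteq> {}" "\<forall>m > n. el Y m = {}"
    unfolding free_glob_def ocat.simps by blast
  then have Y: "glob_card_le n Y" "gmor Y X f" by (simp_all add: slice_objs_def glob_card_le_def)
  from A show "A \<in> rep_class X n ` gcells n (Gam X)"
    using iso_class_eq[OF X Y(1,2)] L_rep_in_gcells[OF Y(1) X Y(2)] by blast
next
  fix A assume "A \<in> rep_class X n ` gcells n (Gam X)"
  then obtain c where c: "c \<in> gcells n (Gam X)" "A = rep_class X n c" by blast
  then obtain Y f where "(Y, f) \<in> rep_class X n c" using rep_class_nonempty[OF X] by blast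
  then have Y: "glob_card_le n Y" "gmor Y X f" "L_rep n Y f = c" by (auto simp: rep_class_def)
  then have "A = iso_class X Y f" using iso_class_eq[OF X Y(1,2)] c by simp
  moreover have "(Y, f) \<in> slice_objs X" "elts Y \<noteq> {}" "\<forall>m > n. el Y m = {}"
    using Y(1,2) by (simp_all add: slice_objs_def glob_card_le_def)
  ultimately show "A \<in> ncells (free_glob X) n"
    unfolding free_glob_def ocat.simps by blast
qed

lemma L_fun_rep_class:
  assumes "glob_card X" "c \<in> gcells n (Gam X)"
  shows "L_fun n (rep_class X n c) = c"
proof -
  have "(\<lambda>(Y, g). L_rep n Y g) ` rep_class X n c = {c}"
    using rep_class_nonempty[OF assms] by (force simp: rep_class_def)
  then show ?thesis by (simp add: L_fun_def)
qed

lemma bnd_iso_class: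
  assumes X: "glob_card X" and Y: "(Y, f) \<in> rep_class X n c" and m: "m < n"
  shows "iso_class X (bnd b m Y) f = rep_class X m ((if b then gdom m else gcod m) c)"
    and "glob_card_le m (bnd b m Y)" "gmor (bnd b m Y) X f"
    and "L_rep m (bnd b m Y) f = (if b then gdom m else gcod m) c"
proof -
  have Yn: "glob_card_le n Y" "gmor Y X f" "L_rep n Y f = c" using Y by (auto simp: rep_class_def)
  show B: "glob_card_le m (bnd b m Y)" "L_rep m (bnd b m Y) f = (if b then gdom m else gcod m) c"
    using bnd_L_rep[OF Yn(1) m, of b f] Yn(3) by auto
  show g: "gmor (bnd b m Y) X f"
    using Yn(1,2) el_bnd[of Y] by (auto simp: gmor_def glob_card_le_def)
  show "iso_class X (bnd b m Y) f = rep_class X m ((if b then gdom m else gcod m) c)"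
    using iso_class_eq[OF X B(1) g] B(2) by simp
qed

text \<open>
  Each operation is a union over all representatives; every one of them contributes the same
  class, and there is at least one.
\<close>

lemma free_glob_ops:
  assumes X: "glob_card X" and c: "c \<in> gcells n (Gam X)"
  shows "m < n \<Longrightarrow> mdom (free_glob X) m n (rep_class X n c) = rep_class X m (gdom m c)"
    and "m < n \<Longrightarrow> mcod (free_glob X) m n (rep_class X n c) = rep_class X m (gcod m c)"
    and "d \<in> gcells n (Gam X) \<Longrightarrow> m < n \<Longrightarrow> gdom m d = gcod m c \<Longrightarrow>
      mcomp (free_glob X) m n (rep_class X n d) (rep_class X n c) = rep_class X n (gcomp m d c)"
proof -
  note ne = rep_class_nonempty[OF X c]
  assume m: "m < n"
  have "mdom (free_glob X) m n (rep_class X n c) = (\<Union>(Y, f) \<in> rep_class X n c. rep_class X m (gdom m c))"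
    unfolding free_glob_def using bnd_iso_class(1)[OF X _ m, of _ _ c True] by (auto simp: bnd_def)
  then show "mdom (free_glob X) m n (rep_class X n c) = rep_class X m (gdom m c)"
    using ne by auto
  have "mcod (free_glob X) m n (rep_class X n c) = (\<Union>(Y, f) \<in> rep_class X n c. rep_class X m (gcod m c))"
    unfolding free_glob_def using bnd_iso_class(1)[OF X _ m, of _ _ c False] by (auto simp: bnd_def)
  then show "mcod (free_glob X) m n (rep_class X n c) = rep_class X m (gcod m c)"
    using ne by auto
  assume d: "d \<in> gcells n (Gam X)" and dc: "gdom m d = gcod m c"
  let ?S = "{iso_class X (pushout Y Z (gsource m Z) e) (pushout_mor f g) |
         Y f Z g e. (Y, f) \<in> rep_class X n c \<and> (Z, g) \<in> rep_class X n d \<and>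
           slice_iso (gsource m Z) g (gtarget m Y) f e}"
  have "A = rep_class X n (gcomp m d c)" if S: "A \<in> ?S" for A
  proof -
    obtain Y f Z g e where A: "A = iso_class X (pushout Y Z (gsource m Z) e) (pushout_mor f g)"
      "(Y, f) \<in> rep_class X n c" "(Z, g) \<in> rep_class X n d"
      and e: "slice_iso (gsource m Z) g (gtarget m Y) f e"
      using S by blast
    then have Y: "glob_card_le n Y" "gmor Y X f" "L_rep n Y f = c"
      and Z: "glob_card_le n Z" "gmor Z X g" "L_rep n Z g = d"
      by (auto simp: rep_class_def)
    note P = pushout_cell[OF Y(1) Z(1) Y(2) Z(2) m e]
    show ?thesis using iso_class_eq[OF X P(1,2)] P(3) A(1) Y(3) Z(3) by simp
  qed
  moreover have "?S \<noteq> {}"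
  proof -
    obtain Y f where Y: "(Y, f) \<in> rep_class X n c" using ne by blast
    obtain Z g where Z: "(Z, g) \<in> rep_class X n d" using rep_class_nonempty[OF X d] by blast
    have "\<exists>e. slice_iso (gsource m Z) g (gtarget m Y) f e"
      using L_rep_inj[OF bnd_iso_class(2)[OF X Z m, of True] bnd_iso_class(2)[OF X Y m, of False] X
          bnd_iso_class(3)[OF X Z m, of True] bnd_iso_class(3)[OF X Y m, of False]]
        bnd_iso_class(4)[OF X Z m, of True] bnd_iso_class(4)[OF X Y m, of False] dc
      by (simp add: bnd_def)
    then show ?thesis using Y Z by blast
  qed
  ultimately have "?S = {rep_class X n (gcomp m d c)}" by blast
  then show "mcomp (free_glob X) m n (rep_class X n d) (rep_class X n c) = rep_class X n (gcomp m d c)"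
    by (simp add: free_glob_def)
qed

text \<open>
  A cardinal of dimension at most \<open>n\<close>, read as one of dimension at most \<open>n + 1\<close>, acquires an empty
  sequence at each of its \<open>n\<close>-dimensional elements.
\<close>

lemma L_rep_ident:
  assumes "glob_card_le n Y"
  shows "glob_card_le (Suc n) Y \<and> L_rep (Suc n) Y f = gident (L_rep n Y f)"
  using assms
proof (induction n arbitrary: Y f)
  case 0
  have Y: "glob_card Y" using 0 by (simp add: glob_card_le_def)
  obtain y where y: "el Y 0 = {y}" using 0 by (auto simp: glob_card_le_0)
  have "set (obj_list Y) = {y}" "distinct (obj_list Y)" using obj_list[OF Y] y by auto
  then have "obj_list Y = [y]"
    by (metis distinct_card card.empty card_insert_if finite.emptyI empty_iff length_0_conv length_Suc_conv list.set_intros(1) singletonD)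
  then show ?case using 0 y unfolding L_rep_Suc_hom[OF Y] by (simp add: glob_card_le_def)
next
  case (Suc n)
  have Y: "glob_card Y" using Suc.prems by (simp add: glob_card_le_def)
  have "glob_card_le (Suc (Suc n)) Y" using Suc.prems by (simp add: glob_card_le_def)
  moreover have "L_rep (Suc n) (hom_card Y y z) (mor_shift f) = gident (L_rep n (hom_card Y y z) (mor_shift f))"
    if "(y, z) \<in> set (steps (obj_list Y))" for y z
    using Suc.IH[OF glob_card_le_hom[OF Suc.prems that]] by blast
  ultimately show ?case
    unfolding L_rep_Suc_hom[OF Y, of "Suc n"] L_rep_Suc_hom[OF Y, of n] by auto
qed

lemma rep_class_gident:
  assumes X: "glob_card X" and c: "c \<in> gcells n (Gam X)"
  shows "rep_class X (Suc n) (gident c) = rep_class X n c"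
proof -
  obtain Y f where "(Y, f) \<in> rep_class X n c" using rep_class_nonempty[OF X c] by blast
  then have Y: "glob_card_le n Y" "gmor Y X f" "L_rep n Y f = c" by (auto simp: rep_class_def)
  note Y' = L_rep_ident[OF Y(1), of f]
  show ?thesis
    using iso_class_eq[OF X Y(1,2)] iso_class_eq[OF X conjunct1[OF Y'] Y(2)] Y' Y(3) by simp
qed

theorem lemma5p28:
  fixes X :: "'a gset"
  assumes "glob_card X"
  shows "omega_iso (free_glob X) (free_graph (Gam X)) L_fun"
proof -
  note X = assms
  let ?C = "free_glob X" and ?D = "free_graph (Gam X)"
  obtain N where N: "is_ncat N ?D"
    using omega_cat_free_graph[OF ordinal_graph_Gam[OF X]] by (auto simp: omega_cat_def)
  note cl = closed_ocatD[OF closed_ncat[OF N], unfolded free_graph_sel]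
  note ops = free_glob_ops[OF X]
  have id: "ident ?C n A = A" for n A by (simp add: free_glob_def)
  note L = L_fun_rep_class[OF X]
  have cells: "\<exists>c \<in> gcells n (Gam X). A = rep_class X n c" if "A \<in> ncells ?C n" for n A
    using that unfolding ncells_free_glob[OF X] by blast
  have inj: "c = d" if "rep_class X n c = rep_class X n d" "c \<in> gcells n (Gam X)" "d \<in> gcells n (Gam X)" for c d n
    using L that by metis
  have comp: "gdom m d = gcod m c"
    if "c \<in> gcells n (Gam X)" "d \<in> gcells n (Gam X)" "m < n"
      "mdom ?C m n (rep_class X n d) = mcod ?C m n (rep_class X n c)" for c d m n
  proof (rule inj)
    show "rep_class X m (gdom m d) = rep_class X m (gcod m c)"
      using that(4) ops(1)[OF that(2,3)] ops(2)[OF that(1,3)] by simp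
  qed (use cl(1)[OF that(2,3)] cl(2)[OF that(1,3)] in auto)
  have F: "ofunctor ?C ?D L_fun"
    unfolding ofunctor_def
  proof (intro conjI allI ballI impI)
    fix n A assume "A \<in> ncells ?C n"
    then obtain c where c: "c \<in> gcells n (Gam X)" "A = rep_class X n c" using cells by blast
    show "L_fun n A \<in> ncells ?D n" using c L by simp
    show "L_fun (Suc n) (ident ?C n A) = ident ?D n (L_fun n A)"
      using L[OF cl(3)[OF c(1)]] rep_class_gident[OF X c(1)] L[OF c(1)] c(2) by (simp add: id)
  next
    fix m n A assume "A \<in> ncells ?C n" and m: "m < n"
    then obtain c where c: "c \<in> gcells n (Gam X)" "A = rep_class X n c" using cells by blast
    show "L_fun m (mdom ?C m n A) = mdom ?D m n (L_fun n A)"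
      "L_fun m (mcod ?C m n A) = mcod ?D m n (L_fun n A)"
      using c m L cl(1,2) ops by simp_all
  next
    fix m n A B assume "A \<in> ncells ?C n" "B \<in> ncells ?C n" and m: "m < n \<and> mdom ?C m n B = mcod ?C m n A"
    then obtain c d where c: "c \<in> gcells n (Gam X)" "A = rep_class X n c"
      and d: "d \<in> gcells n (Gam X)" "B = rep_class X n d" using cells by metis
    have dc: "gdom m d = gcod m c" using comp c d m by blast
    show "L_fun n (mcomp ?C m n B A) = mcomp ?D m n (L_fun n B) (L_fun n A)"
      using c d m dc L cl(4)[OF c(1) d(1) _ dc] ops(3)[OF c(1) d(1) _ dc] by simp
  qed
  have G: "ofunctor ?D ?C (rep_class X)"
    unfolding ofunctor_def
    using ops rep_class_gident[OF X] by (auto simp: ncells_free_glob[OF X] id)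
  have "closed_ocat ?C"
    unfolding closed_ocat_def
  proof (intro conjI allI ballI impI)
    fix n A assume "A \<in> ncells ?C n"
    then obtain c where c: "c \<in> gcells n (Gam X)" "A = rep_class X n c" using cells by blast
    show "ident ?C n A \<in> ncells ?C (Suc n)"
      using c rep_class_gident[OF X c(1)] cl(3)[OF c(1)] unfolding id ncells_free_glob[OF X] by blast
  next
    fix m n A assume "A \<in> ncells ?C n" and m: "m < n"
    then obtain c where c: "c \<in> gcells n (Gam X)" "A = rep_class X n c" using cells by blast
    show "mdom ?C m n A \<in> ncells ?C m" "mcod ?C m n A \<in> ncells ?C m"
      using c m cl(1,2) ops unfolding ncells_free_glob[OF X] by simp_all
  next
    fix m n A B assume "A \<in> ncells ?C n" "B \<in> ncells ?C n" and m: "m < n \<and> mdom ?C m n B = mcod ?C m n A"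
    then obtain c d where c: "c \<in> gcells n (Gam X)" "A = rep_class X n c"
      and d: "d \<in> gcells n (Gam X)" "B = rep_class X n d" using cells by metis
    have dc: "gdom m d = gcod m c" using comp c d m by blast
    show "mcomp ?C m n B A \<in> ncells ?C n"
      using c d m cl(4)[OF c(1) d(1) _ dc] ops(3)[OF c(1) d(1) _ dc] unfolding ncells_free_glob[OF X] by simp
  qed
  then have "is_ncat N ?C"
  proof (rule is_ncat_reflect[of _ "{()}" _ "\<lambda>_. ?D" "\<lambda>_. L_fun"])
    show "A = B" if "A \<in> ncells ?C k" "B \<in> ncells ?C k" "\<And>i. i \<in> {()} \<Longrightarrow> L_fun k A = L_fun k B" for k A B
      using cells[OF that(1)] cells[OF that(2)] that(3) L by auto
  qed (use N F in auto)
  moreover have "rep_class X n (L_fun n A) = A" if "A \<in> ncells ?C n" for n A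
    using cells[OF that] L by auto
  ultimately show ?thesis
    unfolding omega_iso_def omega_cat_def using N F G L by (auto intro!: exI[of _ "rep_class X"])
qed

end
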